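(* Let $\Gamma$ be a graph and let $n\geq 2$ be an integer. The following are equivalent: (i) $\Gamma$ is a connected locally $T_n$ graph; (ii) $\Gamma$ is a halved graph of $(Q_n)_K$ for some $K\leq \mathrm{Aut}(Q_n)$ such that $K$ is even and $d_K\geq 7$. Moreover, the group $K$ in (ii) is unique up to conjugacy in $\mathrm{Aut}(Q_n)$: if $\Gamma$ is a halved graph of $(Q_n)_K$ and of $(Q_n)_L$ where $K,L\leq\mathrm{Aut}(Q_n)$ are even with $d_K\geq 7$ and $d_L\geq 7$, then $K$ and $L$ are conjugate in $\mathrm{Aut}(Q_n)$.
   Context: All graphs are finite, simple and undirected. For $n\geq 2$ the triangular graph $T_n$ has vertex set the $2$-subsets of $\{1,\dots,n\}$, two $2$-subsets adjacent iff they intersect in exactly one point. A graph $\Gamma$ is locally $T_n$ if for every vertex $u$ the subgraph induced on the neighbourhood $\Gamma(u)$ is isomorphic to $T_n$. The $n$-cube $Q_n$ has vertex set $\mathbb{F}_2^n$, two vectors adjacent iff their Hamming distance is $1$. $\mathrm{Aut}(Q_n)=\mathbb{F}_2^n: S_n=\mathbb{F}_2\wr S_n$, where $\mathbb{F}_2^n$ acts by translation and $S_n$ by permuting coordinates; its elements are written $(x,\sigma)$ with $x\in\mathbb{F}_2^n$, $\sigma\in S_n$. $E_n$ denotes the subspace of vectors of even weight, and $K\leq \mathrm{Aut}(Q_n)$ is called even if $K\leq E_n: S_n$. For $K\leq\mathrm{Aut}(Q_n)$, $d_K:=\min\{d_{Q_n}(x,x^k): x\in\mathbb{F}_2^n,\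 1\neq k\in K\}$ if $K\neq 1$ and $d_K:=\infty$ if $K=1$. The normal quotient $(Q_n)_K$ is the simple graph whose vertices are the $K$-orbits $x^K$ on $\mathbb{F}_2^n$, distinct orbits being adjacent iff some vertex of one is adjacent in $Q_n$ to some vertex of the other. For a connected bipartite graph $\Pi$, the distance $2$ graph $\Pi_2$ (same vertex set, adjacency = distance exactly $2$ in $\Pi$) has exactly two connected components, called the halved graphs of $\Pi$. *)

theory Defs
  imports
    "Graph_Theory.Graph_Theory"
    "HOL-Algebra.Bij"
    "HOL-Combinatorics.Permutations"
    "HOL-Library.Z2"
    "HOL-Library.Function_Algebras"
begin

text \<open>
  Finite simple undirected graphs are the symmetric loopless pair digraphs of locale
  \<^locale>\<open>pair_graph\<close>.  Isomorphism, induced subgraphs and connectedness are the library's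
  \<^const>\<open>digraph_iso\<close>, \<^const>\<open>induce_subgraph\<close> and \<^const>\<open>connected\<close>; the last one excludes
  the graph without vertices.
\<close>

section \<open>General graphs\<close>

definition neighbourhood :: "'a pair_pre_digraph \<Rightarrow> 'a \<Rightarrow> 'a set" where
  "neighbourhood G u = {v. (u, v) \<in> parcs G}"

definition is_locally :: "'a pair_pre_digraph \<Rightarrow> 'b pair_pre_digraph \<Rightarrow> bool" where
  "is_locally G H \<longleftrightarrow>
     (\<forall>u \<in> pverts G. digraph_iso (with_proj G \<restriction> neighbourhood G u) (with_proj H))"

text \<open>The path metric: least cost of a walk when every edge costs 1.\<close>

definition graph_dist :: "'a pair_pre_digraph \<Rightarrow> 'a \<Rightarrow> 'a \<Rightarrow> ereal" where
  "graph_dist G = wf_digraph.\<mu> (with_proj G) (\<lambda>_. 1)"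

definition bipartite :: "'a pair_pre_digraph \<Rightarrow> bool" where
  "bipartite G \<longleftrightarrow> (\<exists>A B. A \<union> B = pverts G \<and> A \<inter> B = {} \<and>
     (\<forall>(u, v) \<in> parcs G. u \<in> A \<and> v \<in> B \<or> u \<in> B \<and> v \<in> A))"

definition distance2_graph :: "'a pair_pre_digraph \<Rightarrow> 'a pair_pre_digraph" where
  "distance2_graph G = \<lparr> pverts = pverts G,
     parcs = {(u, v) \<in> pverts G \<times> pverts G. graph_dist G u v = 2} \<rparr>"

text \<open>
  Halved graphs are only defined for connected bipartite graphs, and being one is understood up
  to isomorphism.  Since the distance 2 graph is symmetric, its strongly connected components
  are its connected components.
\<close>

definition is_halved_graph :: "'a pair_pre_digraph \<Rightarrow> 'b pair_pre_digraph \<Rightarrow> bool" where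
  "is_halved_graph \<Gamma> P \<longleftrightarrow> connected (with_proj P) \<and> bipartite P \<and>
     (\<exists>H \<in> pre_digraph.sccs (with_proj (distance2_graph P)). digraph_iso (with_proj \<Gamma>) H)"

definition aut_group :: "'a pair_pre_digraph \<Rightarrow> ('a \<Rightarrow> 'a) monoid" where
  "aut_group G = BijGroup (pverts G) \<lparr> carrier :=
     {f \<in> Bij (pverts G). \<forall>u \<in> pverts G. \<forall>v \<in> pverts G.
        (f u, f v) \<in> parcs G \<longleftrightarrow> (u, v) \<in> parcs G} \<rparr>"

definition orbit :: "('a \<Rightarrow> 'a) set \<Rightarrow> 'a \<Rightarrow> 'a set" where
  "orbit K x = (\<lambda>k. k x) ` K"

definition normal_quotient :: "'a pair_pre_digraph \<Rightarrow> ('a \<Rightarrow> 'a) set \<Rightarrow> 'a set pair_pre_digraph" where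
  "normal_quotient G K = \<lparr> pverts = orbit K ` pverts G,
     parcs = {(A, B) \<in> (orbit K ` pverts G) \<times> (orbit K ` pverts G).
        A \<noteq> B \<and> (\<exists>a \<in> A. \<exists>b \<in> B. (a, b) \<in> parcs G)} \<rparr>"

text \<open>For trivial \<open>K\<close> this is the infimum of the empty set, which is \<open>\<infinity>\<close>.\<close>

definition min_displacement :: "'a pair_pre_digraph \<Rightarrow> ('a \<Rightarrow> 'a) set \<Rightarrow> ereal" where
  "min_displacement G K =
     Inf {graph_dist G x (k x) | x k. x \<in> pverts G \<and> k \<in> K \<and> k \<noteq> \<one>\<^bsub>aut_group G\<^esub>}"

text \<open>Conjugacy of subsets, in particular of subgroups, of a group.\<close>

definition conjugate_in :: "('g, 'm) monoid_scheme \<Rightarrow> 'g set \<Rightarrow> 'g set \<Rightarrow> bool" where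
  "conjugate_in A K L \<longleftrightarrow>
     (\<exists>g \<in> carrier A. L = (\<lambda>k. g \<otimes>\<^bsub>A\<^esub> k \<otimes>\<^bsub>A\<^esub> inv\<^bsub>A\<^esub> g) ` K)"

section \<open>Triangular graphs and cubes\<close>

definition triangular_graph :: "nat \<Rightarrow> nat set pair_pre_digraph" where
  "triangular_graph n = \<lparr> pverts = {s. s \<subseteq> {1..n} \<and> card s = 2},
     parcs = {(s, t). s \<subseteq> {1..n} \<and> card s = 2 \<and> t \<subseteq> {1..n} \<and> card t = 2 \<and> card (s \<inter> t) = 1} \<rparr>"

text \<open>
  The type \<^typ>\<open>bit\<close> is the field with two elements.  A vector of length \<open>n\<close> is a function with
  coordinates \<open>1, \<dots>, n\<close> that is extended by zero; vectors are added pointwise.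
\<close>

definition F2_vectors :: "nat \<Rightarrow> (nat \<Rightarrow> bit) set" where
  "F2_vectors n = {x. \<forall>i. i \<notin> {1..n} \<longrightarrow> x i = 0}"

definition hamming_dist :: "nat \<Rightarrow> (nat \<Rightarrow> bit) \<Rightarrow> (nat \<Rightarrow> bit) \<Rightarrow> nat" where
  "hamming_dist n x y = card {i \<in> {1..n}. x i \<noteq> y i}"

definition cube :: "nat \<Rightarrow> (nat \<Rightarrow> bit) pair_pre_digraph" where
  "cube n = \<lparr> pverts = F2_vectors n,
     parcs = {(x, y) \<in> F2_vectors n \<times> F2_vectors n. hamming_dist n x y = 1} \<rparr>"

definition even_vectors :: "nat \<Rightarrow> (nat \<Rightarrow> bit) set" where
  "even_vectors n = {x \<in> F2_vectors n. even (card {i \<in> {1..n}. x i \<noteq> 0})}"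

text \<open>
  The automorphism \<open>(x, \<sigma>)\<close> of the cube: translate by \<open>x\<close>, then move coordinate \<open>i\<close> to
  coordinate \<open>\<sigma> i\<close>.
\<close>

definition cube_aut :: "nat \<Rightarrow> (nat \<Rightarrow> bit) \<Rightarrow> (nat \<Rightarrow> nat) \<Rightarrow> (nat \<Rightarrow> bit) \<Rightarrow> (nat \<Rightarrow> bit)" where
  "cube_aut n x \<sigma> = (\<lambda>y \<in> F2_vectors n. (y + x) \<circ> Hilbert_Choice.inv \<sigma>)"

definition even_cube_group :: "nat \<Rightarrow> ((nat \<Rightarrow> bit) \<Rightarrow> (nat \<Rightarrow> bit)) set" where
  "even_cube_group n = {cube_aut n x \<sigma> | x \<sigma>. x \<in> even_vectors n \<and> \<sigma> permutes {1..n}}"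

section \<open>Well-definedness\<close>

lemma finite_F2_vectors: "finite (F2_vectors n)"
proof -
  have "finite {f. \<forall>i. (i \<in> {1..n} \<longrightarrow> f i \<in> (UNIV :: bit set)) \<and> (i \<notin> {1..n} \<longrightarrow> f i = 0)}"
  proof (rule finite_set_of_finite_funs)
    have "(UNIV :: bit set) \<subseteq> {0, 1}" by auto
    then show "finite (UNIV :: bit set)" by (rule finite_subset) simp
  qed simp
  then show ?thesis by (simp add: F2_vectors_def)
qed

lemma pair_graph_triangular_graph: "pair_graph (triangular_graph n)"
proof -
  let ?V = "{s. s \<subseteq> {1..n} \<and> card s = 2}"
  have fin: "finite ?V" by simp
  have "finite (parcs (triangular_graph n))"
    by (rule finite_subset[OF _ finite_cartesian_product[OF fin fin]])
      (auto simp: triangular_graph_def)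
  then show ?thesis
    using fin
    by unfold_locales
      (auto simp: triangular_graph_def symmetric_def Int_commute intro!: symI)
qed

lemma pair_graph_cube: "pair_graph (cube n)"
proof -
  have fin: "finite (parcs (cube n))"
    by (rule finite_subset[of _ "F2_vectors n \<times> F2_vectors n"])
      (auto simp: cube_def finite_F2_vectors)
  have "hamming_dist n x y = hamming_dist n y x" for x y
    unfolding hamming_dist_def by (rule arg_cong[where f = card], rule Collect_cong) metis
  then have "(y, x) \<in> parcs (cube n)" if "(x, y) \<in> parcs (cube n)" for x y
    using that by (simp add: cube_def)
  then have sym: "symmetric (with_proj (cube n))"
    by (auto simp: symmetric_def sym_def)
  have "hamming_dist n x x = 0" for x by (simp add: hamming_dist_def)
  then show ?thesis
    using fin sym finite_F2_vectors
    by unfold_locales (auto simp: cube_def)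
qed

lemma pair_wf_digraph_normal_quotient: "pair_wf_digraph (normal_quotient G K)"
  by unfold_locales (auto simp: normal_quotient_def)

lemma group_aut_group: "group (aut_group G)"
proof -
  let ?A = "{f \<in> Bij (pverts G). \<forall>u \<in> pverts G. \<forall>v \<in> pverts G.
        (f u, f v) \<in> parcs G \<longleftrightarrow> (u, v) \<in> parcs G}"
  have "subgroup ?A (BijGroup (pverts G))"
  proof (rule group.subgroupI[OF group_BijGroup])
    show "?A \<subseteq> carrier (BijGroup (pverts G))" by (auto simp: BijGroup_def)
    show "?A \<noteq> {}" using id_Bij[of "pverts G"] by force
  next
    fix f assume f: "f \<in> ?A"
    have *: "f (inv_into (pverts G) f u) = u" if "u \<in> pverts G" for u
      using f that by (auto simp: Bij_def bij_betw_def f_inv_into_f)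
    have "(inv_into (pverts G) f u, inv_into (pverts G) f v) \<in> parcs G \<longleftrightarrow> (u, v) \<in> parcs G"
      if uv: "u \<in> pverts G" "v \<in> pverts G" for u v
    proof -
      have "inv_into (pverts G) f u \<in> pverts G" "inv_into (pverts G) f v \<in> pverts G"
        using f uv by (auto intro: Bij_inv_into_mem)
      then have "(f (inv_into (pverts G) f u), f (inv_into (pverts G) f v)) \<in> parcs G \<longleftrightarrow>
          (inv_into (pverts G) f u, inv_into (pverts G) f v) \<in> parcs G"
        using f by blast
      then show ?thesis by (simp only: *[OF uv(1)] *[OF uv(2)])
    qed
    then show "inv\<^bsub>BijGroup (pverts G)\<^esub> f \<in> ?A"
      using f by (simp add: inv_BijGroup restrict_inv_into_Bij)
  next
    fix f g assume fg: "f \<in> ?A" "g \<in> ?A"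
    then have "g u \<in> pverts G" if "u \<in> pverts G" for u
      using that Bij_imp_funcset[of g "pverts G"] by auto
    then have "(compose (pverts G) f g u, compose (pverts G) f g v) \<in> parcs G \<longleftrightarrow>
        (u, v) \<in> parcs G" if "u \<in> pverts G" "v \<in> pverts G" for u v
      using fg that by (simp add: compose_def)
    then show "f \<otimes>\<^bsub>BijGroup (pverts G)\<^esub> g \<in> ?A"
      using fg by (simp add: BijGroup_def compose_Bij)
  qed
  then show ?thesis
    unfolding aut_group_def by (rule subgroup.subgroup_is_group[OF _ group_BijGroup])
qed

lemma cube_aut_in_aut_group:
  assumes x: "x \<in> F2_vectors n" and s: "\<sigma> permutes {1..n}"
  shows "cube_aut n x \<sigma> \<in> carrier (aut_group (cube n))"
proof -
  let ?i = "Hilbert_Choice.inv \<sigma>"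
  have i: "?i permutes {1..n}" using s by (rule permutes_inv)
  have val: "cube_aut n x \<sigma> y = (y + x) \<circ> ?i" if "y \<in> F2_vectors n" for y
    using that by (simp add: cube_aut_def)
  have maps: "(y + x) \<circ> ?i \<in> F2_vectors n" if "y \<in> F2_vectors n" for y
    using that x permutes_not_in[OF i] by (simp add: F2_vectors_def)
  have inj: "inj_on (cube_aut n x \<sigma>) (F2_vectors n)"
  proof (rule inj_onI)
    fix y z assume yz: "y \<in> F2_vectors n" "z \<in> F2_vectors n" "cube_aut n x \<sigma> y = cube_aut n x \<sigma> z"
    then have "(y + x) \<circ> ?i \<circ> \<sigma> = (z + x) \<circ> ?i \<circ> \<sigma>" by (simp add: val)
    then have "y + x = z + x" using permutes_inv_o(2)[OF s] by (simp add: comp_assoc)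
    then show "y = z" by simp
  qed
  have bij: "bij_betw (cube_aut n x \<sigma>) (F2_vectors n) (F2_vectors n)"
    unfolding bij_betw_def using inj
    by (intro conjI endo_inj_surj finite_F2_vectors) (auto simp: val maps)
  have "hamming_dist n ((y + x) \<circ> ?i) ((z + x) \<circ> ?i) = hamming_dist n y z" for y z
  proof -
    have "bij_betw ?i {j \<in> {1..n}. y (?i j) \<noteq> z (?i j)} {j \<in> {1..n}. y j \<noteq> z j}"
      by (rule bij_betw_subset[OF permutes_imp_bij[OF i]])
        (use permutes_in_image[OF i] permutes_inverses[OF s] permutes_in_image[OF s] in
          \<open>auto intro!: image_eqI[where x = "\<sigma> j" for j]\<close>)
    moreover have "((y + x) \<circ> ?i) j = ((z + x) \<circ> ?i) j \<longleftrightarrow> y (?i j) = z (?i j)" for j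
      by (simp del: add_bit_eq_xor)
    ultimately show ?thesis unfolding hamming_dist_def by (simp only: bij_betw_same_card)
  qed
  then show ?thesis
    using bij maps
    by (auto simp: aut_group_def Bij_def cube_def val) (simp add: cube_aut_def)
qed

end

theory Submission
  imports Defs
begin

text \<open>
  A frame at a vertex \<open>v\<close> of a locally \<open>T\<^sub>n\<close> graph is an isomorphism \<open>f\<close> from \<open>T\<^sub>n\<close> to its
  neighbourhood. A frame at \<open>v\<close> can be transported along the edge to \<open>f {a, b}\<close>: the new frame
  sends \<open>{a, b}\<close> to \<open>v\<close>, and \<open>{a, j}\<close>, \<open>{b, j}\<close> to \<open>f {b, j}\<close>, \<open>f {a, j}\<close>. A frame is determined
  by its values on the pairs through one point, so transport is unique, it is an involution, and
  transport along \<open>ab\<close> and then \<open>ac\<close> is transport along \<open>bc\<close>. Hence the transports along the pairs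
  through 1 commute, and their products define an action of the even vectors on frames. Following a
  fixed frame gives a map \<open>p\<close> from the even vectors to the graph such that \<open>P \<mapsto> p (x + \<chi>\<^sub>P)\<close> is a
  frame at \<open>p x\<close> for all \<open>x\<close>, where \<open>\<chi>\<^sub>P\<close> is the characteristic vector of \<open>P\<close>. Such a cover
  identifies no two vectors at distance at most 6. For \<open>n \<le> 6\<close> it is therefore injective; for \<open>n \<ge> 5\<close> two frames at
  a vertex differ by a permutation, so the fibres are the orbits of the group \<open>K\<close> of cube
  automorphisms preserving \<open>p\<close>. Conversely, if \<open>K\<close> is even with minimum displacement at least 7, the
  orbit map is a cover of each halved graph of the quotient. Covers that agree on a frame are equal,
  so two covers of the same graph differ by a cube automorphism when \<open>n \<ge> 5\<close>, and this
  automorphism conjugates their groups.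
\<close>

section \<open>Frames\<close>

text \<open>The constants have two sources. Five comes from cliques: a point of
  \<open>{1..n}\<close> is recovered from the graph as the clique of the n - 1 pairs through it, and
  only cliques of size at least 4 are sure not to be triangles. The graph T_4 is the octahedron,
  with 48 automorphisms against the 24 permutations, so there two frames at a vertex need not differ
  by a permutation. This forces a separate construction of transports for \<open>n \<le> 4\<close>
  and rules out lifting covers by cube automorphisms in small dimension; there, distances never
  exceed 6, so covers are injective and the groups are trivial. Six comes from counting pairs.
  Vectors of one parity class at distance 2, 4 or 6 differ by one, two or three disjoint pairs, and
  identifying them would give a loop, a collision inside a frame, or an edge between disjoint pairs
  of a frame. In the opposite direction, deciding adjacency inside a neighbourhood of the quotient
  compares three pairs, hence up to six coordinates, and displacement at least 7 is what makes this
  comparison faithful.\<close>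

definition pairs :: "nat \<Rightarrow> nat set set" where
  "pairs n = {P. P \<subseteq> {1..n} \<and> card P = 2}"

text \<open>An isomorphism from the triangular graph onto the neighbourhood of a vertex; the vertex itself
  is stored as the value at the empty set.\<close>

definition frame :: "nat \<Rightarrow> 'a rel \<Rightarrow> (nat set \<Rightarrow> 'a) \<Rightarrow> bool" where
  "frame n E f \<longleftrightarrow> inj_on f (pairs n) \<and> f ` pairs n = E `` {f {}} \<and>
     (\<forall>P \<in> pairs n. \<forall>Q \<in> pairs n. (f P, f Q) \<in> E \<longleftrightarrow> card (P \<inter> Q) = 1)"

lemma doubleton_in_pairs: "{a, b} \<in> pairs n \<longleftrightarrow> a \<noteq> b \<and> a \<in> {1..n} \<and> b \<in> {1..n}"
  by (cases "a = b") (auto simp: pairs_def)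

lemma pairsE:
  assumes "P \<in> pairs n"
  obtains a b where "P = {a, b}" "a \<noteq> b" "a \<in> {1..n}" "b \<in> {1..n}"
  using assms unfolding pairs_def by (auto simp: card_2_iff)

lemma pairs_memE:
  assumes "P \<in> pairs n" "a \<in> P"
  obtains b where "P = {a, b}" "a \<noteq> b" "a \<in> {1..n}" "b \<in> {1..n}"
  using assms by (elim pairsE) (auto simp: insert_commute)

lemma pairs_eq_doubleton:
  "\<lbrakk>P \<in> pairs n; a \<in> P; b \<in> P; a \<noteq> b\<rbrakk> \<Longrightarrow> P = {a, b}"
  by (elim pairsE) auto

lemma finite_pairs: "finite (pairs n)"
  by (rule finite_subset[of _ "Pow {1..n}"]) (auto simp: pairs_def)

lemma empty_not_in_pairs: "{} \<notin> pairs n"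
  by (simp add: pairs_def)

lemma card_Int_doubleton_eq_1_iff:
  assumes "a \<noteq> b"
  shows "card (P \<inter> {a, b}) = 1 \<longleftrightarrow> (a \<in> P \<longleftrightarrow> b \<notin> P)"
proof -
  have "P \<inter> {a, b} = (if a \<in> P then {a} else {}) \<union> (if b \<in> P then {b} else {})" by auto
  then show ?thesis using assms by (auto split: if_splits)
qed

lemma card_Int_pairs_eq_1_iff:
  assumes "P \<in> pairs n" "Q \<in> pairs n"
  shows "card (P \<inter> Q) = 1 \<longleftrightarrow> P \<noteq> Q \<and> P \<inter> Q \<noteq> {}"
proof -
  obtain a b c d where "P = {a, b}" "a \<noteq> b" "Q = {c, d}" "c \<noteq> d"
    using assms by (metis pairsE)
  then show ?thesis
    using card_Int_doubleton_eq_1_iff[of c d P] by auto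
qed

lemma frame_cong:
  assumes "\<And>P. P \<in> pairs n \<Longrightarrow> f P = g P" "f {} = g {}"
  shows "frame n E f \<longleftrightarrow> frame n E g"
proof -
  have "inj_on f (pairs n) \<longleftrightarrow> inj_on g (pairs n)" using assms(1) by (rule inj_on_cong)
  moreover have "f ` pairs n = g ` pairs n" using assms(1) by (rule image_cong[OF refl])
  ultimately show ?thesis using assms by (simp add: frame_def)
qed

lemma frame_adj:
  "\<lbrakk>frame n E f; P \<in> pairs n; Q \<in> pairs n\<rbrakk> \<Longrightarrow> (f P, f Q) \<in> E \<longleftrightarrow> card (P \<inter> Q) = 1"
  by (simp add: frame_def)

text \<open>Adjacency to \<open>f {a, b}\<close> is an exclusive or, so once \<open>a\<close> is
  known to lie outside \<open>P\<close> it reads off whether \<open>b\<close> lies in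
  \<open>P\<close>. This is how pairs are recovered from their neighbours.\<close>

lemma frame_adj_doubleton:
  assumes "frame n E f" "P \<in> pairs n" "{a, b} \<in> pairs n"
  shows "(f P, f {a, b}) \<in> E \<longleftrightarrow> (a \<in> P \<longleftrightarrow> b \<notin> P)"
proof -
  have "a \<noteq> b" using assms(3) by (simp add: doubleton_in_pairs)
  then show ?thesis using frame_adj[OF assms] card_Int_doubleton_eq_1_iff[of a b P] by blast
qed

lemma frame_inj:
  "\<lbrakk>frame n E f; P \<in> pairs n; Q \<in> pairs n\<rbrakk> \<Longrightarrow> f P = f Q \<longleftrightarrow> P = Q"
  by (auto simp: frame_def inj_on_def)

lemma frame_neighbour: "\<lbrakk>frame n E f; P \<in> pairs n\<rbrakk> \<Longrightarrow> (f {}, f P) \<in> E"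
  by (auto simp: frame_def)

lemma frame_onto:
  assumes "frame n E f" "(f {}, w) \<in> E"
  obtains P where "P \<in> pairs n" "w = f P"
proof -
  have "w \<in> f ` pairs n" using assms by (simp add: frame_def)
  then show ?thesis using that by blast
qed

text \<open>A pair that misses \<open>c\<close> is recovered from its neighbours among the pairs through \<open>c\<close>.\<close>

lemma frame_eq_if_agree_on_star:
  assumes f: "frame n E f" and g: "frame n E g" and base: "f {} = g {}"
    and c: "c \<in> {1..n}" and star: "\<And>j. \<lbrakk>j \<in> {1..n}; j \<noteq> c\<rbrakk> \<Longrightarrow> f {c, j} = g {c, j}"
    and P: "P \<in> pairs n"
  shows "f P = g P"
proof -
  have on_star: "f Q = g Q" if "Q \<in> pairs n" "c \<in> Q" for Q
    using that star by (metis pairs_memE)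
  show ?thesis
  proof (cases "c \<in> P")
    case True
    then show ?thesis using on_star P by blast
  next
    case False
    obtain Q where Q: "Q \<in> pairs n" "f P = g Q"
      using frame_onto[OF g] frame_neighbour[OF f P] base by metis
    \<comment> \<open>If \<open>Q\<close> contained \<open>c\<close>, the frames would agree on it,
      so \<open>f P = f Q\<close>, and \<open>P = Q\<close> would contain \<open>c\<close>.\<close>
    have cQ: "c \<notin> Q"
      using Q on_star[of Q] False frame_inj[OF f P Q(1)] by auto
    have "k \<in> P \<longleftrightarrow> k \<in> Q" if "k \<in> {1..n}" "k \<noteq> c" for k
    proof -
      have ck: "{c, k} \<in> pairs n" using that c by (simp add: doubleton_in_pairs)
      have "k \<in> P \<longleftrightarrow> (f P, f {c, k}) \<in> E"
        using frame_adj_doubleton[OF f P ck] False by simp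
      also have "\<dots> \<longleftrightarrow> (g Q, g {c, k}) \<in> E" using Q star that by simp
      also have "\<dots> \<longleftrightarrow> k \<in> Q"
        using frame_adj_doubleton[OF g Q(1) ck] cQ by simp
      finally show ?thesis .
    qed
    moreover have "P \<subseteq> {1..n}" "Q \<subseteq> {1..n}" using P Q by (auto simp: pairs_def)
    ultimately have "P = Q" using False cQ by blast
    then show ?thesis using Q by simp
  qed
qed

text \<open>Three pairwise meeting pairs may form a triangle, hence the bound 4.\<close>

lemma pairwise_meeting_pairs_share_point:
  assumes sub: "F \<subseteq> pairs n" and meet: "\<And>A B. \<lbrakk>A \<in> F; B \<in> F\<rbrakk> \<Longrightarrow> A \<inter> B \<noteq> {}"
    and four: "4 \<le> card F"
  obtains c where "\<And>A. A \<in> F \<Longrightarrow> c \<in> A"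
proof -
  have fin: "finite F" using four card.infinite by fastforce
  have more: "\<exists>D. D \<in> F \<and> D \<notin> S" if "finite S" "card S \<le> 3" for S
  proof (rule ccontr)
    assume "\<not> ?thesis"
    then have "card F \<le> card S" using that by (intro card_mono) auto
    then show False using four that by simp
  qed
  obtain A where A: "A \<in> F" using more[of "{}"] by auto
  obtain B where B: "B \<in> F" "B \<noteq> A" using more[of "{A}"] by auto
  obtain a where a: "a \<in> A" "a \<in> B" using meet[OF A B(1)] by auto
  obtain b where b: "A = {a, b}" "a \<noteq> b" using A sub a by (meson pairs_memE subsetD)
  obtain c where c: "B = {a, c}" "a \<noteq> c" using B sub a by (meson pairs_memE subsetD)
  show ?thesis
  proof (cases "\<forall>C \<in> F. a \<in> C")
    case True
    then show ?thesis using that by blast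
  next
    case False
    then obtain C where C: "C \<in> F" "a \<notin> C" by auto
    have bc: "b \<noteq> c" using b c B by auto
    have inC: "b \<in> C" "c \<in> C" using meet[OF C(1) A] meet[OF C(1) B(1)] b c C by auto
    then have C_eq: "C = {b, c}" using C sub bc by (intro pairs_eq_doubleton) auto
    \<comment> \<open>The three pairs are the sides of a triangle with corners \<open>a\<close>,
      \<open>b\<close>, \<open>c\<close>. A fourth pair meeting every side contains two corners, so
      it is itself a side.\<close>
    have "card {A, B, C} \<le> 3" by (simp add: card_insert_if)
    then obtain D where D: "D \<in> F" "D \<noteq> A" "D \<noteq> B" "D \<noteq> C" using more[of "{A, B, C}"] by auto
    have Dp: "D \<in> pairs n" using D sub by auto
    have m: "D \<inter> {a, b} \<noteq> {}" "D \<inter> {a, c} \<noteq> {}" "D \<inter> {b, c} \<noteq> {}"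
      using meet[OF D(1)] A B(1) C(1) b(1) c(1) C_eq by metis+
    have "a \<in> D \<and> b \<in> D \<or> a \<in> D \<and> c \<in> D \<or> b \<in> D \<and> c \<in> D" using m by blast
    then have "D = {a, b} \<or> D = {a, c} \<or> D = {b, c}"
      using pairs_eq_doubleton[OF Dp] b(2) c(2) bc by metis
    then have False using D b(1) c(1) C_eq by blast
    then show ?thesis ..
  qed
qed

text \<open>Adjacent vertices of a neighbourhood are labelled by meeting pairs, so a clique of size
  4 or more is labelled by pairs through one point. In this way points are recognised from
  \<open>E\<close> alone.\<close>

lemma adjacent_vertices_share_point:
  assumes f: "frame n E f" and nb: "W \<subseteq> E `` {f {}}"
    and cl: "\<And>x y. \<lbrakk>x \<in> W; y \<in> W; x \<noteq> y\<rbrakk> \<Longrightarrow> (x, y) \<in> E"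
    and four: "4 \<le> card W"
  shows "\<exists>c. \<forall>P \<in> pairs n. f P \<in> W \<longrightarrow> c \<in> P"
proof -
  define F where "F = {P \<in> pairs n. f P \<in> W}"
  have "f ` F = W"
  proof
    show "W \<subseteq> f ` F"
    proof
      fix w assume w: "w \<in> W"
      then obtain P where "P \<in> pairs n" "w = f P" using nb frame_onto[OF f, of w] by blast
      then show "w \<in> f ` F" using w by (simp add: F_def)
    qed
  qed (auto simp: F_def)
  moreover have "inj_on f F" using frame_inj[OF f] by (auto simp: F_def inj_on_def)
  ultimately have "card F = card W" by (metis card_image)
  moreover have "A \<inter> B \<noteq> {}" if "A \<in> F" "B \<in> F" for A B
  proof (cases "A = B")
    case True
    then show ?thesis using that empty_not_in_pairs by (auto simp: F_def)
  next
    case False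
    then have "card (A \<inter> B) = 1"
      using that cl[of "f A" "f B"] frame_adj[OF f] frame_inj[OF f] by (auto simp: F_def)
    then show ?thesis by auto
  qed
  moreover have "F \<subseteq> pairs n" by (auto simp: F_def)
  ultimately obtain c where "\<And>P. P \<in> F \<Longrightarrow> c \<in> P"
    using pairwise_meeting_pairs_share_point[of F n] four by metis
  then show ?thesis by (auto simp: F_def)
qed

text \<open>Relabelling the points is an automorphism of the triangular graph. It serves to adjust a
  given frame to prescribed values, and to pull covers back along cube automorphisms.\<close>

lemma frame_permute:
  assumes f: "frame n E f" and s: "\<sigma> permutes {1..n}"
  shows "frame n E (\<lambda>P. f (\<sigma> ` P))"
proof -
  have inj: "inj \<sigma>" using s by (rule permutes_inj)
  have img: "(`) \<sigma> ` pairs n = pairs n"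
  proof -
    have sub: "\<tau> ` P \<in> pairs n" if t: "\<tau> permutes {1..n}" and P: "P \<in> pairs n" for P and \<tau> :: "nat \<Rightarrow> nat"
    proof -
      have "\<tau> ` P \<subseteq> {1..n}" using P permutes_image[OF t] by (auto simp: pairs_def simp del: atLeastAtMost_iff)
      moreover have "card (\<tau> ` P) = card P"
        using permutes_inj[OF t] by (metis card_image inj_on_subset subset_UNIV)
      ultimately show ?thesis using P by (simp add: pairs_def)
    qed
    have "P \<in> (`) \<sigma> ` pairs n" if "P \<in> pairs n" for P
      using sub[OF permutes_inv[OF s] that] permutes_inv_o[OF s]
      by (intro image_eqI[of _ _ "Hilbert_Choice.inv \<sigma> ` P"]) (simp_all add: image_comp)
    then show ?thesis using sub[OF s] by auto
  qed
  have "card (\<sigma> ` P \<inter> \<sigma> ` Q) = card (P \<inter> Q)" for P Q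
    using inj by (metis card_image image_Int inj_on_subset subset_UNIV)
  moreover have "inj_on (\<lambda>P. f (\<sigma> ` P)) (pairs n)"
  proof (rule inj_onI)
    fix P Q assume PQ: "P \<in> pairs n" "Q \<in> pairs n" "f (\<sigma> ` P) = f (\<sigma> ` Q)"
    then have "\<sigma> ` P \<in> pairs n" "\<sigma> ` Q \<in> pairs n" using img by blast+
    then have "\<sigma> ` P = \<sigma> ` Q" using PQ frame_inj[OF f] by blast
    then show "P = Q" using inj by (simp add: inj_image_eq_iff)
  qed
  moreover have "(\<lambda>P. f (\<sigma> ` P)) ` pairs n = E `` {f {}}"
    using f img unfolding frame_def by (metis image_image)
  moreover have "(f (\<sigma> ` P), f (\<sigma> ` Q)) \<in> E \<longleftrightarrow> card (\<sigma> ` P \<inter> \<sigma> ` Q) = 1"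
    if "P \<in> pairs n" "Q \<in> pairs n" for P Q
    using that img by (intro frame_adj[OF f]) blast+
  ultimately show ?thesis by (simp add: frame_def)
qed

lemma inj_endo_imp_permutes:
  assumes "finite S" "inj_on \<sigma> S" "\<sigma> ` S \<subseteq> S" "\<And>i. i \<notin> S \<Longrightarrow> \<sigma> i = i"
  shows "\<sigma> permutes S"
  using assms endo_inj_surj[of S \<sigma>] by (intro bij_imp_permutes) (auto simp: bij_betw_def)

text \<open>Under \<open>f\<close> the pairs through \<open>c\<close> give a clique of size n - 1,
  which is at least 4, so \<open>g\<close> labels it by pairs through one point, taken as
  \<open>\<sigma> c\<close>. In the octahedron T_4 an automorphism can exchange such cliques with
  triangles.\<close>

lemma frames_differ_by_permutation:
  assumes n: "5 \<le> n" and f: "frame n E f" and g: "frame n E g" and base: "f {} = g {}"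
  obtains \<sigma> where "\<sigma> permutes {1..n}" "\<And>P. P \<in> pairs n \<Longrightarrow> f P = g (\<sigma> ` P)"
proof -
  have star: "\<exists>d. \<forall>P \<in> pairs n. \<forall>Q \<in> pairs n. c \<in> P \<and> g Q = f P \<longrightarrow> d \<in> Q"
    if c: "c \<in> {1..n}" for c
  proof -
    define W where "W = (\<lambda>j. f {c, j}) ` ({1..n} - {c})"
    have "card W = n - 1"
    proof -
      have "inj_on (\<lambda>j. f {c, j}) ({1..n} - {c})"
        using frame_inj[OF f] c by (auto simp: inj_on_def doubleton_in_pairs doubleton_eq_iff)
      then show ?thesis using c by (simp add: W_def card_image)
    qed
    moreover have "W \<subseteq> E `` {g {}}"
    proof
      fix w assume "w \<in> W"
      then obtain j where "j \<in> {1..n}" "j \<noteq> c" "w = f {c, j}" unfolding W_def by blast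
      then show "w \<in> E `` {g {}}"
        using frame_neighbour[OF f, of "{c, j}"] c base by (auto simp: doubleton_in_pairs)
    qed
    moreover have "(x, y) \<in> E" if "x \<in> W" "y \<in> W" "x \<noteq> y" for x y
    proof -
      obtain i j where ij: "i \<in> {1..n}" "i \<noteq> c" "x = f {c, i}" "j \<in> {1..n}" "j \<noteq> c" "y = f {c, j}"
        using \<open>x \<in> W\<close> \<open>y \<in> W\<close> unfolding W_def by blast
      then show ?thesis
        using frame_adj_doubleton[OF f, of "{c, i}" c j] \<open>x \<noteq> y\<close> c by (auto simp: doubleton_in_pairs)
    qed
    moreover have "4 \<le> card W" using n \<open>card W = n - 1\<close> by simp
    ultimately obtain d where d: "\<And>P. \<lbrakk>P \<in> pairs n; g P \<in> W\<rbrakk> \<Longrightarrow> d \<in> P"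
      using adjacent_vertices_share_point[OF g, of W] by blast
    have "d \<in> Q" if "P \<in> pairs n" "Q \<in> pairs n" "c \<in> P" "g Q = f P" for P Q
      using that d[of Q] by (auto simp: W_def elim!: pairs_memE[of P n c])
    then show ?thesis by blast
  qed
  then obtain s where s: "\<And>c P Q. \<lbrakk>c \<in> {1..n}; P \<in> pairs n; Q \<in> pairs n; c \<in> P; g Q = f P\<rbrakk> \<Longrightarrow> s c \<in> Q"
    by metis
  define \<sigma> where "\<sigma> = (\<lambda>i. if i \<in> {1..n} then s i else i)"
  have pre: "\<exists>Q \<in> pairs n. g Q = f P" if "P \<in> pairs n" for P
    using frame_neighbour[OF f that] frame_onto[OF g] base by metis
  have range: "\<sigma> c \<in> {1..n}" if c: "c \<in> {1..n}" for c
  proof -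
    obtain d where d: "d \<in> {1..n}" "d \<noteq> c" using n that[of "if c = 1 then 2 else 1"] by auto
    then obtain Q where "Q \<in> pairs n" "g Q = f {c, d}" using pre[of "{c, d}"] c by (auto simp: doubleton_in_pairs)
    then have "\<sigma> c \<in> Q" using s[of c "{c, d}" Q] c \<open>d \<in> {1..n}\<close> \<open>d \<noteq> c\<close> by (simp add: \<sigma>_def doubleton_in_pairs)
    then show ?thesis using \<open>Q \<in> pairs n\<close> by (auto simp: pairs_def)
  qed
  have inj: "c = d" if cd: "c \<in> {1..n}" "d \<in> {1..n}" "\<sigma> c = \<sigma> d" for c d
  proof (rule ccontr)
    assume ne: "c \<noteq> d"
    \<comment> \<open>The aim is to choose \<open>i\<close> and \<open>j\<close> with
      \<open>{c, i}\<close> and \<open>{d, j}\<close> disjoint. Their labels under \<open>g\<close>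
      would share the point \<open>\<sigma> c\<close>, forcing adjacency of vertices that are not
      adjacent.\<close>
    have "\<exists>i \<in> {1..n}. i \<notin> S" if "finite S" "card S \<le> 3" for S
    proof (rule ccontr)
      assume "\<not> ?thesis"
      then have "card {1..n} \<le> card S" using that by (intro card_mono) auto
      then show False using n that by simp
    qed note ex = this
    have "card {c, d} \<le> 3" by (simp add: card_insert_if)
    then obtain i where i: "i \<in> {1..n}" "i \<notin> {c, d}" using ex[of "{c, d}"] by auto
    have "card {c, d, i} \<le> 3" by (simp add: card_insert_if)
    then obtain j where j: "j \<in> {1..n}" "j \<notin> {c, d, i}" using ex[of "{c, d, i}"] by auto
    have p: "{c, i} \<in> pairs n" "{d, j} \<in> pairs n"
      using i j cd(1,2) by (auto simp: doubleton_in_pairs)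
    obtain Q R where Q: "Q \<in> pairs n" "g Q = f {c, i}" and R: "R \<in> pairs n" "g R = f {d, j}"
      using pre[OF p(1)] pre[OF p(2)] by auto
    have "\<sigma> c \<in> Q \<inter> R"
      using s[of c "{c, i}" Q] s[of d "{d, j}" R] cd Q R p by (auto simp: \<sigma>_def)
    moreover have "Q \<noteq> R"
      using Q R frame_inj[OF f p] ne i j by (auto simp: doubleton_eq_iff)
    ultimately have "(g Q, g R) \<in> E"
      using frame_adj[OF g Q(1) R(1)] card_Int_pairs_eq_1_iff[OF Q(1) R(1)] by auto
    then have "card ({c, i} \<inter> {d, j}) = 1" using frame_adj[OF f p] Q R by simp
    moreover have "{c, i} \<inter> {d, j} = {}" using i j ne by auto
    ultimately show False by simp
  qed
  have perm: "\<sigma> permutes {1..n}"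
  proof (rule inj_endo_imp_permutes)
    show "inj_on \<sigma> {1..n}" using inj by (rule inj_onI)
    show "\<sigma> ` {1..n} \<subseteq> {1..n}" using range by blast
  qed (auto simp: \<sigma>_def)
  have "f P = g (\<sigma> ` P)" if P: "P \<in> pairs n" for P
  proof -
    obtain c d where cd: "P = {c, d}" "c \<noteq> d" "c \<in> {1..n}" "d \<in> {1..n}" using P by (rule pairsE)
    obtain Q where Q: "Q \<in> pairs n" "g Q = f P" using pre[OF P] by auto
    have "\<sigma> c \<in> Q" "\<sigma> d \<in> Q" using s[OF _ P Q(1) _ Q(2)] cd by (auto simp: \<sigma>_def)
    moreover have "\<sigma> c \<noteq> \<sigma> d" using inj cd by auto
    ultimately have "Q = {\<sigma> c, \<sigma> d}" using Q(1) by (intro pairs_eq_doubleton)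
    then show ?thesis using Q cd by simp
  qed
  then show ?thesis using that perm by blast
qed


section \<open>Transport of frames along edges\<close>

text \<open>This is how neighbours are renamed when the base \<open>x\<close> of a halved cube moves
  to \<open>x + chi {a, b}\<close>: adding \<open>chi {a, j}\<close> to the new base gives
  \<open>x + chi {b, j}\<close>. Pairs disjoint from \<open>{a, b}\<close> are left to the frame
  condition, since the pairs through \<open>a\<close> already determine a frame.\<close>

definition is_transport ::
  "nat \<Rightarrow> 'a rel \<Rightarrow> nat \<Rightarrow> nat \<Rightarrow> (nat set \<Rightarrow> 'a) \<Rightarrow> (nat set \<Rightarrow> 'a) \<Rightarrow> bool" where
  "is_transport n E a b f g \<longleftrightarrow> frame n E g \<and> g {} = f {a, b} \<and> g {a, b} = f {} \<and>
     (\<forall>j \<in> {1..n} - {a, b}. g {a, j} = f {b, j} \<and> g {b, j} = f {a, j})"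

lemma is_transport_star:
  assumes "is_transport n E a b f g" "j \<in> {1..n}" "j \<noteq> a" "j \<noteq> b"
  shows "g {a, j} = f {b, j}" "g {b, j} = f {a, j}"
  using assms by (simp_all add: is_transport_def)

lemma is_transport_swap: "is_transport n E a b f g \<longleftrightarrow> is_transport n E b a f g"
  unfolding is_transport_def by (metis insert_commute)

lemma is_transport_sym:
  assumes "frame n E f" "is_transport n E a b f g"
  shows "is_transport n E a b g f"
  using assms by (simp add: is_transport_def)

lemma is_transport_unique:
  assumes f: "is_transport n E a b f g" "is_transport n E a b f h"
    and ab: "a \<in> {1..n}" "b \<in> {1..n}" "a \<noteq> b" and P: "P \<in> pairs n"
  shows "g P = h P"
proof (rule frame_eq_if_agree_on_star[of n E g h a])
  show "frame n E g" "frame n E h" "g {} = h {}" using f by (simp_all add: is_transport_def)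
  show "g {a, j} = h {a, j}" if "j \<in> {1..n}" "j \<noteq> a" for j
    using f that by (cases "j = b") (auto simp: is_transport_def)
qed (use ab P in auto)

text \<open>Transport along \<open>ab\<close> followed by transport along \<open>ac\<close> is transport along \<open>bc\<close>:
  the two results agree on the pairs through \<open>c\<close>.\<close>

lemma is_transport_compose:
  assumes f: "frame n E f" and g: "is_transport n E a b f g" and h: "is_transport n E a c g h"
    and k: "is_transport n E b c f k"
    and abc: "a \<in> {1..n}" "b \<in> {1..n}" "c \<in> {1..n}" "a \<noteq> b" "a \<noteq> c" "b \<noteq> c"
  shows "h {} = k {}" and "P \<in> pairs n \<Longrightarrow> h P = k P"
proof -
  show base: "h {} = k {}"
    using g h k abc by (simp add: is_transport_def)
  have star: "h {c, j} = k {c, j}" if j: "j \<in> {1..n}" "j \<noteq> c" for j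
  proof -
    consider "j = a" | "j = b" | "j \<noteq> a" "j \<noteq> b" by auto
    then show ?thesis
    proof cases
      case 1
      have "h {a, c} = g {}" "g {} = f {a, b}" using g h by (simp_all only: is_transport_def)
      moreover have "k {c, a} = f {b, a}" using is_transport_star(2)[OF k abc(1,4,5)] .
      ultimately show ?thesis using 1 by (simp add: insert_commute)
    next
      case 2
      have "g {a, b} = f {}" "k {b, c} = f {}" using g k by (simp_all only: is_transport_def)
      moreover have "h {c, b} = g {a, b}" using is_transport_star(2)[OF h abc(2)] abc by metis
      ultimately show ?thesis using 2 by (simp add: insert_commute)
    next
      case 3
      have "h {c, j} = g {a, j}" using is_transport_star(2)[OF h] j 3 by blast
      also have "\<dots> = f {b, j}" using is_transport_star(1)[OF g] j 3 by blast
      also have "\<dots> = k {c, j}" using is_transport_star(2)[OF k] j 3 by simp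
      finally show ?thesis .
    qed
  qed
  show "h P = k P" if "P \<in> pairs n"
  proof (rule frame_eq_if_agree_on_star[OF _ _ base abc(3) star that])
    show "frame n E h" "frame n E k" using h k by (simp_all add: is_transport_def)
  qed
qed

lemma ex_permutation_doubleton:
  assumes "a \<in> S" "b \<in> S" "a \<noteq> b" "c \<in> S" "d \<in> S" "c \<noteq> d"
  obtains \<sigma> where "\<sigma> permutes S" "\<sigma> a = c" "\<sigma> b = d"
proof -
  \<comment> \<open>\<open>b'\<close> is where the first transposition takes \<open>b\<close>. As
    neither \<open>b'\<close> nor \<open>d\<close> equals \<open>c\<close>, the second transposition
    leaves the image of \<open>a\<close> in place.\<close>
  define b' where "b' = transpose a c b"
  have b': "b' \<in> S" "b' \<noteq> c" using assms by (auto simp: b'_def transpose_def)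
  have "transpose b' d \<circ> transpose a c permutes S"
    using assms b' by (intro permutes_compose permutes_swap_id)
  moreover have "(transpose b' d \<circ> transpose a c) a = c" "(transpose b' d \<circ> transpose a c) b = d"
    using assms b' by (simp_all add: b'_def[symmetric] transpose_def[of b' d])
  ultimately show ?thesis using that by blast
qed

text \<open>For \<open>n \<le> 4\<close> a pair meeting \<open>{a, b}\<close> in one point also meets every pair disjoint from
  \<open>{a, b}\<close> in one point, so the frame at \<open>f {a, b}\<close> may be altered freely on the common
  neighbours of \<open>f {}\<close> and \<open>f {a, b}\<close>.\<close>

lemma transport_exists_small:
  assumes n: "n \<le> 4" and symE: "sym E" and f: "frame n E f"
    and h0: "frame n E h0" "h0 {} = f {a, b}"
    and ab: "a \<in> {1..n}" "b \<in> {1..n}" "a \<noteq> b"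
  shows "\<exists>g. is_transport n E a b f g"
proof -
  have abp: "{a, b} \<in> pairs n" using ab by (simp add: doubleton_in_pairs)
  have "(f {a, b}, f {}) \<in> E" using frame_neighbour[OF f abp] symE by (blast dest: symD)
  then obtain T where T: "T \<in> pairs n" "f {} = h0 T" using frame_onto[OF h0(1)] h0(2) by metis
  obtain c d where cd: "T = {c, d}" "c \<noteq> d" "c \<in> {1..n}" "d \<in> {1..n}" using T by (metis pairsE)
  \<comment> \<open>Aligning \<open>T\<close> with \<open>{a, b}\<close> gives a frame at the right
    vertex with the right value at \<open>{a, b}\<close>; only its values on the common neighbours
    remain to be corrected.\<close>
  obtain \<sigma> where s: "\<sigma> permutes {1..n}" "\<sigma> a = c" "\<sigma> b = d"
    using ex_permutation_doubleton ab cd by metis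
  define h where "h = (\<lambda>P. h0 (\<sigma> ` P))"
  have h: "frame n E h" "h {} = f {a, b}" "h {a, b} = f {}"
    using frame_permute[OF h0(1) s(1)] h0 s T cd by (simp_all add: h_def)
  \<comment> \<open>\<open>M\<close> indexes the common neighbours of \<open>f {}\<close> and
    \<open>f {a, b}\<close>, for \<open>f\<close> as well as for \<open>h\<close>. On
    \<open>M\<close>, \<open>flip\<close> exchanges \<open>a\<close> and \<open>b\<close>, which is
    the renaming that a transport performs.\<close>
  define M where "M = {P \<in> pairs n. card (P \<inter> {a, b}) = 1}"
  define flip where "flip P = sym_diff P {a, b}" for P :: "nat set"
  have M_cases: "\<exists>j \<in> {1..n} - {a, b}. P = {a, j} \<or> P = {b, j}" if P: "P \<in> M" for P
  proof -
    have Pp: "P \<in> pairs n" and m: "a \<in> P \<longleftrightarrow> b \<notin> P"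
      using P card_Int_doubleton_eq_1_iff[OF ab(3), of P] by (auto simp: M_def)
    show ?thesis
    proof (cases "a \<in> P")
      case True
      then obtain j where j: "P = {a, j}" "j \<in> {1..n}" "a \<noteq> j" using Pp by (metis pairs_memE)
      then have "j \<noteq> b" using m by blast
      then show ?thesis using j by blast
    next
      case False
      then have "b \<in> P" using m by simp
      then obtain j where j: "P = {b, j}" "j \<in> {1..n}" "b \<noteq> j" using Pp by (metis pairs_memE)
      then have "j \<noteq> a" using False by blast
      then show ?thesis using j by blast
    qed
  qed
  have flip_M: "flip {a, j} = {b, j}" "flip {b, j} = {a, j}" if "j \<notin> {a, b}" for j
    using that ab by (auto simp: flip_def)
  have in_M: "{a, j} \<in> M" "{b, j} \<in> M" if "j \<in> {1..n} - {a, b}" for j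
    using that ab card_Int_doubleton_eq_1_iff[OF ab(3), of "{a, j}"]
      card_Int_doubleton_eq_1_iff[OF ab(3), of "{b, j}"]
    by (auto simp: M_def doubleton_in_pairs)
  have flip_in_M: "flip P \<in> M" and flip_flip: "flip (flip P) = P" if P: "P \<in> M" for P
    using M_cases[OF P] flip_M in_M by force+
  have flip_meet: "card (flip P \<inter> flip Q) = 1 \<longleftrightarrow> card (P \<inter> Q) = 1" if PQ: "P \<in> M" "Q \<in> M" for P Q
  proof -
    obtain i j where i: "i \<in> {1..n} - {a, b}" "P = {a, i} \<or> P = {b, i}"
      and j: "j \<in> {1..n} - {a, b}" "Q = {a, j} \<or> Q = {b, j}"
      using M_cases[OF PQ(1)] M_cases[OF PQ(2)] by blast
    have ij: "i \<notin> {a, b}" "j \<notin> {a, b}" using i(1) j(1) by blast+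
    have same: "card ({x, i} \<inter> {x, j}) = 1 \<longleftrightarrow> i \<noteq> j" if "x \<in> {a, b}" for x
      using card_Int_doubleton_eq_1_iff[of x j "{x, i}"] that ij by blast
    have different: "card ({x, i} \<inter> {y, j}) = 1 \<longleftrightarrow> i = j" if "x \<in> {a, b}" "y \<in> {a, b}" "x \<noteq> y" for x y
      using card_Int_doubleton_eq_1_iff[of y j "{x, i}"] that ij by blast
    show ?thesis
      using i(2) j(2) flip_M[OF ij(1)] flip_M[OF ij(2)] same[of a] same[of b]
        different[of a b] different[of b a] ab(3)
      by (metis insertCI)
  qed
  have adj_M: "(h P, h {a, b}) \<in> E \<longleftrightarrow> P \<in> M" if "P \<in> pairs n" for P
    using that frame_adj[OF h(1) that abp] by (simp add: M_def)
  \<comment> \<open>\<open>f (flip P)\<close> is adjacent to both ends of the edge, so its label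
    under \<open>h\<close> lies in \<open>M\<close> again.\<close>
  have "\<exists>Q \<in> M. h Q = f (flip P)" if P: "P \<in> M" for P
  proof -
    have fP: "flip P \<in> pairs n" "card (flip P \<inter> {a, b}) = 1" using flip_in_M[OF P] by (auto simp: M_def)
    have "(f (flip P), f {a, b}) \<in> E" using frame_adj[OF f fP(1) abp] fP by simp
    then have "(h {}, f (flip P)) \<in> E" using h symE by (auto dest: symD)
    then obtain Q where Q: "Q \<in> pairs n" "f (flip P) = h Q" using frame_onto[OF h(1)] by metis
    have "(h Q, h {a, b}) \<in> E"
      using frame_neighbour[OF f fP(1)] Q h symE by (auto dest: symD)
    then show ?thesis using Q adj_M by auto
  qed
  then obtain \<psi> where \<psi>: "\<And>P. P \<in> M \<Longrightarrow> \<psi> P \<in> M" "\<And>P. P \<in> M \<Longrightarrow> h (\<psi> P) = f (flip P)" by metis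
  \<comment> \<open>Neither \<open>{}\<close> nor \<open>{a, b}\<close> lies in \<open>M\<close>, so
    this correction preserves the two values of \<open>h\<close> that are already right.\<close>
  define \<phi> where "\<phi> P = (if P \<in> M then \<psi> P else P)" for P
  define g where "g P = h (\<phi> P)" for P
  have M_pairs: "P \<in> pairs n" if "P \<in> M" for P using that by (simp add: M_def)
  have \<phi>_M: "\<phi> P \<in> M \<longleftrightarrow> P \<in> M" for P by (simp add: \<phi>_def \<psi>)
  have \<phi>_pairs: "\<phi> P \<in> pairs n" if "P \<in> pairs n" for P using that \<psi> M_pairs by (simp add: \<phi>_def)
  have \<phi>_inj: "inj_on \<phi> (pairs n)"
  proof (rule inj_onI)
    fix P Q assume PQ: "P \<in> pairs n" "Q \<in> pairs n" "\<phi> P = \<phi> Q"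
    show "P = Q"
    proof (cases "P \<in> M")
      case True
      then have "Q \<in> M" using PQ \<phi>_M by metis
      then have "f (flip P) = f (flip Q)" using \<psi>[OF True] \<psi>[of Q] True PQ by (simp add: \<phi>_def)
      then have "flip P = flip Q"
        using frame_inj[OF f] M_pairs flip_in_M True \<open>Q \<in> M\<close> by metis
      then show ?thesis using flip_flip True \<open>Q \<in> M\<close> by metis
    next
      case False
      then have "Q \<notin> M" using PQ \<phi>_M by metis
      then show ?thesis using False PQ by (simp add: \<phi>_def)
    qed
  qed
  then have \<phi>_img: "\<phi> ` pairs n = pairs n"
    using \<phi>_pairs by (intro endo_inj_surj finite_pairs) auto
  \<comment> \<open>The bound \<open>n \<le> 4\<close> enters here: \<open>{1..n} - {a, b}\<close>
    has at most two points, so a pair inside it is all of it and contains the second point of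
    \<open>P\<close>.\<close>
  have M_disj: "card (P \<inter> Q) = 1" if P: "P \<in> M" and Q: "Q \<in> pairs n" "Q \<inter> {a, b} = {}" for P Q
  proof -
    obtain j where j: "j \<in> {1..n} - {a, b}" "P = {a, j} \<or> P = {b, j}" using M_cases[OF P] by blast
    have "Q \<subseteq> {1..n} - {a, b}" using Q by (auto simp: pairs_def)
    moreover have "card ({1..n} - {a, b}) \<le> 2" using ab n by (simp add: card_Diff_subset)
    moreover have "card Q = 2" using Q by (simp add: pairs_def)
    ultimately have "Q = {1..n} - {a, b}" by (intro card_seteq) auto
    then have "P \<inter> Q = {j}" using j by auto
    then show ?thesis by simp
  qed
  have not_M: "P = {a, b} \<or> P \<inter> {a, b} = {}" if "P \<in> pairs n" "P \<notin> M" for P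
    using that card_Int_doubleton_eq_1_iff[OF ab(3), of P] pairs_eq_doubleton[OF that(1) _ _ ab(3)]
    by (auto simp: M_def)
  have one_side: "card (P \<inter> Q) = 1 \<longleftrightarrow> Q \<inter> {a, b} = {} \<or> Q = {a, b}"
    if "P \<in> M" "Q \<in> pairs n" "Q \<notin> M" for P Q
    using M_disj that not_M by (auto simp: M_def)
  \<comment> \<open>For two members of \<open>M\<close> both sides express the same adjacency in
    \<open>E\<close>, read once through \<open>h\<close> and once through \<open>f\<close>. In the
    mixed cases the answer depends only on the pair outside \<open>M\<close>.\<close>
  have meet: "card (\<phi> P \<inter> \<phi> Q) = 1 \<longleftrightarrow> card (P \<inter> Q) = 1" if PQ: "P \<in> pairs n" "Q \<in> pairs n" for P Q
  proof -
    consider "P \<in> M" "Q \<in> M" | "P \<in> M" "Q \<notin> M" | "P \<notin> M" "Q \<in> M" | "P \<notin> M" "Q \<notin> M" by blast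
    then show ?thesis
    proof cases
      case 1
      have "card (\<phi> P \<inter> \<phi> Q) = 1 \<longleftrightarrow> (h (\<psi> P), h (\<psi> Q)) \<in> E"
        using 1 \<psi> M_pairs frame_adj[OF h(1), of "\<psi> P" "\<psi> Q"] by (simp add: \<phi>_def)
      also have "\<dots> \<longleftrightarrow> card (flip P \<inter> flip Q) = 1"
        using 1 \<psi> flip_in_M M_pairs frame_adj[OF f, of "flip P" "flip Q"] by simp
      finally show ?thesis using flip_meet 1 by simp
    next
      case 2
      then show ?thesis using one_side[of P Q] one_side[of "\<psi> P" Q] \<psi> PQ by (simp add: \<phi>_def)
    next
      case 3
      then show ?thesis using one_side[of Q P] one_side[of "\<psi> Q" P] \<psi> PQ
        by (simp add: \<phi>_def Int_commute)
    qed (simp add: \<phi>_def)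
  qed
  have "{} \<notin> M" "{a, b} \<notin> M" using ab by (auto simp: M_def pairs_def)
  then have base: "g {} = f {a, b}" "g {a, b} = f {}" using h by (simp_all add: g_def \<phi>_def)
  have "frame n E g"
    unfolding frame_def
  proof (intro conjI ballI)
    show "inj_on g (pairs n)"
    proof (rule inj_onI)
      fix P Q assume PQ: "P \<in> pairs n" "Q \<in> pairs n" "g P = g Q"
      then have "\<phi> P = \<phi> Q" using frame_inj[OF h(1)] \<phi>_pairs by (simp add: g_def)
      then show "P = Q" using \<phi>_inj PQ by (simp add: inj_on_eq_iff)
    qed
    have "g ` pairs n = h ` pairs n" unfolding g_def using \<phi>_img by (metis image_image)
    then show "g ` pairs n = E `` {g {}}" using h base by (simp add: frame_def)
    show "(g P, g Q) \<in> E \<longleftrightarrow> card (P \<inter> Q) = 1" if "P \<in> pairs n" "Q \<in> pairs n" for P Q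
      using that meet frame_adj[OF h(1)] \<phi>_pairs by (simp add: g_def)
  qed
  moreover have "g {a, j} = f {b, j} \<and> g {b, j} = f {a, j}" if "j \<in> {1..n} - {a, b}" for j
    using that in_M[OF that] flip_M[of j] \<psi> by (simp add: g_def \<phi>_def)
  ultimately show ?thesis using base by (auto simp: is_transport_def)
qed

text \<open>For \<open>n \<ge> 5\<close> the vertex \<open>f {}\<close> and the common neighbours \<open>f {a, j}\<close> form a clique of size
  at least 4 around \<open>f {a, b}\<close>, so they correspond to pairs through one point.\<close>

lemma transport_exists_large:
  assumes n: "5 \<le> n" and symE: "sym E" and irreflE: "irrefl E" and f: "frame n E f"
    and h: "frame n E h" "h {} = f {a, b}"
    and ab: "a \<in> {1..n}" "b \<in> {1..n}" "a \<noteq> b"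
  shows "\<exists>g. is_transport n E a b f g"
proof -
  \<comment> \<open>Applied with \<open>x\<close>, \<open>y\<close> in both orders. The clique
    consists of \<open>f {}\<close> and the n - 2 vertices \<open>f {x, j}\<close>, all adjacent to
    \<open>f {x, y}\<close>.\<close>
  have clique: "\<exists>z. \<forall>P \<in> pairs n. (h P = f {} \<or> (\<exists>j \<in> {1..n} - {x, y}. h P = f {x, j})) \<longrightarrow> z \<in> P"
    if xy: "{x, y} = {a, b}" for x y
  proof -
    have xyn: "x \<in> {1..n}" "y \<in> {1..n}" "x \<noteq> y" using xy ab by (auto simp: doubleton_eq_iff)
    define S where "S = {1..n} - {x, y}"
    define W where "W = insert (f {}) ((\<lambda>j. f {x, j}) ` S)"
    have xj: "{x, j} \<in> pairs n" if "j \<in> S" for j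
      using that xyn by (auto simp: S_def doubleton_in_pairs)
    have xyp: "{x, y} \<in> pairs n" using xyn by (simp add: doubleton_in_pairs)
    have fresh: "f {} \<noteq> f P" if "P \<in> pairs n" for P
      using frame_neighbour[OF f that] irreflE by (auto simp: irrefl_def)
    have inj: "inj_on (\<lambda>j. f {x, j}) S"
    proof (rule inj_onI)
      fix i j assume "i \<in> S" "j \<in> S" "f {x, i} = f {x, j}"
      then show "i = j" using frame_inj[OF f xj xj] by (auto simp: doubleton_eq_iff)
    qed
    have "card S = n - 2" using xyn by (simp add: S_def card_Diff_subset)
    moreover have "f {} \<notin> (\<lambda>j. f {x, j}) ` S" using fresh xj by blast
    ultimately have "card W = n - 1" using n inj by (simp add: W_def card_image S_def)
    then have "4 \<le> card W" using n by simp
    moreover have "W \<subseteq> E `` {h {}}"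
    proof
      fix w assume "w \<in> W"
      then consider "w = f {}" | j where "j \<in> S" "w = f {x, j}" unfolding W_def by blast
      then show "w \<in> E `` {h {}}"
      proof cases
        case 1
        then show ?thesis using frame_neighbour[OF f xyp] symE h(2) xy by (auto dest: symD)
      next
        case 2
        then have "(f {x, j}, f {x, y}) \<in> E"
          using frame_adj_doubleton[OF f xj xyp] xyn by (auto simp: S_def)
        then show ?thesis using 2 symE h(2) xy by (auto dest: symD)
      qed
    qed
    moreover have "(v, w) \<in> E" if "v \<in> W" "w \<in> W" "v \<noteq> w" for v w
    proof -
      have 1: "(f {}, f {x, j}) \<in> E" if "j \<in> S" for j using frame_neighbour[OF f xj[OF that]] .
      have 2: "(f {x, i}, f {x, j}) \<in> E" if "i \<in> S" "j \<in> S" "i \<noteq> j" for i j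
        using frame_adj_doubleton[OF f xj xj] that by (auto simp: S_def)
      have "v = f {} \<or> (\<exists>i \<in> S. v = f {x, i})" "w = f {} \<or> (\<exists>i \<in> S. w = f {x, i})"
        using that unfolding W_def by blast+
      then show ?thesis using 1 2 symD[OF symE] \<open>v \<noteq> w\<close> by metis
    qed
    ultimately obtain z where "\<forall>P \<in> pairs n. h P \<in> W \<longrightarrow> z \<in> P"
      using adjacent_vertices_share_point[OF h(1), of W] by blast
    then show ?thesis unfolding W_def S_def by blast
  qed
  define S where "S = {1..n} - {a, b}"
  \<comment> \<open>The names cross over: a transport sends \<open>{b, j}\<close> to
    \<open>f {a, j}\<close>, so the point shared by the clique through \<open>a\<close> has to
    become the image of \<open>b\<close>.\<close>
  obtain b' where b'0: "h P = f {} \<Longrightarrow> b' \<in> P" and b'1: "\<lbrakk>j \<in> S; h P = f {a, j}\<rbrakk> \<Longrightarrow> b' \<in> P"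
    if "P \<in> pairs n" for P j
    using clique[of a b] unfolding S_def by blast
  have S_swap: "{1..n} - {b, a} = S" by (auto simp: S_def)
  obtain a' where a'0: "h P = f {} \<Longrightarrow> a' \<in> P" and a'1: "\<lbrakk>j \<in> S; h P = f {b, j}\<rbrakk> \<Longrightarrow> a' \<in> P"
    if "P \<in> pairs n" for P j
    using clique[of b a, unfolded S_swap, OF insert_commute] by blast
  have aj: "{a, j} \<in> pairs n" "{b, j} \<in> pairs n" if "j \<in> S" for j
    using that ab by (auto simp: S_def doubleton_in_pairs)
  have abp: "{a, b} \<in> pairs n" using ab by (simp add: doubleton_in_pairs)
  have fresh: "f {} \<noteq> f P" if "P \<in> pairs n" for P
    using frame_neighbour[OF f that] irreflE by (auto simp: irrefl_def)
  have pre: "\<exists>P \<in> pairs n. h P = w" if "(w, f {a, b}) \<in> E" for w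
    using frame_onto[OF h(1), of w] h(2) symE that by (metis symD)
  obtain U where U: "U \<in> pairs n" "h U = f {}" using pre frame_neighbour[OF f abp] by metis
  have "\<exists>P \<in> pairs n. h P = f {a, j}" "\<exists>P \<in> pairs n. h P = f {b, j}" if "j \<in> S" for j
    using pre frame_adj_doubleton[OF f aj(1)[OF that] abp] frame_adj_doubleton[OF f aj(2)[OF that] abp]
      ab that by (auto simp: S_def)
  then obtain A B where A: "\<And>j. j \<in> S \<Longrightarrow> A j \<in> pairs n" "\<And>j. j \<in> S \<Longrightarrow> h (A j) = f {a, j}"
    and B: "\<And>j. j \<in> S \<Longrightarrow> B j \<in> pairs n" "\<And>j. j \<in> S \<Longrightarrow> h (B j) = f {b, j}" by metis
  \<comment> \<open>Two different indices in \<open>S\<close> are needed to separate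
    \<open>a'\<close> from \<open>b'\<close>: a common point would lie in both \<open>A j\<close>
    and \<open>B k\<close>, whose vertices are not adjacent.\<close>
  have "card S = n - 2" using ab by (simp add: S_def card_Diff_subset)
  then have "\<not> card S \<le> 1" using n by simp
  then obtain j k where jk: "j \<in> S" "k \<in> S" "j \<noteq> k"
    by (metis card_le_Suc0_iff_eq card.infinite One_nat_def le0)
  have meet: "A i \<inter> B j \<noteq> {} \<longleftrightarrow> i = j" if ij: "i \<in> S" "j \<in> S" for i j
  proof -
    have "A i \<noteq> B j"
    proof
      assume "A i = B j"
      then have "f {a, i} = f {b, j}" using A B ij by metis
      then have "{a, i} = {b, j}" using frame_inj[OF f] aj ij by metis
      then show False using ab ij by (auto simp: doubleton_eq_iff S_def)
    qed
    then have "A i \<inter> B j \<noteq> {} \<longleftrightarrow> (h (A i), h (B j)) \<in> E"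
      using frame_adj[OF h(1)] card_Int_pairs_eq_1_iff A(1) B(1) ij by metis
    also have "\<dots> \<longleftrightarrow> (f {a, i}, f {b, j}) \<in> E" using A B ij by simp
    also have "\<dots> \<longleftrightarrow> i = j"
      using frame_adj_doubleton[OF f aj(1)[OF ij(1)] aj(2)[OF ij(2)]] ab ij by (auto simp: S_def)
    finally show ?thesis .
  qed
  have ne: "a' \<noteq> b'"
  proof
    assume "a' = b'"
    then have "b' \<in> A j \<inter> B k"
      using b'1[OF A(1) _ A(2)] a'1[OF B(1) _ B(2)] jk by blast
    then show False using meet jk by blast
  qed
  have U_eq: "U = {a', b'}" using U a'0 b'0 ne by (intro pairs_eq_doubleton) auto
  \<comment> \<open>\<open>A j\<close> and \<open>B j\<close> meet, but neither in \<open>a'\<close>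
    nor in \<open>b'\<close>, since a pair containing both points is \<open>U\<close>, the label of
    \<open>f {}\<close>. Their common point is the image of \<open>j\<close>.\<close>
  have "\<exists>s. A j = {b', s} \<and> B j = {a', s} \<and> s \<in> {1..n} - {a', b'}" if j: "j \<in> S" for j
  proof -
    have "b' \<in> A j" "a' \<in> B j" using b'1 a'1 A B j by metis+
    moreover have "a' \<notin> A j"
    proof
      assume "a' \<in> A j"
      then have "A j = U" using pairs_eq_doubleton A j \<open>b' \<in> A j\<close> ne U_eq by metis
      then show False using A[OF j] U fresh aj[OF j] by metis
    qed
    moreover have "b' \<notin> B j"
    proof
      assume "b' \<in> B j"
      then have "B j = U" using pairs_eq_doubleton B j \<open>a' \<in> B j\<close> ne U_eq by metis
      then show False using B[OF j] U fresh aj[OF j] by metis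
    qed
    moreover obtain s where s: "A j = {b', s}" "b' \<noteq> s" "s \<in> {1..n}"
      using A(1)[OF j] \<open>b' \<in> A j\<close> by (metis pairs_memE)
    moreover obtain t where "B j = {a', t}" using B(1)[OF j] \<open>a' \<in> B j\<close> by (metis pairs_memE)
    moreover have "A j \<inter> B j \<noteq> {}" using meet j by simp
    ultimately show ?thesis by auto
  qed
  then obtain s where s: "\<And>j. j \<in> S \<Longrightarrow> A j = {b', s j}" "\<And>j. j \<in> S \<Longrightarrow> B j = {a', s j}"
    "\<And>j. j \<in> S \<Longrightarrow> s j \<in> {1..n} - {a', b'}" by metis
  have s_inj: "i = j" if "i \<in> S" "j \<in> S" "s i = s j" for i j
    using that meet[of i j] s by auto
  have ab': "a' \<in> {1..n}" "b' \<in> {1..n}" using U(1) U_eq by (auto simp: doubleton_in_pairs)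
  define \<sigma> where "\<sigma> i = (if i = a then a' else if i = b then b' else if i \<in> S then s i else i)" for i
  have perm: "\<sigma> permutes {1..n}"
  proof (rule inj_endo_imp_permutes)
    show "\<sigma> ` {1..n} \<subseteq> {1..n}" using ab' s(3) by (auto simp: \<sigma>_def S_def)
    show "inj_on \<sigma> {1..n}"
    proof (rule inj_onI)
      fix i j assume ij: "i \<in> {1..n}" "j \<in> {1..n}" "\<sigma> i = \<sigma> j"
      have S: "i = a \<or> i = b \<or> i \<in> S" "j = a \<or> j = b \<or> j \<in> S" using ij by (auto simp: S_def)
      have notS: "a \<notin> S" "b \<notin> S" by (auto simp: S_def)
      show "i = j"
        using S ij(3) s(3) s_inj ne ab(3) notS unfolding \<sigma>_def
        by (smt (verit, best) Diff_iff insertCI)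
    qed
    show "\<sigma> i = i" if "i \<notin> {1..n}" for i using that ab by (auto simp: \<sigma>_def S_def)
  qed simp
  define g where "g = (\<lambda>P. h (\<sigma> ` P))"
  have "frame n E g" unfolding g_def using h(1) perm by (rule frame_permute)
  moreover have "g {} = f {a, b}" "g {a, b} = f {}"
    using h(2) U U_eq ab(3) by (simp_all add: g_def \<sigma>_def insert_commute)
  moreover have "g {a, j} = f {b, j} \<and> g {b, j} = f {a, j}" if "j \<in> {1..n} - {a, b}" for j
  proof -
    have "j \<in> S" "j \<noteq> a" "j \<noteq> b" using that by (auto simp: S_def)
    then show ?thesis
      using A(2)[of j] B(2)[of j] s(1,2)[of j] ab(3) by (simp add: g_def \<sigma>_def insert_commute)
  qed
  ultimately show ?thesis by (auto simp: is_transport_def)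
qed


section \<open>Covers\<close>

definition chi :: "nat set \<Rightarrow> nat \<Rightarrow> bit" where
  "chi S i = of_bool (i \<in> S)"

lemma chi_empty [simp]: "chi {} = 0"
  by (auto simp: chi_def fun_eq_iff)

lemma vec_add_self [simp]: "x + x = (0 :: nat \<Rightarrow> bit)"
  by (auto simp: fun_eq_iff)

lemma vec_add_self_left [simp]: "x + (x + y) = (y :: nat \<Rightarrow> bit)"
  by (simp flip: add.assoc)



lemma chi_add: "chi S + chi T = chi (sym_diff S T)"
  by (auto simp: chi_def fun_eq_iff)

lemma chi_eq_iff [simp]: "chi S = chi T \<longleftrightarrow> S = T"
proof
  assume eq: "chi S = chi T"
  have "i \<in> S \<longleftrightarrow> i \<in> T" for i using fun_cong[OF eq, of i]
    by (auto simp: chi_def of_bool_def split: if_splits)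
  then show "S = T" by blast
qed simp

lemma chi_doubleton_add:
  assumes "a \<noteq> b" "a \<noteq> c" "b \<noteq> c"
  shows "chi {a, b} + chi {a, c} = chi {b, c}"
proof -
  have "sym_diff {a, b} {a, c} = {b, c}" using assms by auto
  then show ?thesis by (simp add: chi_add)
qed

text \<open>Frames are demanded at the ends of edges because these are the vertices to which a
  transport can lead.\<close>

locale locally_triangular_rel =
  fixes n :: nat and E :: "'a rel"
  assumes symE: "sym E" and irreflE: "irrefl E"
    and frame_at: "(u, v) \<in> E \<Longrightarrow> \<exists>h. frame n E h \<and> h {} = v"
begin

abbreviation "frame_dom \<equiv> insert {} (pairs n)"

text \<open>A frame matters only on \<open>frame_dom\<close>, so transports are normalised to be
  extensional there. Uniqueness then becomes equality of functions, and the composition laws become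
  equations.\<close>

definition transport :: "nat \<Rightarrow> nat \<Rightarrow> (nat set \<Rightarrow> 'a) \<Rightarrow> nat set \<Rightarrow> 'a" where
  "transport a b f = (THE g. is_transport n E a b f g \<and> g \<in> extensional frame_dom)"

lemma transport_exists:
  assumes f: "frame n E f" and ab: "a \<in> {1..n}" "b \<in> {1..n}" "a \<noteq> b"
  shows "\<exists>g. is_transport n E a b f g \<and> g \<in> extensional frame_dom"
proof -
  have "{a, b} \<in> pairs n" using ab by (simp add: doubleton_in_pairs)
  then obtain h where h: "frame n E h" "h {} = f {a, b}"
    using frame_at frame_neighbour[OF f] by metis
  have "\<exists>g. is_transport n E a b f g"
  proof (cases "n \<le> 4")
    case True
    then show ?thesis by (rule transport_exists_small[OF _ symE f h ab])
  next
    case False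
    then show ?thesis by (intro transport_exists_large[OF _ symE irreflE f h ab]) simp
  qed
  then obtain g where g: "is_transport n E a b f g" ..
  define g' where "g' = restrict g frame_dom"
  have eq: "g' P = g P" if "P \<in> frame_dom" for P using that by (simp add: g'_def)
  have "frame n E g'" using g frame_cong[of n g' g E] eq by (simp add: is_transport_def)
  then have "is_transport n E a b f g'"
    using g eq ab by (simp add: is_transport_def doubleton_in_pairs)
  then show ?thesis by (auto simp: g'_def)
qed

lemma transport_eqI:
  assumes "is_transport n E a b f g" "g \<in> extensional frame_dom"
    and ab: "a \<in> {1..n}" "b \<in> {1..n}" "a \<noteq> b"
  shows "transport a b f = g"
  unfolding transport_def
proof (rule the_equality)
  fix h assume h: "is_transport n E a b f h \<and> h \<in> extensional frame_dom"
  show "h = g"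
  proof (rule extensionalityI[of h frame_dom g])
    show "h P = g P" if "P \<in> frame_dom" for P
      using that is_transport_unique[OF _ assms(1) ab, of h P] h assms(1)
      by (auto simp: is_transport_def)
  qed (use h assms in auto)
qed (use assms in auto)

lemma is_transport_transport:
  assumes "frame n E f" "a \<in> {1..n}" "b \<in> {1..n}" "a \<noteq> b"
  shows "is_transport n E a b f (transport a b f)" "transport a b f \<in> extensional frame_dom"
proof -
  obtain g where g: "is_transport n E a b f g" "g \<in> extensional frame_dom"
    using transport_exists[OF assms] by blast
  then have "transport a b f = g" using assms by (intro transport_eqI)
  then show "is_transport n E a b f (transport a b f)" "transport a b f \<in> extensional frame_dom"
    using g by simp_all
qed

lemma frame_transport:
  assumes "frame n E f" "a \<in> {1..n}" "b \<in> {1..n}" "a \<noteq> b"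
  shows "frame n E (transport a b f)"
  using is_transport_transport[OF assms] by (simp add: is_transport_def)

lemma transport_swap: "transport a b = transport b a"
  unfolding transport_def by (subst is_transport_swap) (rule refl)

lemma transport_involution:
  assumes "frame n E f" "f \<in> extensional frame_dom" "a \<in> {1..n}" "b \<in> {1..n}" "a \<noteq> b"
  shows "transport a b (transport a b f) = f"
  using is_transport_sym[OF assms(1) is_transport_transport(1)[OF assms(1,3-5)]] assms
  by (intro transport_eqI)

lemma transport_compose:
  assumes f: "frame n E f"
    and abc: "a \<in> {1..n}" "b \<in> {1..n}" "c \<in> {1..n}" "a \<noteq> b" "a \<noteq> c" "b \<noteq> c"
  shows "transport a c (transport a b f) = transport b c f"
proof (rule extensionalityI[of _ frame_dom])
  note g = is_transport_transport[OF f abc(1,2,4)]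
  note h = is_transport_transport[OF frame_transport[OF f abc(1,2,4)] abc(1,3,5)]
  note k = is_transport_transport[OF f abc(2,3,6)]
  show "transport a c (transport a b f) \<in> extensional frame_dom" "transport b c f \<in> extensional frame_dom"
    using h k by auto
  show "transport a c (transport a b f) P = transport b c f P" if "P \<in> frame_dom" for P
    using is_transport_compose[OF f g(1) h(1) k(1) abc] that by auto
qed

text \<open>For distinct \<open>i\<close> and \<open>j\<close> either order yields the transport
  along \<open>{i, j}\<close>, which is symmetric in the two points.\<close>

lemma transport_commute:
  assumes "frame n E f" "i \<in> {2..n}" "j \<in> {2..n}"
  shows "transport 1 i (transport 1 j f) = transport 1 j (transport 1 i f)"
proof (cases "i = j")
  case False
  then show ?thesis
    using assms transport_compose[of f 1 j i] transport_compose[of f 1 i j]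
    by (simp add: transport_swap[of j i])
qed simp

text \<open>The transports along the pairs through 1 are commuting involutions, so their products
  are indexed by vectors, whose first coordinate is ignored.\<close>

definition multi_transport :: "(nat \<Rightarrow> bit) \<Rightarrow> nat list \<Rightarrow> (nat set \<Rightarrow> 'a) \<Rightarrow> nat set \<Rightarrow> 'a" where
  "multi_transport x = foldr (\<lambda>j f. if x j = 0 then f else transport 1 j f)"

lemma multi_transport_simps [simp]:
  "multi_transport x [] f = f"
  "multi_transport x (j # js) f =
    (if x j = 0 then multi_transport x js f else transport 1 j (multi_transport x js f))"
  by (simp_all add: multi_transport_def)

lemma frame_multi_transport:
  assumes "frame n E f" "f \<in> extensional frame_dom" "set js \<subseteq> {2..n}"
  shows "frame n E (multi_transport x js f) \<and> multi_transport x js f \<in> extensional frame_dom"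
  using assms(3)
proof (induction js)
  case (Cons j js)
  then show ?case
    using frame_transport[of "multi_transport x js f" 1 j]
      is_transport_transport(2)[of "multi_transport x js f" 1 j] by auto
qed (use assms in simp)

lemma multi_transport_cong:
  "(\<And>j. j \<in> set js \<Longrightarrow> x j = y j) \<Longrightarrow> multi_transport x js f = multi_transport y js f"
  by (induction js) auto

text \<open>The new factor is moved inwards by commutation until it reaches the place of
  \<open>k\<close>, where it is either inserted or cancelled by involution. This toggles coordinate
  \<open>k\<close>.\<close>

lemma transport_multi_transport:
  assumes f: "frame n E f" "f \<in> extensional frame_dom" and js: "set js \<subseteq> {2..n}" "distinct js"
    and k: "k \<in> set js"
  shows "transport 1 k (multi_transport x js f) = multi_transport (x + chi {1, k}) js f"
  using js k
proof (induction js)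
  case (Cons j js)
  define y where "y = x + chi {1, k}"
  have js: "set js \<subseteq> {2..n}" "distinct js" using Cons.prems by auto
  note fr = frame_multi_transport[OF f js(1)]
  show ?case
  proof (cases "j = k")
    case True
    \<comment> \<open>The vectors differ only in the coordinates 1 and \<open>k\<close>; the tail
      avoids \<open>k\<close> by distinctness and never contains 1.\<close>
    have "multi_transport y js f = multi_transport x js f"
      using Cons.prems True by (intro multi_transport_cong) (auto simp: y_def chi_def)
    moreover have "y j = 0 \<longleftrightarrow> x j \<noteq> 0" using True by (simp add: y_def chi_def)
    moreover have "transport 1 k (transport 1 k (multi_transport x js f)) = multi_transport x js f"
      using fr[of x] Cons.prems True by (intro transport_involution) auto
    ultimately show ?thesis unfolding y_def[symmetric] using True by simp
  next
    case False
    have "y j = x j" using False Cons.prems by (auto simp: y_def chi_def)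
    moreover have "transport 1 k (transport 1 j (multi_transport x js f)) =
        transport 1 j (transport 1 k (multi_transport x js f))"
      using fr Cons.prems by (intro transport_commute) auto
    moreover have "transport 1 k (multi_transport x js f) = multi_transport y js f"
      unfolding y_def using False Cons.prems by (intro Cons.IH js) simp
    ultimately show ?thesis unfolding y_def[symmetric] by simp
  qed
qed simp

lemma transport_multi_transport_pair:
  assumes f: "frame n E f" "f \<in> extensional frame_dom" and ab: "a \<in> {1..n}" "b \<in> {1..n}" "a \<noteq> b"
  shows "transport a b (multi_transport x [2..<Suc n] f) =
    multi_transport (x + chi {a, b}) [2..<Suc n] f"
proof -
  let ?F = "\<lambda>x. multi_transport x [2..<Suc n] f"
  have one: "transport 1 k (?F x) = ?F (x + chi {1, k})" if "k \<in> {1..n}" "k \<noteq> 1" for k x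
    using that f by (intro transport_multi_transport) auto
  have fr: "frame n E (?F x)" for x
    using frame_multi_transport[OF f, of "[2..<Suc n]"] by (simp add: less_Suc_eq_le subset_eq del: upt_Suc)
  consider "a = 1" | "b = 1" | "a \<noteq> 1" "b \<noteq> 1" by auto
  then show ?thesis
  proof cases
    case 1
    then show ?thesis using one ab by simp
  next
    case 2
    then show ?thesis using one[of a x] ab by (metis transport_swap insert_commute)
  next
    case 3
    \<comment> \<open>A pair that misses 1 is reached through the two pairs joining its points to
      1.\<close>
    then have "transport a b (?F x) = transport 1 b (transport 1 a (?F x))"
      using transport_compose[OF fr, of 1 a b] ab by simp
    also have "\<dots> = ?F (x + (chi {1, a} + chi {1, b}))" using one 3 ab by (simp add: add.assoc)
    finally show ?thesis using chi_doubleton_add[of 1 a b] 3 ab by simp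
  qed
qed

text \<open>Each vector indexes a product of transports and hence a frame, and \<open>p\<close>
  takes its base vertex. Transport along \<open>P\<close> moves the base to the value at
  \<open>P\<close> and adds \<open>chi P\<close> to the index, so the other values of the frame are
  values of \<open>p\<close> as well.\<close>

lemma ex_cover:
  assumes f: "frame n E f"
  obtains p where "\<And>x. frame n E (\<lambda>P. p (x + chi P))" "p 0 = f {}"
proof -
  \<comment> \<open>\<open>transport_involution\<close> requires an extensional frame.\<close>
  define f0 where "f0 = restrict f frame_dom"
  have f0: "frame n E f0" "f0 \<in> extensional frame_dom"
    using f frame_cong[of n f0 f E] by (simp_all add: f0_def)
  define F where "F x = multi_transport x [2..<Suc n] f0" for x
  define p where "p x = F x {}" for x
  have fr: "frame n E (F x)" for x
    using frame_multi_transport[OF f0, of "[2..<Suc n]"]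
    by (simp add: F_def less_Suc_eq_le subset_eq del: upt_Suc)
  have "p (x + chi P) = F x P" if P: "P \<in> pairs n" for x P
  proof -
    obtain a b where ab: "P = {a, b}" "a \<noteq> b" "a \<in> {1..n}" "b \<in> {1..n}" using P by (rule pairsE)
    then have "F (x + chi P) = transport a b (F x)"
      using transport_multi_transport_pair[OF f0] by (simp add: F_def)
    then show ?thesis
      using is_transport_transport(1)[OF fr ab(3,4,2), of x] ab by (simp add: p_def is_transport_def)
  qed
  then have "frame n E (\<lambda>P. p (x + chi P))" for x
    using fr[of x] frame_cong[of n "\<lambda>P. p (x + chi P)" "F x" E] by (simp add: p_def)
  moreover have "multi_transport 0 js f0 = f0" for js by (induction js) simp_all
  then have "p 0 = f {}" by (simp add: p_def F_def f0_def)
  ultimately show ?thesis using that by blast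
qed

end


section \<open>Parity classes and covers by a halved cube\<close>

definition parity :: "nat \<Rightarrow> (nat \<Rightarrow> bit) \<Rightarrow> bit" where
  "parity n x = (\<Sum>i\<in>{1..n}. x i)"

definition parity_class :: "nat \<Rightarrow> bit \<Rightarrow> (nat \<Rightarrow> bit) set" where
  "parity_class n c = {x \<in> F2_vectors n. parity n x = c}"

definition supp :: "nat \<Rightarrow> (nat \<Rightarrow> bit) \<Rightarrow> nat set" where
  "supp n x = {i \<in> {1..n}. x i \<noteq> 0}"

lemma F2_vectors_add: "\<lbrakk>x \<in> F2_vectors n; y \<in> F2_vectors n\<rbrakk> \<Longrightarrow> x + y \<in> F2_vectors n"
  by (simp add: F2_vectors_def)

lemma F2_vectors_zero: "0 \<in> F2_vectors n"
  by (simp add: F2_vectors_def)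

lemma F2_vectors_chi: "S \<subseteq> {1..n} \<Longrightarrow> chi S \<in> F2_vectors n"
  by (auto simp: F2_vectors_def chi_def)

lemma chi_supp: "x \<in> F2_vectors n \<Longrightarrow> chi (supp n x) = x"
  by (auto simp: F2_vectors_def chi_def supp_def fun_eq_iff)

lemma supp_chi: "S \<subseteq> {1..n} \<Longrightarrow> supp n (chi S) = S"
  by (auto simp: chi_def supp_def)

lemma supp_subset: "supp n x \<subseteq> {1..n}"
  by (auto simp: supp_def)

lemma finite_supp: "finite (supp n x)"
  by (simp add: supp_def)

lemma hamming_dist_eq_card_supp: "hamming_dist n x y = card (supp n (x + y))"
proof -
  have "x i \<noteq> y i \<longleftrightarrow> (x + y) i \<noteq> 0" for i by (cases "x i"; cases "y i") auto
  then show ?thesis by (simp add: hamming_dist_def supp_def)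
qed

lemma hamming_dist_add_chi: "S \<subseteq> {1..n} \<Longrightarrow> hamming_dist n x (x + chi S) = card S"
  by (simp add: hamming_dist_eq_card_supp supp_chi)

lemma hamming_dist_le: "hamming_dist n x y \<le> n"
  using card_mono[OF _ supp_subset, of n "x + y"] by (simp add: hamming_dist_eq_card_supp)

lemma parity_add: "parity n (x + y) = parity n x + parity n y"
  unfolding parity_def by (simp add: sum.distrib plus_fun_apply del: add_bit_eq_xor)

lemma parity_chi: "S \<subseteq> {1..n} \<Longrightarrow> parity n (chi S) = of_bool (odd (card S))"
proof -
  assume S: "S \<subseteq> {1..n}"
  have "parity n (chi S) = (\<Sum>i\<in>S. 1)"
    unfolding parity_def using S by (intro sum.mono_neutral_cong_right) (auto simp: chi_def)
  then have "parity n (chi S) = of_nat (card S)" by simp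
  moreover have "(of_nat m :: bit) = of_bool (odd m)" for m by (induction m) auto
  ultimately show ?thesis by metis
qed

lemma parity_class_add_pair:
  assumes "x \<in> parity_class n c" "P \<in> pairs n"
  shows "x + chi P \<in> parity_class n c"
proof -
  have "P \<subseteq> {1..n}" "card P = 2" using assms by (auto simp: pairs_def)
  then show ?thesis
    using assms F2_vectors_add[OF _ F2_vectors_chi]
    by (simp add: parity_class_def parity_add parity_chi)
qed

lemma even_card_supp_add:
  assumes "x \<in> parity_class n c" "y \<in> parity_class n c"
  shows "even (card (supp n (x + y)))"
proof -
  have "x + y \<in> F2_vectors n" "parity n (x + y) = 0"
    using assms F2_vectors_add by (auto simp: parity_class_def parity_add simp del: add_bit_eq_xor)
  then show ?thesis
    using parity_chi[OF supp_subset, of n "x + y"] by (auto simp: chi_supp)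
qed

lemma split_off_pair:
  assumes "S \<subseteq> {1..n}" "S \<noteq> {}" "even (card S)"
  obtains P T where "P \<in> pairs n" "T \<subseteq> {1..n}" "P \<inter> T = {}" "S = P \<union> T" "card S = card T + 2"
proof -
  have fin: "finite S" using assms finite_subset by blast
  then have "card S \<noteq> 0" "card S \<noteq> 1" using assms by auto
  then have "2 \<le> card S" by linarith
  then obtain P where P: "P \<subseteq> S" "card P = 2" by (meson obtain_subset_with_card_n)
  have "finite P" using P fin finite_subset by blast
  then have "card (S - P) = card S - 2" using P card_Diff_subset by metis
  then show ?thesis
    using that[of P "S - P"] P assms(1) \<open>2 \<le> card S\<close>
    by (simp add: pairs_def Un_absorb1 subset_trans[of P S] subset_trans[of "S - P" S])
qed

lemma chi_disjoint_Un: "P \<inter> Q = {} \<Longrightarrow> chi (P \<union> Q) = chi P + chi Q"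
  by (simp add: chi_add Diff_triv Int_commute)

text \<open>Vectors of one parity class differ by a set of even size, which is a disjoint union of
  pairs. This is connectedness of the halved cube, in the form of an induction rule.\<close>

lemma parity_class_induct [consumes 2, case_names base step]:
  assumes x: "x \<in> parity_class n c" and y: "y \<in> parity_class n c"
    and base: "Q x" and step: "\<And>z P. \<lbrakk>z \<in> parity_class n c; Q z; P \<in> pairs n\<rbrakk> \<Longrightarrow> Q (z + chi P)"
  shows "Q y"
proof -
  have "x + chi S \<in> parity_class n c \<and> Q (x + chi S)" if "S \<subseteq> {1..n}" "even (card S)" for S
    using that
  proof (induction "card S" arbitrary: S rule: less_induct)
    case less
    show ?case
    proof (cases "S = {}")
      case True
      then show ?thesis using x base by simp
    next
      case False
      obtain P T where PT: "P \<in> pairs n" "T \<subseteq> {1..n}" "P \<inter> T = {}" "S = P \<union> T" "card S = card T + 2"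
        using split_off_pair[OF less.prems(1) False less.prems(2)] by blast
      have T: "x + chi T \<in> parity_class n c \<and> Q (x + chi T)"
        using less PT by simp
      have eq: "x + chi S = x + chi T + chi P"
        using PT by (simp add: chi_disjoint_Un ac_simps)
      show ?thesis unfolding eq using T step parity_class_add_pair PT(1) by blast
    qed
  qed
  from this[OF supp_subset even_card_supp_add[OF x y]] show ?thesis
    using x y F2_vectors_add by (simp add: parity_class_def chi_supp)
qed

text \<open>A map from one half of the cube that is an isomorphism on neighbourhoods. The class is a
  parameter because a graph may be presented by either half.\<close>

definition is_cover :: "nat \<Rightarrow> 'a rel \<Rightarrow> bit \<Rightarrow> ((nat \<Rightarrow> bit) \<Rightarrow> 'a) \<Rightarrow> bool" where
  "is_cover n E c p \<longleftrightarrow> (\<forall>x \<in> parity_class n c. frame n E (\<lambda>P. p (x + chi P)))"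

lemma is_coverD: "\<lbrakk>is_cover n E c p; x \<in> parity_class n c\<rbrakk> \<Longrightarrow> frame n E (\<lambda>P. p (x + chi P))"
  by (simp add: is_cover_def)

lemma is_cover_adj:
  assumes "is_cover n E c p" "x \<in> parity_class n c"
  shows "(p x, w) \<in> E \<longleftrightarrow> (\<exists>P \<in> pairs n. w = p (x + chi P))"
  using is_coverD[OF assms] by (auto simp: frame_def)

lemma is_cover_inj:
  assumes "is_cover n E c p" "x \<in> parity_class n c" "P \<in> pairs n" "Q \<in> pairs n"
  shows "p (x + chi P) = p (x + chi Q) \<longleftrightarrow> P = Q"
  using frame_inj[OF is_coverD[OF assms(1,2)] assms(3,4)] .

text \<open>Paths lift: every edge at \<open>p z\<close> is the image of a step from
  \<open>z\<close> to some \<open>z + chi P\<close>, which stays in the class.\<close>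

lemma is_cover_onto:
  assumes cov: "is_cover n E c p" and x: "x \<in> parity_class n c" and w: "(p x, w) \<in> E\<^sup>*"
  shows "w \<in> p ` parity_class n c"
  using w
proof (induction rule: rtrancl_induct)
  case (step v w)
  then show ?case using is_cover_adj[OF cov] parity_class_add_pair by blast
qed (use x in blast)

lemma is_cover_reachable:
  assumes cov: "is_cover n E c p" and xy: "x \<in> parity_class n c" "y \<in> parity_class n c"
  shows "(p x, p y) \<in> E\<^sup>*"
  using xy
proof (induction rule: parity_class_induct)
  case (step z P)
  then have "(p z, p (z + chi P)) \<in> E" using is_cover_adj[OF cov] by blast
  then show ?case using step by (meson rtrancl.rtrancl_into_rtrancl)
qed simp

text \<open>Agreement on a whole frame spreads to neighbouring vectors: since
  \<open>chi {a, b} + chi {a, j} = chi {b, j}\<close>, the pairs through \<open>a\<close> at the new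
  vector lead to the old vector or to its neighbours, and these pairs determine the new
  frame.\<close>

lemma is_cover_unique:
  assumes p: "is_cover n E c p" and q: "is_cover n E c q"
    and x: "x \<in> parity_class n c" and base: "p x = q x"
    and agree: "\<And>P. P \<in> pairs n \<Longrightarrow> p (x + chi P) = q (x + chi P)"
    and y: "y \<in> parity_class n c"
  shows "p y = q y"
proof -
  have "p y = q y \<and> (\<forall>P \<in> pairs n. p (y + chi P) = q (y + chi P))"
    using x y
  proof (induction rule: parity_class_induct)
    case base
    then show ?case using assms(4) agree by blast
  next
    case (step z P)
    obtain a b where ab: "P = {a, b}" "a \<noteq> b" "a \<in> {1..n}" "b \<in> {1..n}" using step by (metis pairsE)
    let ?y = "z + chi P"
    have y: "?y \<in> parity_class n c" using step parity_class_add_pair by blast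
    have "p (?y + chi Q) = q (?y + chi Q)" if Q: "Q \<in> pairs n" for Q
    proof (rule frame_eq_if_agree_on_star[OF is_coverD[OF p y] is_coverD[OF q y] _ ab(3) _ Q])
      show "p (?y + chi {}) = q (?y + chi {})" unfolding chi_empty add_0_right using step by blast
      fix j assume j: "j \<in> {1..n}" "j \<noteq> a"
      show "p (?y + chi {a, j}) = q (?y + chi {a, j})"
      proof (cases "j = b")
        case True
        then have "?y + chi {a, j} = z" using ab by (simp add: add.assoc)
        then show ?thesis using step by metis
      next
        case False
        then have "?y + chi {a, j} = z + chi {b, j}"
          using chi_doubleton_add[of a b j] ab j by (simp add: add.assoc)
        moreover have "{b, j} \<in> pairs n" using False ab j by (simp add: doubleton_in_pairs)
        ultimately show ?thesis using step by metis
      qed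
    qed
    then show ?case using step by blast
  qed
  then show ?thesis ..
qed

text \<open>The distance is 2, 4 or 6. Equal images would mean, respectively, a loop, two equal
  values in the frame at a middle vector, or adjacency of two values of one frame at disjoint
  pairs.\<close>

lemma is_cover_inj_le_6:
  assumes cov: "is_cover n E c p" and irr: "irrefl E"
    and x: "x \<in> parity_class n c" and y: "y \<in> parity_class n c"
    and eq: "p x = p y" and dist: "hamming_dist n x y \<le> 6"
  shows "x = y"
proof (rule ccontr)
  assume ne: "x \<noteq> y"
  define S where "S = supp n (x + y)"
  have y_eq: "y = x + chi S"
    using x y F2_vectors_add by (simp add: S_def parity_class_def chi_supp)
  have S: "S \<subseteq> {1..n}" "even (card S)" "card S \<le> 6"
    using supp_subset even_card_supp_add[OF x y] dist
    by (simp_all add: S_def hamming_dist_eq_card_supp)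
  have "S \<noteq> {}" using ne y_eq by auto
  note cl = parity_class_add_pair
  obtain P T where P: "P \<in> pairs n" "T \<subseteq> {1..n}" "P \<inter> T = {}" "S = P \<union> T" "card S = card T + 2"
    using split_off_pair[OF S(1) \<open>S \<noteq> {}\<close> S(2)] by blast
  show False
  proof (cases "T = {}")
    case True
    then have "(p x, p y) \<in> E" using is_cover_adj[OF cov x] P y_eq by auto
    then show False using eq irr by (simp add: irrefl_def)
  next
    case False
    have "even (card T)" using P S by simp
    then obtain Q U where Q: "Q \<in> pairs n" "U \<subseteq> {1..n}" "Q \<inter> U = {}" "T = Q \<union> U" "card T = card U + 2"
      using split_off_pair[OF P(2) False] by blast
    have PQ: "P \<inter> Q = {}" using P Q by blast
    show False
    proof (cases "U = {}")
      case True
      let ?z = "x + chi P"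
      have "p (?z + chi P) = p (?z + chi Q)"
        using eq y_eq P Q True by (simp add: chi_disjoint_Un add.assoc)
      then have "P = Q" using is_cover_inj[OF cov cl[OF x P(1)] P(1) Q(1)] by blast
      then show False using PQ P empty_not_in_pairs by auto
    next
      case False
      have "even (card U)" using P Q S by simp
      then obtain R V where R: "R \<in> pairs n" "R \<inter> V = {}" "U = R \<union> V" "card U = card V + 2" "V \<subseteq> {1..n}"
        using split_off_pair[OF Q(2) False] by blast
      have "card V = 0" using P Q R S by simp
      moreover have "finite V" using R finite_subset by blast
      ultimately have V: "V = {}" by simp
      have QR: "Q \<inter> R = {}" using Q R by blast
      \<comment> \<open>The frame at this vector contains \<open>y\<close>, reached by
        \<open>R\<close>, and \<open>x + chi P\<close>, reached by \<open>Q\<close>. The latter is a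
        neighbour of \<open>x\<close>, so identifying \<open>x\<close> with \<open>y\<close> would
        make the values at \<open>R\<close> and \<open>Q\<close> adjacent.\<close>
      let ?w = "x + chi P + chi Q"
      have w: "?w \<in> parity_class n c" using cl[OF cl[OF x P(1)] Q(1)] .
      have "p (?w + chi R) = p x"
        using eq y_eq P Q R V by (simp add: chi_disjoint_Un ac_simps)
      moreover have "(p x, p (?w + chi Q)) \<in> E"
        using is_cover_adj[OF cov x] P(1) by (auto simp: add.assoc)
      ultimately have "card (R \<inter> Q) = 1"
        using frame_adj[OF is_coverD[OF cov w] R(1) Q(1)] by simp
      then show False using QR by (simp add: Int_commute)
    qed
  qed
qed


section \<open>Cube automorphisms and deck transformations\<close>

text \<open>The wreath product as a set of automorphisms. Its members come with an explicit
  translation and permutation, from which the effect on parities and on steps \<open>chi P\<close>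
  can be read off.\<close>

definition affine_auts :: "nat \<Rightarrow> ((nat \<Rightarrow> bit) \<Rightarrow> nat \<Rightarrow> bit) set" where
  "affine_auts n = {cube_aut n t \<sigma> | t \<sigma>. t \<in> F2_vectors n \<and> \<sigma> permutes {1..n}}"

lemma affine_autsE:
  assumes "k \<in> affine_auts n"
  obtains t \<sigma> where "k = cube_aut n t \<sigma>" "t \<in> F2_vectors n" "\<sigma> permutes {1..n}"
  using assms by (auto simp: affine_auts_def)

lemma cube_aut_apply: "y \<in> F2_vectors n \<Longrightarrow> cube_aut n t \<sigma> y = (y + t) \<circ> Hilbert_Choice.inv \<sigma>"
  by (simp add: cube_aut_def)

lemma vec_comp_add: "(x + y) \<circ> f = (x \<circ> f) + (y \<circ> f :: nat \<Rightarrow> bit)"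
  by (simp add: fun_eq_iff plus_fun_apply del: add_bit_eq_xor)

lemma F2_vectors_comp:
  assumes "x \<in> F2_vectors n" "\<sigma> permutes {1..n}"
  shows "x \<circ> \<sigma> \<in> F2_vectors n"
  using assms permutes_not_in[of \<sigma>] by (simp add: F2_vectors_def)

lemma chi_comp_inv: "\<sigma> permutes S \<Longrightarrow> chi T \<circ> Hilbert_Choice.inv \<sigma> = chi (\<sigma> ` T)"
proof -
  assume s: "\<sigma> permutes S"
  have "Hilbert_Choice.inv \<sigma> i \<in> T \<longleftrightarrow> i \<in> \<sigma> ` T" for i
    using permutes_inverses[OF s] by (metis imageE imageI)
  then show ?thesis by (auto simp: chi_def fun_eq_iff)
qed

lemma cube_aut_closed:
  "\<lbrakk>y \<in> F2_vectors n; t \<in> F2_vectors n; \<sigma> permutes {1..n}\<rbrakk> \<Longrightarrow> cube_aut n t \<sigma> y \<in> F2_vectors n"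
  by (simp add: cube_aut_apply F2_vectors_comp F2_vectors_add permutes_inv)

lemma cube_aut_add_chi:
  assumes "y \<in> F2_vectors n" "\<sigma> permutes {1..n}" "S \<subseteq> {1..n}"
  shows "cube_aut n t \<sigma> (y + chi S) = cube_aut n t \<sigma> y + chi (\<sigma> ` S)"
proof -
  have "y + chi S \<in> F2_vectors n" using assms F2_vectors_add F2_vectors_chi by blast
  moreover have "y + chi S + t = y + t + chi S" by (simp add: ac_simps)
  ultimately show ?thesis
    using assms by (simp add: cube_aut_apply vec_comp_add chi_comp_inv del: comp_apply)
qed

lemma parity_comp:
  assumes "\<sigma> permutes {1..n}"
  shows "parity n (x \<circ> \<sigma>) = parity n x"
  unfolding parity_def by (rule sum.permute[OF assms, symmetric])

lemma parity_cube_aut: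
  assumes "y \<in> F2_vectors n" "\<sigma> permutes {1..n}"
  shows "parity n (cube_aut n t \<sigma> y) = parity n y + parity n t"
  by (simp only: cube_aut_apply[OF assms(1)] parity_comp[OF permutes_inv[OF assms(2)]] parity_add)

lemma even_vectors_eq: "even_vectors n = parity_class n 0"
proof -
  have "parity n x = of_bool (odd (card {i \<in> {1..n}. x i \<noteq> 0}))" if "x \<in> F2_vectors n" for x
    using parity_chi[OF supp_subset, of n x] chi_supp[OF that] by (simp add: supp_def)
  then show ?thesis by (auto simp: even_vectors_def parity_class_def)
qed

lemma even_cube_group_subset: "even_cube_group n \<subseteq> affine_auts n"
  by (auto simp: even_cube_group_def affine_auts_def even_vectors_def)

lemma even_cube_group_parity:
  assumes "k \<in> even_cube_group n" "x \<in> parity_class n c"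
  shows "k x \<in> parity_class n c"
  using assms parity_cube_aut cube_aut_closed
  by (auto simp: even_cube_group_def even_vectors_eq parity_class_def simp del: add_bit_eq_xor)

lemma carrier_aut_group: "carrier (aut_group G) \<subseteq> Bij (pverts G)"
  by (auto simp: aut_group_def)

lemma mult_aut_group:
  "\<lbrakk>f \<in> Bij (pverts G); g \<in> Bij (pverts G)\<rbrakk> \<Longrightarrow> f \<otimes>\<^bsub>aut_group G\<^esub> g = compose (pverts G) f g"
  by (simp add: aut_group_def BijGroup_def)

lemma one_aut_group: "\<one>\<^bsub>aut_group G\<^esub> = (\<lambda>x \<in> pverts G. x)"
  by (simp add: aut_group_def BijGroup_def)

abbreviation "cube_group n \<equiv> aut_group (cube n)"

lemma pverts_cube [simp]: "pverts (cube n) = F2_vectors n"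
  by (simp add: cube_def)

lemma affine_auts_subset: "affine_auts n \<subseteq> carrier (cube_group n)"
  using cube_aut_in_aut_group by (auto simp: affine_auts_def)

lemma cube_group_mult_apply:
  assumes "f \<in> carrier (cube_group n)" "g \<in> carrier (cube_group n)" "x \<in> F2_vectors n"
  shows "(f \<otimes>\<^bsub>cube_group n\<^esub> g) x = f (g x)"
proof -
  have "f \<in> Bij (pverts (cube n))" "g \<in> Bij (pverts (cube n))"
    using assms carrier_aut_group by blast+
  then show ?thesis using assms(3) by (simp add: mult_aut_group compose_def)
qed

lemma cube_group_one_apply: "x \<in> F2_vectors n \<Longrightarrow> \<one>\<^bsub>cube_group n\<^esub> x = x"
  by (simp add: one_aut_group)

lemma cube_group_closed:
  assumes "f \<in> carrier (cube_group n)" "x \<in> F2_vectors n"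
  shows "f x \<in> F2_vectors n"
  using assms carrier_aut_group[of "cube n"] Bij_imp_funcset[of f "F2_vectors n"] by auto

lemma cube_group_eqI:
  assumes "f \<in> carrier (cube_group n)" "g \<in> carrier (cube_group n)"
    and "\<And>x. x \<in> F2_vectors n \<Longrightarrow> f x = g x"
  shows "f = g"
  using assms carrier_aut_group[of "cube n"]
  by (intro extensionalityI[of f "F2_vectors n" g]) (auto simp: Bij_def)

lemma cube_group_inv_apply:
  assumes "f \<in> carrier (cube_group n)" "x \<in> F2_vectors n"
  shows "(inv\<^bsub>cube_group n\<^esub> f) (f x) = x" "f ((inv\<^bsub>cube_group n\<^esub> f) x) = x"
proof -
  interpret group "cube_group n" by (rule group_aut_group)
  have i: "inv\<^bsub>cube_group n\<^esub> f \<in> carrier (cube_group n)" using assms by simp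
  show "(inv\<^bsub>cube_group n\<^esub> f) (f x) = x"
    using cube_group_mult_apply[OF i assms(1,2)] assms by (simp add: cube_group_one_apply)
  show "f ((inv\<^bsub>cube_group n\<^esub> f) x) = x"
    using cube_group_mult_apply[OF assms(1) i assms(2)] assms by (simp add: cube_group_one_apply)
qed

text \<open>The translation acts before the permutation, so \<open>t\<close> must be pulled back
  through \<open>\<sigma>'\<close> before it can be merged with \<open>t'\<close>.\<close>

lemma cube_aut_mult:
  assumes t: "t \<in> F2_vectors n" "t' \<in> F2_vectors n"
    and s: "\<sigma> permutes {1..n}" "\<sigma>' permutes {1..n}"
  shows "cube_aut n t \<sigma> \<otimes>\<^bsub>cube_group n\<^esub> cube_aut n t' \<sigma>' = cube_aut n (t' + (t \<circ> \<sigma>')) (\<sigma> \<circ> \<sigma>')"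
proof (rule cube_group_eqI)
  interpret group "cube_group n" by (rule group_aut_group)
  note car = cube_aut_in_aut_group[OF t(1) s(1)] cube_aut_in_aut_group[OF t(2) s(2)]
  show "cube_aut n t \<sigma> \<otimes>\<^bsub>cube_group n\<^esub> cube_aut n t' \<sigma>' \<in> carrier (cube_group n)"
    using car by simp
  show "cube_aut n (t' + (t \<circ> \<sigma>')) (\<sigma> \<circ> \<sigma>') \<in> carrier (cube_group n)"
    using t s by (intro cube_aut_in_aut_group F2_vectors_add F2_vectors_comp permutes_compose)
  fix x assume x: "x \<in> F2_vectors n"
  have inv: "Hilbert_Choice.inv (\<sigma> \<circ> \<sigma>') = Hilbert_Choice.inv \<sigma>' \<circ> Hilbert_Choice.inv \<sigma>"
    using s by (intro o_inv_distrib permutes_bij)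
  have t_eq: "(t \<circ> \<sigma>') \<circ> Hilbert_Choice.inv \<sigma>' = t"
    using permutes_inv_o(1)[OF s(2)] by (simp add: comp_assoc)
  have "(cube_aut n t \<sigma> \<otimes>\<^bsub>cube_group n\<^esub> cube_aut n t' \<sigma>') x = cube_aut n t \<sigma> (cube_aut n t' \<sigma>' x)"
    by (rule cube_group_mult_apply[OF car x])
  also have "\<dots> = (((x + t') \<circ> Hilbert_Choice.inv \<sigma>') + t) \<circ> Hilbert_Choice.inv \<sigma>"
    unfolding cube_aut_apply[OF cube_aut_closed[OF x t(2) s(2)]] unfolding cube_aut_apply[OF x]
    by (rule refl)
  also have "\<dots> = (((x + t') \<circ> Hilbert_Choice.inv \<sigma>') + ((t \<circ> \<sigma>') \<circ> Hilbert_Choice.inv \<sigma>'))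
      \<circ> Hilbert_Choice.inv \<sigma>"
    by (simp only: t_eq)
  also have "\<dots> = cube_aut n (t' + (t \<circ> \<sigma>')) (\<sigma> \<circ> \<sigma>') x"
    by (simp only: cube_aut_apply[OF x] inv vec_comp_add comp_assoc add.assoc)
  finally show "(cube_aut n t \<sigma> \<otimes>\<^bsub>cube_group n\<^esub> cube_aut n t' \<sigma>') x =
      cube_aut n (t' + (t \<circ> \<sigma>')) (\<sigma> \<circ> \<sigma>') x" .
qed

lemma cube_aut_zero_id: "cube_aut n 0 id = \<one>\<^bsub>cube_group n\<^esub>"
  by (auto simp: cube_aut_def one_aut_group)

lemma subgroup_affine_auts: "subgroup (affine_auts n) (cube_group n)"
proof -
  interpret group "cube_group n" by (rule group_aut_group)
  show ?thesis
  proof (rule subgroupI)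
    show "affine_auts n \<subseteq> carrier (cube_group n)" by (rule affine_auts_subset)
    have "cube_aut n 0 id \<in> affine_auts n"
      unfolding affine_auts_def using F2_vectors_zero permutes_id by blast
    then show "affine_auts n \<noteq> {}" by blast
  next
    fix f assume "f \<in> affine_auts n"
    then obtain t \<sigma> where f: "f = cube_aut n t \<sigma>" "t \<in> F2_vectors n" "\<sigma> permutes {1..n}"
      by (rule affine_autsE)
    let ?i = "Hilbert_Choice.inv \<sigma>"
    have i: "?i permutes {1..n}" using f(3) by (rule permutes_inv)
    then have ti: "t \<circ> ?i \<in> F2_vectors n" using f(2) by (rule F2_vectors_comp[rotated])
    have "t + (t \<circ> ?i \<circ> \<sigma>) = 0" "?i \<circ> \<sigma> = id"
      using permutes_inv_o(2)[OF f(3)] by (simp_all add: comp_assoc)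
    then have "cube_aut n (t \<circ> ?i) ?i \<otimes>\<^bsub>cube_group n\<^esub> f = \<one>\<^bsub>cube_group n\<^esub>"
      unfolding f(1) by (simp only: cube_aut_mult[OF ti f(2) i f(3)] cube_aut_zero_id)
    then have "inv\<^bsub>cube_group n\<^esub> f = cube_aut n (t \<circ> ?i) ?i"
      using f i ti cube_aut_in_aut_group by (intro inv_equality) auto
    then show "inv\<^bsub>cube_group n\<^esub> f \<in> affine_auts n" using i ti by (auto simp: affine_auts_def)
  next
    fix f g assume "f \<in> affine_auts n" "g \<in> affine_auts n"
    then obtain t \<sigma> t' \<sigma>' where f: "f = cube_aut n t \<sigma>" "t \<in> F2_vectors n" "\<sigma> permutes {1..n}"
      and g: "g = cube_aut n t' \<sigma>'" "t' \<in> F2_vectors n" "\<sigma>' permutes {1..n}"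
      by (metis affine_autsE)
    have "f \<otimes>\<^bsub>cube_group n\<^esub> g = cube_aut n (t' + (t \<circ> \<sigma>')) (\<sigma> \<circ> \<sigma>')"
      using f g cube_aut_mult by simp
    moreover have "t' + (t \<circ> \<sigma>') \<in> F2_vectors n" "\<sigma> \<circ> \<sigma>' permutes {1..n}"
      using F2_vectors_add[OF g(2) F2_vectors_comp[OF f(2) g(3)]] permutes_compose[OF g(3) f(3)]
      by blast+
    ultimately show "f \<otimes>\<^bsub>cube_group n\<^esub> g \<in> affine_auts n" unfolding affine_auts_def by blast
  qed
qed

section \<open>Deck groups of covers: rigidity, transitivity on fibres, displacement,
  conjugacy\<close>

definition deck_group :: "nat \<Rightarrow> bit \<Rightarrow> ((nat \<Rightarrow> bit) \<Rightarrow> 'a) \<Rightarrow> ((nat \<Rightarrow> bit) \<Rightarrow> nat \<Rightarrow> bit) set" where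
  "deck_group n c p =
     {k \<in> affine_auts n. \<forall>x \<in> parity_class n c. k x \<in> parity_class n c \<and> p (k x) = p x}"

lemma parity_class_subset: "parity_class n c \<subseteq> F2_vectors n"
  by (auto simp: parity_class_def)

text \<open>A member only has to map the class into itself; finiteness makes it map onto the class,
  which is what closure under inverses requires.\<close>

lemma subgroup_deck_group: "subgroup (deck_group n c p) (cube_group n)"
proof -
  interpret group "cube_group n" by (rule group_aut_group)
  interpret A: subgroup "affine_auts n" "cube_group n" by (rule subgroup_affine_auts)
  have car: "f \<in> carrier (cube_group n)" if "f \<in> deck_group n c p" for f
    using that A.subset by (auto simp: deck_group_def)
  show ?thesis
  proof (rule subgroupI)
    show "deck_group n c p \<subseteq> carrier (cube_group n)" using car by blast
    have "\<one>\<^bsub>cube_group n\<^esub> \<in> deck_group n c p"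
      using parity_class_subset[of n c] by (auto simp: deck_group_def cube_group_one_apply)
    then show "deck_group n c p \<noteq> {}" by blast
  next
    fix f assume f: "f \<in> deck_group n c p"
    let ?i = "inv\<^bsub>cube_group n\<^esub> f"
    have "f ` parity_class n c = parity_class n c"
    proof (rule endo_inj_surj)
      show "finite (parity_class n c)"
        using finite_subset[OF parity_class_subset finite_F2_vectors] .
      show "f ` parity_class n c \<subseteq> parity_class n c" using f by (auto simp: deck_group_def)
      show "inj_on f (parity_class n c)"
        using cube_group_inv_apply(1)[OF car[OF f]] parity_class_subset[of n c]
        by (intro inj_on_inverseI[of _ ?i]) auto
    qed
    then have "?i x \<in> parity_class n c \<and> p (?i x) = p x" if x: "x \<in> parity_class n c" for x
    proof -
      obtain y where y: "y \<in> parity_class n c" "x = f y"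
        using x \<open>f ` parity_class n c = parity_class n c\<close> by blast
      then have "?i x = y" using cube_group_inv_apply(1)[OF car[OF f]] parity_class_subset by blast
      then show ?thesis using y f by (auto simp: deck_group_def)
    qed
    moreover have "?i \<in> affine_auts n" using f by (simp add: deck_group_def)
    ultimately show "?i \<in> deck_group n c p" by (simp add: deck_group_def)
  next
    fix f g assume fg: "f \<in> deck_group n c p" "g \<in> deck_group n c p"
    have "(f \<otimes>\<^bsub>cube_group n\<^esub> g) x = f (g x)" if "x \<in> parity_class n c" for x
      using cube_group_mult_apply[OF car car] fg that parity_class_subset by blast
    then show "f \<otimes>\<^bsub>cube_group n\<^esub> g \<in> deck_group n c p"
      using fg by (auto simp: deck_group_def)
  qed
qed

text \<open>A point is the intersection of two pairs through it. This needs a third point: for n = 2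
  the swap fixes the only pair.\<close>

lemma permutation_trivial_on_pairs:
  assumes n: "3 \<le> n" and s: "\<sigma> permutes {1..n}" and fixed: "\<And>P. P \<in> pairs n \<Longrightarrow> \<sigma> ` P = P"
  shows "\<sigma> = id"
proof (rule ext)
  fix i
  show "\<sigma> i = id i"
  proof (cases "i \<in> {1..n}")
    case True
    have ex: "\<exists>j \<in> {1..n}. j \<notin> T" if "finite T" "card T \<le> 2" for T
    proof (rule ccontr)
      assume "\<not> ?thesis"
      then have "card {1..n} \<le> card T" using that by (intro card_mono) auto
      then show False using n that by simp
    qed
    obtain j where j: "j \<in> {1..n}" "j \<noteq> i" using ex[of "{i}"] by auto
    have "card {i, j} \<le> 2" by (simp add: card_insert_if)
    then obtain l where l: "l \<in> {1..n}" "l \<noteq> i" "l \<noteq> j" using ex[of "{i, j}"] by auto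
    have "\<sigma> ` {i, j} = {i, j}" "\<sigma> ` {i, l} = {i, l}"
      using True j l by (auto intro!: fixed simp del: image_insert simp: doubleton_in_pairs)
    then have "\<sigma> i \<in> {i, j}" "\<sigma> i \<in> {i, l}" by blast+
    then show ?thesis using l by auto
  next
    case False
    then show ?thesis using permutes_not_in[OF s] by simp
  qed
qed

lemma pairs_subset: "P \<in> pairs n \<Longrightarrow> P \<subseteq> {1..n}"
  by (simp add: pairs_def)

lemma image_pairs: "\<lbrakk>\<sigma> permutes {1..n}; P \<in> pairs n\<rbrakk> \<Longrightarrow> \<sigma> ` P \<in> pairs n"
  using permutes_image[of \<sigma> "{1..n}"] card_image[OF inj_on_subset[OF permutes_inj[of \<sigma> "{1..n}"]]]
  by (auto simp: pairs_def simp del: atLeastAtMost_iff)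

text \<open>A deck transformation that fixes a vector also fixes its frame.\<close>

lemma deck_group_rigid:
  assumes n: "3 \<le> n" and cov: "is_cover n E c p" and k: "k \<in> deck_group n c p"
    and x: "x \<in> parity_class n c" and fixed: "k x = x"
  shows "k = \<one>\<^bsub>cube_group n\<^esub>"
proof -
  obtain t \<sigma> where k_eq: "k = cube_aut n t \<sigma>" "t \<in> F2_vectors n" "\<sigma> permutes {1..n}"
    using k by (auto simp: deck_group_def elim: affine_autsE)
  have xF: "x \<in> F2_vectors n" using x parity_class_subset by blast
  have "\<sigma> ` P = P" if P: "P \<in> pairs n" for P
  proof -
    have "k (x + chi P) = x + chi (\<sigma> ` P)"
      using cube_aut_add_chi[OF xF k_eq(3) pairs_subset[OF P]] fixed by (simp add: k_eq(1))
    moreover have "p (k (x + chi P)) = p (x + chi P)"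
      using k parity_class_add_pair[OF x P] by (auto simp: deck_group_def)
    ultimately show ?thesis
      using is_cover_inj[OF cov x] image_pairs[OF k_eq(3) P] P by metis
  qed
  then have id: "\<sigma> = id" using permutation_trivial_on_pairs[OF n k_eq(3)] by blast
  have "x + t = x" using fixed id cube_aut_apply[OF xF, of t \<sigma>] by (simp add: k_eq(1))
  then have "t = 0" by (metis vec_add_self_left vec_add_self)
  then show ?thesis using k_eq id cube_aut_zero_id by simp
qed


text \<open>The frames of \<open>p\<close> at \<open>x\<close> and of \<open>q\<close> at
  \<open>y\<close> differ by a permutation. The automorphism with this permutation that sends
  \<open>x\<close> to \<open>y\<close> turns \<open>q\<close> into a cover agreeing with
  \<open>p\<close> on a frame, hence on the whole class.\<close>

lemma lift_covers:
  assumes n: "5 \<le> n" and p: "is_cover n E c p" and q: "is_cover n E c' q"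
    and x: "x \<in> parity_class n c" and y: "y \<in> parity_class n c'" and eq: "p x = q y"
  obtains g where "g \<in> affine_auts n" "g x = y"
    "\<And>z. z \<in> F2_vectors n \<Longrightarrow> g z \<in> parity_class n c' \<longleftrightarrow> z \<in> parity_class n c"
    "\<And>z. z \<in> parity_class n c \<Longrightarrow> q (g z) = p z"
proof -
  have xF: "x \<in> F2_vectors n" and yF: "y \<in> F2_vectors n" using x y parity_class_subset by blast+
  obtain \<sigma> where s: "\<sigma> permutes {1..n}" and
    sP: "\<And>P. P \<in> pairs n \<Longrightarrow> p (x + chi P) = q (y + chi (\<sigma> ` P))"
    using frames_differ_by_permutation[OF n is_coverD[OF p x] is_coverD[OF q y]] eq
    by (metis add_0_right chi_empty)
  \<comment> \<open>The solution of \<open>(x + t) \<circ> Hilbert_Choice.inv \<sigma> = y\<close>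
    in characteristic 2.\<close>
  define t where "t = x + (y \<circ> \<sigma>)"
  define g where "g = cube_aut n t \<sigma>"
  have tF: "t \<in> F2_vectors n" unfolding t_def using F2_vectors_add[OF xF F2_vectors_comp[OF yF s]] .
  have g: "g \<in> affine_auts n" using tF s by (auto simp: g_def affine_auts_def)
  have "(y \<circ> \<sigma>) \<circ> Hilbert_Choice.inv \<sigma> = y" using permutes_inv_o(1)[OF s] by (simp add: comp_assoc)
  then have gx: "g x = y"
    by (simp only: g_def cube_aut_apply[OF xF] t_def vec_add_self_left)
  have "parity n t = c + c'"
    using x y by (simp only: t_def parity_add parity_comp[OF s] parity_class_def mem_Collect_eq)
  then have "parity n (g z) = parity n z + (c + c')" if "z \<in> F2_vectors n" for z
    using parity_cube_aut[OF that s] by (simp only: g_def)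
  moreover have "d + (c + c') = c' \<longleftrightarrow> d = c" for d :: bit by (cases c; cases c'; cases d) auto
  ultimately have cls: "g z \<in> parity_class n c' \<longleftrightarrow> z \<in> parity_class n c" if "z \<in> F2_vectors n" for z
    using that cube_aut_closed[OF that tF s] by (simp only: parity_class_def g_def mem_Collect_eq)
  have g_add: "g (z + chi P) = g z + chi (\<sigma> ` P)" if "z \<in> parity_class n c" "P \<subseteq> {1..n}" for z P
    using cube_aut_add_chi[OF _ s that(2)] that(1) parity_class_subset unfolding g_def by blast
  have gq: "is_cover n E c (\<lambda>z. q (g z))"
    unfolding is_cover_def
  proof
    fix z assume z: "z \<in> parity_class n c"
    then have gz: "g z \<in> parity_class n c'" using cls parity_class_subset by blast
    have "frame n E (\<lambda>P. q (g z + chi (\<sigma> ` P)))" using frame_permute[OF is_coverD[OF q gz] s] .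
    then show "frame n E (\<lambda>P. q (g (z + chi P)))"
      using g_add[OF z pairs_subset] g_add[OF z, of "{}"]
      by (subst frame_cong[of n _ "\<lambda>P. q (g z + chi (\<sigma> ` P))"]) simp_all
  qed
  have "q (g z) = p z" if z: "z \<in> parity_class n c" for z
  proof (rule is_cover_unique[OF gq p x _ _ z])
    show "q (g x) = p x" using gx eq by simp
    show "q (g (x + chi P)) = p (x + chi P)" if "P \<in> pairs n" for P
      using g_add[OF x pairs_subset[OF that]] gx sP[OF that] by simp
  qed
  then show ?thesis using that g gx cls by blast
qed

lemma deck_group_transitive:
  assumes n: "5 \<le> n" and p: "is_cover n E c p"
    and x: "x \<in> parity_class n c" and y: "y \<in> parity_class n c" and eq: "p x = p y"
  shows "\<exists>k \<in> deck_group n c p. y = k x"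
proof -
  obtain g where "g \<in> affine_auts n" "g x = y"
    "\<And>z. z \<in> F2_vectors n \<Longrightarrow> g z \<in> parity_class n c \<longleftrightarrow> z \<in> parity_class n c"
    "\<And>z. z \<in> parity_class n c \<Longrightarrow> p (g z) = p z"
    using lift_covers[OF n p p x y eq] by blast
  then have "g \<in> deck_group n c p" using parity_class_subset[of n c] by (auto simp: deck_group_def)
  then show ?thesis using \<open>g x = y\<close> by blast
qed

lemma parity_class_nonempty:
  assumes "1 \<le> n"
  obtains x where "x \<in> parity_class n c"
proof (cases "c = 0")
  case True
  then have "0 \<in> parity_class n c"
    using F2_vectors_zero by (simp add: parity_class_def parity_def)
  then show ?thesis by (rule that)
next
  case False
  then have "chi {1} \<in> parity_class n c"
    using assms F2_vectors_chi[of "{1}" n] parity_chi[of "{1}" n] by (simp add: parity_class_def)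
  then show ?thesis by (rule that)
qed

text \<open>A permutation of coordinates preserves parity, so an automorphism that keeps a vector in
  its class has a translation of parity 0.\<close>

lemma deck_group_even:
  assumes "1 \<le> n"
  shows "deck_group n c p \<subseteq> even_cube_group n"
proof
  fix k assume k: "k \<in> deck_group n c p"
  then obtain t \<sigma> where k_eq: "k = cube_aut n t \<sigma>" "t \<in> F2_vectors n" "\<sigma> permutes {1..n}"
    by (auto simp: deck_group_def elim: affine_autsE)
  obtain x where x: "x \<in> parity_class n c" using parity_class_nonempty[OF assms] .
  then have "parity n (k x) = c" "parity n x = c" "x \<in> F2_vectors n"
    using k by (auto simp: deck_group_def parity_class_def)
  then have "c + parity n t = c" using parity_cube_aut[OF _ k_eq(3), of x t] k_eq(1) by simp
  then have "parity n t = 0" by (metis add_cancel_left_right)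
  then have "t \<in> even_vectors n" using k_eq by (simp add: even_vectors_eq parity_class_def)
  then show "k \<in> even_cube_group n" using k_eq by (auto simp: even_cube_group_def)
qed

lemma deck_group_displacement_in_class:
  assumes n: "3 \<le> n" and irr: "irrefl E" and cov: "is_cover n E c p"
    and k: "k \<in> deck_group n c p" "k \<noteq> \<one>\<^bsub>cube_group n\<^esub>" and x: "x \<in> parity_class n c"
  shows "7 \<le> hamming_dist n x (k x)"
proof (rule ccontr)
  assume "\<not> ?thesis"
  moreover have "k x \<in> parity_class n c" "p (k x) = p x" using k x by (auto simp: deck_group_def)
  ultimately have "x = k x" by (intro is_cover_inj_le_6[OF cov irr x]) auto
  then have "k x = x" by (rule sym)
  then show False using deck_group_rigid[OF n cov k(1) x] k(2) by blast
qed

lemma card_sym_diff_singleton: "finite A \<Longrightarrow> card (sym_diff A {i}) \<le> card A + 1"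
proof -
  assume "finite A"
  moreover have "sym_diff A {i} \<subseteq> insert i A" by auto
  ultimately have "card (sym_diff A {i}) \<le> card (insert i A)" by (intro card_mono) auto
  also have "\<dots> \<le> card A + 1" using \<open>finite A\<close> by (simp add: card_insert_if)
  finally show ?thesis .
qed

text \<open>In the other parity class the displacement is bounded by moving to a neighbour \<open>x + chi {i}\<close>
  with \<open>i\<close> chosen, if possible, among the coordinates that \<open>k\<close> changes.\<close>

lemma deck_group_displacement:
  assumes n: "3 \<le> n" and irr: "irrefl E" and cov: "is_cover n E c p"
    and k: "k \<in> deck_group n c p" "k \<noteq> \<one>\<^bsub>cube_group n\<^esub>" and x: "x \<in> F2_vectors n"
  shows "7 \<le> hamming_dist n x (k x)"
proof (cases "x \<in> parity_class n c")
  case True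
  then show ?thesis using deck_group_displacement_in_class[OF n irr cov k] by blast
next
  case False
  show ?thesis
  proof (rule ccontr)
    assume "\<not> ?thesis"
    then have small: "card (supp n (x + k x)) \<le> 6" by (simp add: hamming_dist_eq_card_supp)
    define D where "D = supp n (x + k x)"
    obtain t \<sigma> where k_eq: "k = cube_aut n t \<sigma>" "t \<in> F2_vectors n" "\<sigma> permutes {1..n}"
      using k by (auto simp: deck_group_def elim: affine_autsE)
    have D: "finite D" "D \<subseteq> {1..n}" unfolding D_def by (rule finite_supp supp_subset)+
    obtain i where i: "i \<in> {1..n}" "D \<noteq> {} \<Longrightarrow> i \<in> D"
    proof (cases "D = {}")
      case True
      then show ?thesis using n by (intro that[of 1]) auto
    next
      case False
      then show ?thesis using D(2) that by blast
    qed
    have iS: "{i} \<subseteq> {1..n}" "\<sigma> ` {i} \<subseteq> {1..n}"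
      using i(1) permutes_in_image[OF k_eq(3), of i] by auto
    let ?x = "x + chi {i}"
    have xF: "?x \<in> F2_vectors n" using F2_vectors_add[OF x F2_vectors_chi[OF iS(1)]] .
    have "parity n ?x = parity n x + 1" using parity_chi[OF iS(1)] by (simp only: parity_add) simp
    moreover have "parity n x \<noteq> c" using False x by (simp add: parity_class_def)
    ultimately have "parity n ?x = c" by (cases c; cases "parity n x") auto
    then have "?x \<in> parity_class n c" using xF by (simp add: parity_class_def)
    then have far: "7 \<le> card (supp n (?x + k ?x))"
      using deck_group_displacement_in_class[OF n irr cov k] by (simp only: hamming_dist_eq_card_supp)
    have "x + k x \<in> F2_vectors n"
      using F2_vectors_add[OF x cube_aut_closed[OF x k_eq(2,3)]] by (simp only: k_eq(1))
    then have "x + k x = chi D" by (simp only: D_def chi_supp)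
    \<comment> \<open>Moving the vector along \<open>i\<close> moves its image along
      \<open>\<sigma> i\<close>, so the displacement changes in at most these two
      coordinates.\<close>
    moreover have "?x + k ?x = (x + k x) + chi {i} + chi (\<sigma> ` {i})"
      using cube_aut_add_chi[OF x k_eq(3) iS(1)] by (simp only: k_eq(1) ac_simps)
    ultimately have "?x + k ?x = chi (sym_diff (sym_diff D {i}) (\<sigma> ` {i}))"
      by (simp only: chi_add)
    moreover have "sym_diff (sym_diff D {i}) (\<sigma> ` {i}) \<subseteq> {1..n}" using D iS by blast
    ultimately have supp_eq: "supp n (?x + k ?x) = sym_diff (sym_diff D {i}) {\<sigma> i}"
      using supp_chi by (metis image_empty image_insert)
    \<comment> \<open>For nonempty \<open>D\<close> the choice of \<open>i\<close> in
      \<open>D\<close> removes one of at most six coordinates, which leaves room for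
      \<open>\<sigma> i\<close>.\<close>
    have "card (sym_diff D {i}) \<le> 5"
    proof (cases "D = {}")
      case True
      then show ?thesis by simp
    next
      case False
      then have "sym_diff D {i} = D - {i}" using i(2) by blast
      then show ?thesis using small i(2)[OF False] D(1) by (simp add: D_def)
    qed
    then have "card (supp n (?x + k ?x)) \<le> 6"
      unfolding supp_eq using card_sym_diff_singleton[of "sym_diff D {i}" "\<sigma> i"] D(1) by simp
    then show False using far by simp
  qed
qed

lemma one_in_even_cube_group: "\<one>\<^bsub>cube_group n\<^esub> \<in> even_cube_group n"
proof -
  have "0 \<in> even_vectors n" by (simp add: even_vectors_def F2_vectors_zero)
  then show ?thesis
    unfolding even_cube_group_def cube_aut_zero_id[symmetric] using permutes_id by blast
qed

text \<open>For \<open>n \<le> 6\<close> the cover is injective because all distances are at most 6,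
  and the trivial group is the right one. The deck group itself would be wrong for n = 2, where the
  swap of coordinates fixes both even vectors.\<close>

lemma ex_group_of_cover:
  assumes irr: "irrefl E" and cov: "is_cover n E c p"
  obtains K where "subgroup K (cube_group n)" "K \<subseteq> even_cube_group n"
    "\<And>k x. \<lbrakk>k \<in> K; k \<noteq> \<one>\<^bsub>cube_group n\<^esub>; x \<in> F2_vectors n\<rbrakk> \<Longrightarrow> 7 \<le> hamming_dist n x (k x)"
    "\<And>x y. \<lbrakk>x \<in> parity_class n c; y \<in> parity_class n c\<rbrakk> \<Longrightarrow> p x = p y \<longleftrightarrow> (\<exists>k \<in> K. y = k x)"
proof (cases "n \<le> 6")
  case True
  interpret group "cube_group n" by (rule group_aut_group)
  show ?thesis
  proof (rule that[of "{\<one>\<^bsub>cube_group n\<^esub>}"])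
    show "subgroup {\<one>\<^bsub>cube_group n\<^esub>} (cube_group n)" by (rule triv_subgroup)
    show "p x = p y \<longleftrightarrow> (\<exists>k \<in> {\<one>\<^bsub>cube_group n\<^esub>}. y = k x)"
      if "x \<in> parity_class n c" "y \<in> parity_class n c" for x y
      using is_cover_inj_le_6[OF cov irr that] that True hamming_dist_le[of n x y]
        cube_group_one_apply[of x n] parity_class_subset[of n c] by auto
  qed (use one_in_even_cube_group in auto)
next
  case False
  show ?thesis
  proof (rule that[of "deck_group n c p"])
    show "p x = p y \<longleftrightarrow> (\<exists>k \<in> deck_group n c p. y = k x)"
      if "x \<in> parity_class n c" "y \<in> parity_class n c" for x y
    proof
      show "\<exists>k \<in> deck_group n c p. y = k x" if "p x = p y"
        using deck_group_transitive[OF _ cov] that False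
          \<open>x \<in> parity_class n c\<close> \<open>y \<in> parity_class n c\<close> by simp
      show "p x = p y" if "\<exists>k \<in> deck_group n c p. y = k x"
        using that \<open>x \<in> parity_class n c\<close> by (auto simp: deck_group_def)
    qed
    show "7 \<le> hamming_dist n x (k x)"
      if "k \<in> deck_group n c p" "k \<noteq> \<one>\<^bsub>cube_group n\<^esub>" "x \<in> F2_vectors n" for k x
      using deck_group_displacement[OF _ irr cov that] False by simp
    show "deck_group n c p \<subseteq> even_cube_group n" using False by (intro deck_group_even) simp
  qed (rule subgroup_deck_group)
qed

text \<open>\<open>K\<close> already acts transitively on the fibres inside the deck group. A deck
  transformation therefore agrees at one vector with some member of \<open>K\<close>, and their
  quotient fixes that vector, so rigidity makes them equal.\<close>

lemma group_eq_deck_group: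
  assumes n: "3 \<le> n" and K: "subgroup K (cube_group n)" "K \<subseteq> even_cube_group n"
    and cov: "is_cover n E c p"
    and ker: "\<And>x y. \<lbrakk>x \<in> parity_class n c; y \<in> parity_class n c\<rbrakk> \<Longrightarrow> p x = p y \<longleftrightarrow> (\<exists>k \<in> K. y = k x)"
  shows "K = deck_group n c p"
proof
  interpret group "cube_group n" by (rule group_aut_group)
  have closed: "k x \<in> parity_class n c" if "k \<in> K" "x \<in> parity_class n c" for k x
    using even_cube_group_parity K(2) that by blast
  show sub: "K \<subseteq> deck_group n c p"
  proof
    fix k assume k: "k \<in> K"
    then have "k \<in> affine_auts n" using K(2) even_cube_group_subset by blast
    moreover have "p (k x) = p x" if "x \<in> parity_class n c" for x
      using ker[OF that closed[OF k that]] k by auto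
    ultimately show "k \<in> deck_group n c p" using closed[OF k] by (simp add: deck_group_def)
  qed
  show "deck_group n c p \<subseteq> K"
  proof
    fix m assume m: "m \<in> deck_group n c p"
    obtain x where x: "x \<in> parity_class n c" using parity_class_nonempty n by (metis le_trans one_le_numeral)
    have "m x \<in> parity_class n c" "p x = p (m x)" using m x by (auto simp: deck_group_def)
    then obtain k where k: "k \<in> K" "m x = k x" using ker[OF x] by blast
    have car: "k \<in> carrier (cube_group n)" "m \<in> carrier (cube_group n)"
      using subgroup.subset[OF subgroup_deck_group, of n c p] k m sub by blast+
    have xF: "x \<in> F2_vectors n" using x parity_class_subset by blast
    let ?d = "inv\<^bsub>cube_group n\<^esub> k \<otimes>\<^bsub>cube_group n\<^esub> m"
    have "?d \<in> deck_group n c p"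
      using subgroup_deck_group[of n c p] k m sub by (meson subgroup.m_closed subgroup.m_inv_closed subsetD)
    moreover have "?d x = x"
      using cube_group_mult_apply[OF _ car(2) xF] cube_group_inv_apply(1)[OF car(1) xF] k car by simp
    ultimately have "?d = \<one>\<^bsub>cube_group n\<^esub>" using deck_group_rigid[OF n cov _ x] by blast
    then have "k = m" using car by (metis inv_equality inv_inv inv_closed)
    then show "m \<in> K" using k by simp
  qed
qed

lemma group_trivial_if_small:
  assumes n: "n \<le> 6" and K: "subgroup K (cube_group n)"
    and disp: "\<And>k x. \<lbrakk>k \<in> K; k \<noteq> \<one>\<^bsub>cube_group n\<^esub>; x \<in> F2_vectors n\<rbrakk> \<Longrightarrow> 7 \<le> hamming_dist n x (k x)"
  shows "K = {\<one>\<^bsub>cube_group n\<^esub>}"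
proof -
  have "k = \<one>\<^bsub>cube_group n\<^esub>" if "k \<in> K" for k
    using disp[OF that _ F2_vectors_zero] hamming_dist_le[of n 0 "k 0"] n by force
  then show ?thesis using subgroup.one_closed[OF K] by blast
qed

text \<open>\<open>g\<close> matches the fibres of \<open>p\<close> with those of \<open>q\<close>,
  so conjugation by \<open>g\<close> and by its inverse carries the two deck groups into each
  other.\<close>

lemma conjugate_deck_groups:
  assumes g: "g \<in> affine_auts n"
    and cls: "\<And>z. z \<in> F2_vectors n \<Longrightarrow> g z \<in> parity_class n c' \<longleftrightarrow> z \<in> parity_class n c"
    and lift: "\<And>z. z \<in> parity_class n c \<Longrightarrow> q (g z) = p z"
  shows "conjugate_in (cube_group n) (deck_group n c p) (deck_group n c' q)"
proof -
  interpret group "cube_group n" by (rule group_aut_group)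
  let ?G = "cube_group n"
  let ?i = "inv\<^bsub>?G\<^esub> g"
  have A: "subgroup (affine_auts n) ?G" by (rule subgroup_affine_auts)
  have gc: "g \<in> carrier ?G" "?i \<in> carrier ?G" using g subgroup.subset[OF A] by auto
  have i: "?i \<in> affine_auts n" using subgroup.m_inv_closed[OF A g] .
  have deck: "k \<in> affine_auts n" "k \<in> carrier ?G" if "k \<in> deck_group n d r" for k d and r :: "_ \<Rightarrow> 'b"
    using that subgroup.subset[OF A] by (auto simp: deck_group_def)
  have F: "z \<in> F2_vectors n" if "z \<in> parity_class n d" for z d using that parity_class_subset by blast
  have icls: "?i w \<in> parity_class n c" "q w = p (?i w)" if w: "w \<in> parity_class n c'" for w
  proof -
    have "g (?i w) = w" "?i w \<in> F2_vectors n"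
      using cube_group_inv_apply(2)[OF gc(1) F[OF w]] cube_group_closed[OF gc(2) F[OF w]] by auto
    then show "?i w \<in> parity_class n c" "q w = p (?i w)" using cls lift w by metis+
  qed
  have gcls: "g z \<in> parity_class n c'" if "z \<in> parity_class n c" for z using cls F that by blast
  have "deck_group n c' q = (\<lambda>k. g \<otimes>\<^bsub>?G\<^esub> k \<otimes>\<^bsub>?G\<^esub> ?i) ` deck_group n c p"
  proof
    show "(\<lambda>k. g \<otimes>\<^bsub>?G\<^esub> k \<otimes>\<^bsub>?G\<^esub> ?i) ` deck_group n c p \<subseteq> deck_group n c' q"
    proof
      fix l assume "l \<in> (\<lambda>k. g \<otimes>\<^bsub>?G\<^esub> k \<otimes>\<^bsub>?G\<^esub> ?i) ` deck_group n c p"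
      then obtain k where k: "k \<in> deck_group n c p" "l = g \<otimes>\<^bsub>?G\<^esub> k \<otimes>\<^bsub>?G\<^esub> ?i" by blast
      have "l \<in> affine_auts n" using k deck(1)[OF k(1)] g i by (simp add: subgroup.m_closed[OF A])
      moreover have "l w \<in> parity_class n c' \<and> q (l w) = q w" if w: "w \<in> parity_class n c'" for w
      proof -
        have "l w = g (k (?i w))"
          using k deck(2)[OF k(1)] gc F[OF w] cube_group_closed[OF gc(2) F[OF w]]
          by (simp add: cube_group_mult_apply)
        moreover have "k (?i w) \<in> parity_class n c" "p (k (?i w)) = p (?i w)"
          using k(1) icls(1)[OF w] by (auto simp: deck_group_def)
        ultimately show ?thesis using gcls lift icls(2)[OF w] by simp
      qed
      ultimately show "l \<in> deck_group n c' q" by (simp add: deck_group_def)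
    qed
    show "deck_group n c' q \<subseteq> (\<lambda>k. g \<otimes>\<^bsub>?G\<^esub> k \<otimes>\<^bsub>?G\<^esub> ?i) ` deck_group n c p"
    proof
      fix l assume l: "l \<in> deck_group n c' q"
      define k where "k = ?i \<otimes>\<^bsub>?G\<^esub> l \<otimes>\<^bsub>?G\<^esub> g"
      have lc: "l \<in> carrier ?G" using deck(2)[OF l] .
      have "k \<in> affine_auts n" using deck(1)[OF l] g i by (simp add: k_def subgroup.m_closed[OF A])
      moreover have "k z \<in> parity_class n c \<and> p (k z) = p z" if z: "z \<in> parity_class n c" for z
      proof -
        have "k z = ?i (l (g z))"
          using lc gc F[OF z] cube_group_closed[OF gc(1) F[OF z]]
          by (simp add: k_def cube_group_mult_apply)
        moreover have "l (g z) \<in> parity_class n c'" "q (l (g z)) = q (g z)"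
          using l gcls[OF z] by (auto simp: deck_group_def)
        ultimately show ?thesis using icls lift[OF z] by metis
      qed
      ultimately have "k \<in> deck_group n c p" by (simp add: deck_group_def)
      moreover have "l = g \<otimes>\<^bsub>?G\<^esub> k \<otimes>\<^bsub>?G\<^esub> ?i"
        using gc lc m_assoc[of g ?i l, symmetric] by (simp add: k_def m_assoc)
      ultimately show "l \<in> (\<lambda>k. g \<otimes>\<^bsub>?G\<^esub> k \<otimes>\<^bsub>?G\<^esub> ?i) ` deck_group n c p" by blast
    qed
  qed
  then show ?thesis using gc by (auto simp: conjugate_in_def)
qed


section \<open>Graphs as relations\<close>

text \<open>A library isomorphism has a separate map on arcs and may rename the head and tail
  functions. With projections on both sides the arc map is forced to be
  \<open>map_prod f f\<close>.\<close>

lemma digraph_iso_conv: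
  assumes "wf_digraph A" "wf_digraph B"
    and proj: "tail A = fst" "head A = snd" "tail B = fst" "head B = snd"
  shows "digraph_iso A B \<longleftrightarrow>
    (\<exists>f. bij_betw f (verts A) (verts B) \<and>
      (\<forall>u \<in> verts A. \<forall>v \<in> verts A. (u, v) \<in> arcs A \<longleftrightarrow> (f u, f v) \<in> arcs B))"
proof -
  interpret A: wf_digraph A by fact
  interpret B: wf_digraph B by fact
  have A_verts: "u \<in> verts A" "v \<in> verts A" if "(u, v) \<in> arcs A" for u v
    using A.tail_in_verts[OF that] A.head_in_verts[OF that] proj by auto
  have B_verts: "u \<in> verts B" "v \<in> verts B" if "(u, v) \<in> arcs B" for u v
    using B.tail_in_verts[OF that] B.head_in_verts[OF that] proj by auto
  show ?thesis
  proof
    assume "digraph_iso A B"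
    then obtain h where h: "A.digraph_isomorphism h" "B = app_iso h A"
      by (auto simp: digraph_iso_def)
    define f where "f = iso_verts h"
    have inj: "inj_on f (verts A)" using h by (simp add: f_def A.digraph_isomorphism_def)
    have tl: "iso_tail h = fst" "iso_head h = snd" using proj(3,4) h(2) by auto
    have "iso_arcs h (u, v) = (f u, f v)" if "(u, v) \<in> arcs A" for u v
      using h(1) that by (auto simp: A.digraph_isomorphism_def f_def tl proj prod_eq_iff)
    then have "iso_arcs h ` arcs A = map_prod f f ` arcs A" by (intro image_cong) auto
    then have arcs_B: "arcs B = map_prod f f ` arcs A" using h(2) by simp
    have "(u, v) \<in> arcs A \<longleftrightarrow> (f u, f v) \<in> arcs B" if uv: "u \<in> verts A" "v \<in> verts A" for u v
    proof
      show "(f u, f v) \<in> arcs B" if "(u, v) \<in> arcs A" using that arcs_B by auto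
      assume "(f u, f v) \<in> arcs B"
      then obtain u' v' where "(u', v') \<in> arcs A" "f u = f u'" "f v = f v'" using arcs_B by auto
      then show "(u, v) \<in> arcs A" using inj uv A_verts by (metis inj_onD)
    qed
    moreover have "bij_betw f (verts A) (verts B)" using inj h(2) by (simp add: bij_betw_def f_def)
    ultimately show "\<exists>f. bij_betw f (verts A) (verts B) \<and>
      (\<forall>u \<in> verts A. \<forall>v \<in> verts A. (u, v) \<in> arcs A \<longleftrightarrow> (f u, f v) \<in> arcs B)" by blast
  next
    assume "\<exists>f. bij_betw f (verts A) (verts B) \<and>
      (\<forall>u \<in> verts A. \<forall>v \<in> verts A. (u, v) \<in> arcs A \<longleftrightarrow> (f u, f v) \<in> arcs B)"
    then obtain f where f: "bij_betw f (verts A) (verts B)"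
      "\<And>u v. \<lbrakk>u \<in> verts A; v \<in> verts A\<rbrakk> \<Longrightarrow> (u, v) \<in> arcs A \<longleftrightarrow> (f u, f v) \<in> arcs B" by blast
    define h where "h = \<lparr>iso_verts = f, iso_arcs = map_prod f f, iso_head = snd, iso_tail = fst\<rparr>"
    have "inj_on (map_prod f f) (arcs A)"
    proof (rule inj_on_subset)
      show "inj_on (map_prod f f) (verts A \<times> verts A)"
        using f(1) by (intro map_prod_inj_on) (auto simp: bij_betw_def)
      show "arcs A \<subseteq> verts A \<times> verts A" using A_verts by auto
    qed
    then have "A.digraph_isomorphism h"
      using f(1) A.wf_digraph by (auto simp: A.digraph_isomorphism_def h_def bij_betw_def proj)
    moreover have "B = app_iso h A"
    proof (rule pre_digraph.equality)
      show "verts B = verts (app_iso h A)" using f(1) by (simp add: h_def bij_betw_def)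
      have "e \<in> map_prod f f ` arcs A" if "e \<in> arcs B" for e
      proof -
        obtain x y where e: "e = (x, y)" by (cases e)
        have "x \<in> f ` verts A" "y \<in> f ` verts A"
          using B_verts[of x y] that e f(1) by (auto simp: bij_betw_def)
        then obtain u v where "u \<in> verts A" "v \<in> verts A" "x = f u" "y = f v" by blast
        then have "(u, v) \<in> arcs A" "e = map_prod f f (u, v)" using f(2)[of u v] that e by simp_all
        then show ?thesis by (rule rev_image_eqI)
      qed
      moreover have "map_prod f f ` arcs A \<subseteq> arcs B"
      proof
        fix e assume "e \<in> map_prod f f ` arcs A"
        then obtain u v where "(u, v) \<in> arcs A" "e = (f u, f v)" by auto
        then show "e \<in> arcs B" using f(2) A_verts by metis
      qed
      ultimately show "arcs B = arcs (app_iso h A)" by (auto simp: h_def)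
    qed (simp_all add: proj h_def)
    ultimately show "digraph_iso A B" by (auto simp: digraph_iso_def)
  qed
qed

lemma wf_with_proj: "pair_wf_digraph G \<Longrightarrow> wf_digraph (with_proj G)"
  by unfold_locales (auto dest: pair_wf_digraph.wellformed')

lemma connected_conv_rtrancl:
  assumes wf: "pair_wf_digraph G" and sym: "sym (parcs G)"
  shows "connected (with_proj G) \<longleftrightarrow>
    pverts G \<noteq> {} \<and> (\<forall>u \<in> pverts G. \<forall>v \<in> pverts G. (u, v) \<in> (parcs G)\<^sup>*)"
proof -
  interpret pair_wf_digraph G by fact
  have "symcl (parcs G) = parcs G" using sym by (auto simp: symcl_def sym_def)
  then have "connected (with_proj G) \<longleftrightarrow>
      pverts G \<noteq> {} \<and> (\<forall>u \<in> pverts G. \<forall>v \<in> pverts G. u \<rightarrow>\<^sup>*\<^bsub>with_proj G\<^esub> v)"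
    by (simp add: connected_conv reachable_def)
  then show ?thesis by (simp add: reachable_conv)
qed

section \<open>Path distances, minimum displacement and local structure\<close>

lemma numeral_le_ereal_of_nat: "numeral w \<le> ereal (real m) \<longleftrightarrow> numeral w \<le> m"
proof -
  have "numeral w = ereal (real (numeral w))" by simp
  then show ?thesis by (simp only: ereal_less_eq(3) of_nat_le_iff)
qed

lemma graph_dist_conv:
  assumes "pair_wf_digraph G"
  shows "graph_dist G u v = (INF p \<in> {p. u \<in> pverts G \<and> set p \<subseteq> parcs G \<and> pcas u p v}. ereal (length p))"
proof -
  interpret pair_wf_digraph G by fact
  have "awalk_cost (\<lambda>_. 1) p = length p" for p :: "('a \<times> 'a) list"
    by (induction p) auto
  then show ?thesis by (simp add: graph_dist_def \<mu>_def awalk_def)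
qed

lemma graph_dist_le:
  assumes "pair_wf_digraph G" "u \<in> pverts G" "set p \<subseteq> parcs G" "pcas u p v"
  shows "graph_dist G u v \<le> ereal (length p)"
  unfolding graph_dist_conv[OF assms(1)] using assms(2-4) by (intro INF_lower) simp

lemma graph_dist_ge:
  assumes "pair_wf_digraph G" "\<And>p. \<lbrakk>set p \<subseteq> parcs G; pcas u p v\<rbrakk> \<Longrightarrow> m \<le> length p"
  shows "ereal m \<le> graph_dist G u v"
  unfolding graph_dist_conv[OF assms(1)] using assms(2) by (intro INF_greatest) simp

lemma graph_dist_eq_2_iff:
  assumes wf: "pair_wf_digraph G" and u: "u \<in> pverts G"
  shows "graph_dist G u v = 2 \<longleftrightarrow>
    u \<noteq> v \<and> (u, v) \<notin> parcs G \<and> (\<exists>w. (u, w) \<in> parcs G \<and> (w, v) \<in> parcs G)"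
proof
  assume d: "graph_dist G u v = 2"
  have long: "2 \<le> length p" if "set p \<subseteq> parcs G" "pcas u p v" for p
    using graph_dist_le[OF wf u that] by (simp only: d numeral_le_ereal_of_nat)
  \<comment> \<open>The distance is an infimum; a strict upper bound is what produces an actual
    walk.\<close>
  have "graph_dist G u v < 3" using d by simp
  then obtain p where p: "set p \<subseteq> parcs G" "pcas u p v" "ereal (length p) < 3"
    unfolding graph_dist_conv[OF wf] by (auto simp: INF_less_iff)
  have "length p < 3" using p(3) numeral_le_ereal_of_nat by (metis leD leI)
  then have "length p = 2" using long[OF p(1,2)] by simp
  then obtain e e' where "p = [e, e']" by (auto simp: numeral_2_eq_2 length_Suc_conv)
  then have "(u, snd e) \<in> parcs G" "(snd e, v) \<in> parcs G" using p(1,2) by (cases e; cases e'; auto)+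
  moreover have "u \<noteq> v" using long[of "[]"] by auto
  moreover have "(u, v) \<notin> parcs G" using long[of "[(u, v)]"] by auto
  ultimately show "u \<noteq> v \<and> (u, v) \<notin> parcs G \<and> (\<exists>w. (u, w) \<in> parcs G \<and> (w, v) \<in> parcs G)" by blast
next
  assume r: "u \<noteq> v \<and> (u, v) \<notin> parcs G \<and> (\<exists>w. (u, w) \<in> parcs G \<and> (w, v) \<in> parcs G)"
  then obtain w where "(u, w) \<in> parcs G" "(w, v) \<in> parcs G" by blast
  then have "graph_dist G u v \<le> ereal (length [(u, w), (w, v)])"
    by (intro graph_dist_le[OF wf u]) auto
  moreover have "ereal (real 2) \<le> graph_dist G u v"
  proof (rule graph_dist_ge[OF wf])
    fix p assume p: "set p \<subseteq> parcs G" "pcas u p v"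
    show "2 \<le> length p"
    proof (cases p)
      case Nil
      then show ?thesis using p r by simp
    next
      case (Cons e q)
      then show ?thesis using p r by (cases q; cases e) auto
    qed
  qed
  ultimately show "graph_dist G u v = 2" by (simp add: order_antisym)
qed

lemma hamming_dist_triangle: "hamming_dist n x z \<le> hamming_dist n x y + hamming_dist n y z"
proof -
  have "{i \<in> {1..n}. x i \<noteq> z i} \<subseteq> {i \<in> {1..n}. x i \<noteq> y i} \<union> {i \<in> {1..n}. y i \<noteq> z i}" by auto
  then have "hamming_dist n x z \<le> card ({i \<in> {1..n}. x i \<noteq> y i} \<union> {i \<in> {1..n}. y i \<noteq> z i})"
    unfolding hamming_dist_def by (intro card_mono) auto
  then show ?thesis unfolding hamming_dist_def using card_Un_le le_trans by blast
qed

lemma in_parcs_cube_iff: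
  assumes "x \<in> F2_vectors n"
  shows "(x, y) \<in> parcs (cube n) \<longleftrightarrow> (\<exists>i \<in> {1..n}. y = x + chi {i})"
proof
  assume "(x, y) \<in> parcs (cube n)"
  then have y: "y \<in> F2_vectors n" and "card (supp n (x + y)) = 1"
    by (auto simp: cube_def hamming_dist_eq_card_supp)
  then obtain i where i: "supp n (x + y) = {i}" by (auto simp: card_1_singleton_iff)
  have "x + y = chi {i}" using chi_supp[OF F2_vectors_add[OF assms y]] i by metis
  then have "y = x + chi {i}" by (metis vec_add_self_left)
  moreover have "i \<in> {1..n}" using supp_subset[of n "x + y"] i by blast
  ultimately show "\<exists>i \<in> {1..n}. y = x + chi {i}" by blast
next
  assume "\<exists>i \<in> {1..n}. y = x + chi {i}"
  then obtain i where i: "i \<in> {1..n}" "y = x + chi {i}" by blast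
  then have "{i} \<subseteq> {1..n}" by blast
  then show "(x, y) \<in> parcs (cube n)"
    using assms F2_vectors_add F2_vectors_chi hamming_dist_add_chi[of "{i}" n x]
    by (simp add: cube_def i(2))
qed

text \<open>The triangle inequality bounds every walk from below, and flipping the differing
  coordinates one at a time gives a walk that attains the bound.\<close>

lemma graph_dist_cube:
  assumes x: "x \<in> F2_vectors n" and y: "y \<in> F2_vectors n"
  shows "graph_dist (cube n) x y = ereal (hamming_dist n x y)"
proof (rule order_antisym)
  have wf: "pair_wf_digraph (cube n)"
    using pair_graph_cube[of n] by (simp add: pair_graph_def pair_digraph_def pair_fin_digraph_def)
  show "ereal (real (hamming_dist n x y)) \<le> graph_dist (cube n) x y"
  proof (rule graph_dist_ge[OF wf])
    fix p assume "set p \<subseteq> parcs (cube n)" "pcas x p y"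
    then show "hamming_dist n x y \<le> length p"
    proof (induction p arbitrary: x)
      case Nil
      then show ?case by (simp add: hamming_dist_def)
    next
      case (Cons e p)
      obtain z where z: "e = (x, z)" using Cons.prems by (cases e) auto
      then have "hamming_dist n x z = 1" using Cons.prems by (simp add: cube_def)
      moreover have "hamming_dist n z y \<le> length p" using Cons z by simp
      ultimately show ?case using hamming_dist_triangle[of n x y z] by simp
    qed
  qed
  have "\<exists>p. set p \<subseteq> parcs (cube n) \<and> pcas x p (x + chi S) \<and> length p = card S"
    if "finite S" "S \<subseteq> {1..n}" for S
    using that x
  proof (induction S arbitrary: x rule: finite_induct)
    case empty
    show ?case unfolding chi_empty add_0_right by (intro exI[of _ "[]"]) simp
  next
    case (insert i S)
    have i: "i \<in> {1..n}" "{i} \<subseteq> {1..n}" "S \<subseteq> {1..n}" using insert.prems(1) by blast+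
    have "x + chi {i} \<in> F2_vectors n" using F2_vectors_add[OF insert.prems(2) F2_vectors_chi[OF i(2)]] .
    then obtain p where p: "set p \<subseteq> parcs (cube n)" "pcas (x + chi {i}) p (x + chi {i} + chi S)" "length p = card S"
      using insert.IH[OF i(3)] by blast
    have "chi (insert i S) = chi {i} + chi S" using insert.hyps chi_disjoint_Un[of "{i}" S] by simp
    then have "x + chi {i} + chi S = x + chi (insert i S)" by (simp only: add.assoc)
    then have "pcas (x + chi {i}) p (x + chi (insert i S))" using p(2) by metis
    moreover have "(x, x + chi {i}) \<in> parcs (cube n)"
      using in_parcs_cube_iff[OF insert.prems(2)] i(1) by blast
    moreover have "length ((x, x + chi {i}) # p) = card (insert i S)" using p(3) insert.hyps by simp
    ultimately show ?case
      using p(1) by (intro exI[of _ "(x, x + chi {i}) # p"])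
        (simp only: pcas.simps fst_conv snd_conv list.set insert_subset simp_thms)
  qed
  from this[OF finite_supp supp_subset, of "x + y"]
  obtain p where p: "set p \<subseteq> parcs (cube n)" "pcas x p (x + chi (supp n (x + y)))"
    "length p = card (supp n (x + y))" by blast
  have "x + chi (supp n (x + y)) = y"
    using chi_supp[OF F2_vectors_add[OF x y]] by (metis vec_add_self_left)
  then show "graph_dist (cube n) x y \<le> ereal (real (hamming_dist n x y))"
    using graph_dist_le[OF wf _ p(1), of x y] p x by (simp add: hamming_dist_eq_card_supp)
qed

lemma min_displacement_ge_iff:
  assumes K: "K \<subseteq> carrier (cube_group n)"
  shows "7 \<le> min_displacement (cube n) K \<longleftrightarrow>
    (\<forall>k \<in> K. k \<noteq> \<one>\<^bsub>cube_group n\<^esub> \<longrightarrow> (\<forall>x \<in> F2_vectors n. 7 \<le> hamming_dist n x (k x)))"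
proof -
  have "7 \<le> graph_dist (cube n) x (k x) \<longleftrightarrow> 7 \<le> hamming_dist n x (k x)"
    if "k \<in> K" "x \<in> F2_vectors n" for k x
  proof -
    have "k x \<in> F2_vectors n" using that K cube_group_closed by blast
    then show ?thesis
      using graph_dist_cube[OF that(2)] by (simp only: numeral_le_ereal_of_nat)
  qed
  moreover have "7 \<le> min_displacement (cube n) K \<longleftrightarrow>
      (\<forall>k \<in> K. k \<noteq> \<one>\<^bsub>cube_group n\<^esub> \<longrightarrow> (\<forall>x \<in> F2_vectors n. 7 \<le> graph_dist (cube n) x (k x)))"
    unfolding min_displacement_def pverts_cube by (auto simp only: le_Inf_iff mem_Collect_eq)
  ultimately show ?thesis by metis
qed

lemma is_locally_triangular_iff:
  assumes G: "pair_wf_digraph G"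
  shows "is_locally G (triangular_graph n) \<longleftrightarrow> (\<forall>u \<in> pverts G. \<exists>f. frame n (parcs G) f \<and> f {} = u)"
proof -
  interpret pair_wf_digraph G by fact
  have T: "wf_digraph (with_proj (triangular_graph n))"
    using pair_graph_triangular_graph[of n]
    by (intro wf_with_proj) (simp add: pair_graph_def pair_digraph_def pair_fin_digraph_def)
  have T_simps: "pverts (triangular_graph n) = pairs n"
    "(P, Q) \<in> parcs (triangular_graph n) \<longleftrightarrow> P \<in> pairs n \<and> Q \<in> pairs n \<and> card (P \<inter> Q) = 1" for P Q
    by (auto simp: triangular_graph_def pairs_def)
  have "digraph_iso (with_proj G \<restriction> neighbourhood G u) (with_proj (triangular_graph n)) \<longleftrightarrow>
      (\<exists>f. frame n (parcs G) f \<and> f {} = u)" (is "?L \<longleftrightarrow> ?R") for u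
  proof -
    have nb: "neighbourhood G u = parcs G `` {u}" by (auto simp: neighbourhood_def)
    have "wf_digraph (with_proj G \<restriction> neighbourhood G u)"
      by (rule wellformed_induce_subgraph)
    note conv = digraph_iso_conv[OF this T]
    have L: "?L \<longleftrightarrow> (\<exists>f. bij_betw f (parcs G `` {u}) (pairs n) \<and>
        (\<forall>v \<in> parcs G `` {u}. \<forall>w \<in> parcs G `` {u}. (v, w) \<in> parcs G \<longleftrightarrow> card (f v \<inter> f w) = 1))"
      (is "_ \<longleftrightarrow> (\<exists>f. ?iso f)")
    proof -
      have "?L \<longleftrightarrow> (\<exists>f. bij_betw f (parcs G `` {u}) (pairs n) \<and>
        (\<forall>v \<in> parcs G `` {u}. \<forall>w \<in> parcs G `` {u}.
          (v, w) \<in> parcs G \<longleftrightarrow> f v \<in> pairs n \<and> f w \<in> pairs n \<and> card (f v \<inter> f w) = 1))"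
        by (subst conv) (simp_all add: nb T_simps)
      moreover have "(\<forall>v \<in> parcs G `` {u}. \<forall>w \<in> parcs G `` {u}.
          (v, w) \<in> parcs G \<longleftrightarrow> f v \<in> pairs n \<and> f w \<in> pairs n \<and> card (f v \<inter> f w) = 1) \<longleftrightarrow>
        (\<forall>v \<in> parcs G `` {u}. \<forall>w \<in> parcs G `` {u}. (v, w) \<in> parcs G \<longleftrightarrow> card (f v \<inter> f w) = 1)"
        if f: "bij_betw f (parcs G `` {u}) (pairs n)" for f
      proof (intro ball_cong refl)
        fix v w assume "v \<in> parcs G `` {u}" "w \<in> parcs G `` {u}"
        then have "f v \<in> pairs n" "f w \<in> pairs n" using bij_betwE[OF f] by blast+
        then show "((v, w) \<in> parcs G \<longleftrightarrow> f v \<in> pairs n \<and> f w \<in> pairs n \<and> card (f v \<inter> f w) = 1) \<longleftrightarrow>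
          ((v, w) \<in> parcs G \<longleftrightarrow> card (f v \<inter> f w) = 1)" by blast
      qed
      ultimately show ?thesis by (simp cong: conj_cong)
    qed
    show ?thesis
    proof
      assume ?L
      then obtain f where f: "?iso f" using L by blast
      \<comment> \<open>A frame points from pairs to vertices, opposite to the given isomorphism.
        The empty set is not a pair, so its value is free to record the centre.\<close>
      define g where "g P = (if P = {} then u else inv_into (parcs G `` {u}) f P)" for P
      have inv: "bij_betw (inv_into (parcs G `` {u}) f) (pairs n) (parcs G `` {u})"
        using f by (simp add: bij_betw_inv_into)
      have g_eq: "g P = inv_into (parcs G `` {u}) f P" if "P \<in> pairs n" for P
        using that empty_not_in_pairs by (auto simp: g_def)
      have g: "bij_betw g (pairs n) (parcs G `` {u})"
        using inv bij_betw_cong[of "pairs n" g "inv_into (parcs G `` {u}) f"] g_eq by blast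
      have fg: "f (g P) = P" if "P \<in> pairs n" for P
        using that bij_betw_inv_into_right[OF conjunct1[OF f] that] g_eq by simp
      have base: "g {} = u" by (simp add: g_def)
      have "frame n (parcs G) g"
        unfolding frame_def base
      proof (intro conjI ballI)
        show "inj_on g (pairs n)" "g ` pairs n = parcs G `` {u}" using g by (auto simp: bij_betw_def)
        fix P Q assume PQ: "P \<in> pairs n" "Q \<in> pairs n"
        then have "g P \<in> parcs G `` {u}" "g Q \<in> parcs G `` {u}" using bij_betwE[OF g] by blast+
        then have "(g P, g Q) \<in> parcs G \<longleftrightarrow> card (f (g P) \<inter> f (g Q)) = 1" using f by blast
        then show "(g P, g Q) \<in> parcs G \<longleftrightarrow> card (P \<inter> Q) = 1" by (simp only: fg PQ)
      qed
      then show ?R using base by blast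
    next
      assume ?R
      then obtain f where f: "frame n (parcs G) f" "f {} = u" by blast
      then have b: "bij_betw f (pairs n) (parcs G `` {u})" by (simp add: frame_def bij_betw_def)
      define g where "g = inv_into (pairs n) f"
      have "bij_betw g (parcs G `` {u}) (pairs n)" using b by (simp add: g_def bij_betw_inv_into)
      moreover have "f (g v) = v" if "v \<in> parcs G `` {u}" for v
        using that b by (simp add: g_def bij_betw_inv_into_right)
      ultimately have "?iso g" using frame_adj[OF f(1)] by (metis bij_betwE)
      then show ?L using L by blast
    qed
  qed
  then show ?thesis by (simp add: is_locally_def)
qed


section \<open>Normal quotients of cubes\<close>

lemma orbit_eq_iff:
  assumes K: "subgroup K (cube_group n)" and xy: "x \<in> F2_vectors n" "y \<in> F2_vectors n"
  shows "orbit K x = orbit K y \<longleftrightarrow> (\<exists>k \<in> K. y = k x)"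
proof -
  interpret group "cube_group n" by (rule group_aut_group)
  have car: "k \<in> carrier (cube_group n)" if "k \<in> K" for k using subgroup.subset[OF K] that by blast
  have self: "z \<in> orbit K z" if "z \<in> F2_vectors n" for z
    unfolding orbit_def using subgroup.one_closed[OF K] cube_group_one_apply[OF that] by (metis imageI)
  have sub: "orbit K (k z) \<subseteq> orbit K z" if k: "k \<in> K" and z: "z \<in> F2_vectors n" for k z
  proof
    fix w assume "w \<in> orbit K (k z)"
    then obtain l where l: "l \<in> K" "w = l (k z)" by (auto simp: orbit_def)
    then have "w = (l \<otimes>\<^bsub>cube_group n\<^esub> k) z" using cube_group_mult_apply[OF car car z] k by simp
    then show "w \<in> orbit K z" using subgroup.m_closed[OF K l(1) k] by (auto simp: orbit_def)
  qed
  show ?thesis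
  proof
    assume "orbit K x = orbit K y"
    then have "y \<in> orbit K x" using self xy by blast
    then show "\<exists>k \<in> K. y = k x" by (auto simp: orbit_def)
  next
    assume "\<exists>k \<in> K. y = k x"
    then obtain k where k: "k \<in> K" "y = k x" by blast
    have "x = (inv\<^bsub>cube_group n\<^esub> k) y" using cube_group_inv_apply(1)[OF car xy(1)] k by simp
    then have "orbit K x \<subseteq> orbit K y" using sub[OF subgroup.m_inv_closed[OF K k(1)] xy(2)] by simp
    then show "orbit K x = orbit K y" using sub[OF k(1) xy(1)] k(2) by blast
  qed
qed

text \<open>The conditions on \<open>K\<close> with the displacement expressed through Hamming
  distances. For positive \<open>n\<close> both parity classes are nonempty, so there are really two
  halves.\<close>

locale cube_quotient =
  fixes n :: nat and K :: "((nat \<Rightarrow> bit) \<Rightarrow> nat \<Rightarrow> bit) set"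
  assumes n_pos: "1 \<le> n" and subgroup_K: "subgroup K (cube_group n)"
    and even_K: "K \<subseteq> even_cube_group n"
    and displacement_K: "\<lbrakk>k \<in> K; k \<noteq> \<one>\<^bsub>cube_group n\<^esub>; x \<in> F2_vectors n\<rbrakk> \<Longrightarrow> 7 \<le> hamming_dist n x (k x)"
begin

abbreviation "N \<equiv> normal_quotient (cube n) K"
abbreviation "D \<equiv> distance2_graph N"
abbreviation "orb \<equiv> orbit K"

lemmas orb_eq_iff = orbit_eq_iff[OF subgroup_K]

lemma orb_eq_parity:
  assumes "x \<in> F2_vectors n" "y \<in> F2_vectors n" "orb x = orb y"
  shows "parity n x = parity n y"
proof -
  obtain k where k: "k \<in> K" "y = k x" using orb_eq_iff assms by blast
  have "x \<in> parity_class n (parity n x)" using assms by (simp add: parity_class_def)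
  then have "k x \<in> parity_class n (parity n x)" using even_cube_group_parity even_K k by blast
  then show ?thesis using k by (simp add: parity_class_def)
qed

lemma orb_eq_imp_eq:
  assumes "x \<in> F2_vectors n" "y \<in> F2_vectors n" "orb x = orb y" "hamming_dist n x y \<le> 6"
  shows "x = y"
proof -
  obtain k where k: "k \<in> K" "y = k x" using orb_eq_iff assms by blast
  then have "k = \<one>\<^bsub>cube_group n\<^esub>" using displacement_K[OF k(1) _ assms(1)] assms(4) by force
  then show ?thesis using k cube_group_one_apply[OF assms(1)] by simp
qed

lemma orb_add_chi_eq_iff:
  assumes x: "x \<in> F2_vectors n" and S: "S \<subseteq> {1..n}" "T \<subseteq> {1..n}" "card (sym_diff S T) \<le> 6"
  shows "orb (x + chi S) = orb (x + chi T) \<longleftrightarrow> S = T"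
proof
  assume eq: "orb (x + chi S) = orb (x + chi T)"
  have "x + chi S + chi (sym_diff S T) = x + (chi S + (chi S + chi T))"
    by (simp only: chi_add[symmetric] add.assoc)
  then have "x + chi T = x + chi S + chi (sym_diff S T)" by (simp only: vec_add_self_left)
  moreover have "sym_diff S T \<subseteq> {1..n}" using S by blast
  ultimately have "hamming_dist n (x + chi S) (x + chi T) \<le> 6"
    using hamming_dist_add_chi[of "sym_diff S T" n "x + chi S"] S(3) by metis
  then have "x + chi S = x + chi T"
    using eq by (intro orb_eq_imp_eq F2_vectors_add x F2_vectors_chi S)
  then have "chi S = chi T" by (rule add_left_imp_eq)
  then show "S = T" by simp
qed simp

lemma pverts_N: "pverts N = orb ` F2_vectors n"
  by (simp add: normal_quotient_def)

lemma wf_N: "pair_wf_digraph N"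
  by (rule pair_wf_digraph_normal_quotient)

text \<open>An edge between two orbits may join other representatives. The inverse of the group
  element that moves \<open>x\<close> to its end carries the edge back to one at \<open>x\<close>,
  with direction \<open>j\<close> turned into \<open>\<sigma> j\<close>.\<close>

lemma in_parcs_N_iff:
  assumes x: "x \<in> F2_vectors n"
  shows "(orb x, B) \<in> parcs N \<longleftrightarrow> (\<exists>i \<in> {1..n}. B = orb (x + chi {i}))"
proof
  interpret group "cube_group n" by (rule group_aut_group)
  assume "(orb x, B) \<in> parcs N"
  then obtain a b y where a: "a \<in> orb x" and b: "b \<in> orb y" "B = orb y" "y \<in> F2_vectors n"
    and ab: "(a, b) \<in> parcs (cube n)" by (auto simp: normal_quotient_def)
  obtain k where k: "k \<in> K" "a = k x" using a by (auto simp: orbit_def)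
  obtain l where l: "l \<in> K" "b = l y" using b by (auto simp: orbit_def)
  have kc: "k \<in> carrier (cube_group n)" using k subgroup.subset[OF subgroup_K] by blast
  have ki: "inv\<^bsub>cube_group n\<^esub> k \<in> K" using subgroup.m_inv_closed[OF subgroup_K k(1)] .
  then have "inv\<^bsub>cube_group n\<^esub> k \<in> affine_auts n" using even_K even_cube_group_subset by blast
  then obtain t \<sigma> where i: "inv\<^bsub>cube_group n\<^esub> k = cube_aut n t \<sigma>" "\<sigma> permutes {1..n}"
    by (metis affine_autsE)
  have aF: "a \<in> F2_vectors n" and bF: "b \<in> F2_vectors n" using ab by (auto simp: cube_def)
  obtain j where j: "j \<in> {1..n}" "b = a + chi {j}" using ab in_parcs_cube_iff[OF aF] by blast
  have "{j} \<subseteq> {1..n}" using j by blast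
  then have "(inv\<^bsub>cube_group n\<^esub> k) b = (inv\<^bsub>cube_group n\<^esub> k) a + chi (\<sigma> ` {j})"
    unfolding i(1) j(2) by (rule cube_aut_add_chi[OF aF i(2)])
  also have "(inv\<^bsub>cube_group n\<^esub> k) a = x" using cube_group_inv_apply(1)[OF kc x] k(2) by simp
  also have "\<sigma> ` {j} = {\<sigma> j}" by simp
  finally have kb: "(inv\<^bsub>cube_group n\<^esub> k) b = x + chi {\<sigma> j}" .
  have sj: "\<sigma> j \<in> {1..n}" using permutes_in_image[OF i(2)] j by blast
  have "x + chi {\<sigma> j} \<in> F2_vectors n" using sj by (intro F2_vectors_add x F2_vectors_chi) blast
  then have "orb b = orb (x + chi {\<sigma> j})" using orb_eq_iff[OF bF] ki kb by metis
  moreover have "orb y = orb b" using orb_eq_iff[OF b(3) bF] l by blast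
  ultimately show "\<exists>i \<in> {1..n}. B = orb (x + chi {i})" using sj b(2) by auto
next
  assume "\<exists>i \<in> {1..n}. B = orb (x + chi {i})"
  then obtain i where i: "i \<in> {1..n}" "B = orb (x + chi {i})" by blast
  have iS: "{i} \<subseteq> {1..n}" using i by blast
  have y: "x + chi {i} \<in> F2_vectors n" using F2_vectors_add[OF x F2_vectors_chi[OF iS]] .
  have "orb (x + chi {}) \<noteq> orb (x + chi {i})" using orb_add_chi_eq_iff[OF x _ iS, of "{}"] by simp
  then have "orb x \<noteq> B" using i(2) by simp
  moreover have "z \<in> orb z" if "z \<in> F2_vectors n" for z
    unfolding orbit_def using subgroup.one_closed[OF subgroup_K] cube_group_one_apply[OF that]
    by (metis imageI)
  moreover have "(x, x + chi {i}) \<in> parcs (cube n)" using in_parcs_cube_iff[OF x] i by blast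
  ultimately show "(orb x, B) \<in> parcs N" using i(2) x y unfolding normal_quotient_def by auto
qed

lemma sym_N: "sym (parcs N)"
proof (rule symI)
  fix A B assume AB: "(A, B) \<in> parcs N"
  then obtain x where x: "x \<in> F2_vectors n" "A = orb x" by (auto simp: normal_quotient_def)
  then obtain i where i: "i \<in> {1..n}" "B = orb (x + chi {i})" using in_parcs_N_iff AB by blast
  then have "x + chi {i} \<in> F2_vectors n" using x by (intro F2_vectors_add F2_vectors_chi) auto
  moreover have "x = x + chi {i} + chi {i}" by (simp only: add.assoc vec_add_self add_0_right)
  ultimately show "(B, A) \<in> parcs N" using in_parcs_N_iff i x(2) by metis
qed

text \<open>The sides are the images of the two parity classes. They are disjoint because an even
  group never mixes parities.\<close>

lemma bipartite_N: "bipartite N"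
  unfolding bipartite_def
proof (intro exI conjI)
  have "x \<in> parity_class n 0 \<union> parity_class n 1" if "x \<in> F2_vectors n" for x
    using that by (cases "parity n x") (simp_all add: parity_class_def)
  then show "orb ` parity_class n 0 \<union> orb ` parity_class n 1 = pverts N"
    unfolding pverts_N using parity_class_subset by blast
  show "orb ` parity_class n 0 \<inter> orb ` parity_class n 1 = {}"
  proof (rule ccontr)
    assume "orb ` parity_class n 0 \<inter> orb ` parity_class n 1 \<noteq> {}"
    then obtain x y where xy: "x \<in> parity_class n 0" "y \<in> parity_class n 1" "orb x = orb y" by auto
    then have "parity n x = parity n y" using orb_eq_parity parity_class_subset by blast
    then show False using xy by (simp add: parity_class_def)
  qed
  have edge: "\<exists>x y. x \<in> F2_vectors n \<and> y \<in> F2_vectors n \<and> A = orb x \<and> B = orb y \<and> parity n x \<noteq> parity n y"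
    if AB: "(A, B) \<in> parcs N" for A B
  proof -
    obtain x where x: "x \<in> F2_vectors n" "A = orb x" using AB by (auto simp: normal_quotient_def)
    then obtain i where i: "i \<in> {1..n}" "B = orb (x + chi {i})" using in_parcs_N_iff AB by blast
    have iS: "{i} \<subseteq> {1..n}" using i by blast
    have "parity n (x + chi {i}) = parity n x + 1" using parity_chi[OF iS] by (simp only: parity_add) simp
    then have "parity n x \<noteq> parity n (x + chi {i})" by (cases "parity n x") auto
    then show ?thesis using x i F2_vectors_add[OF x(1) F2_vectors_chi[OF iS]] by blast
  qed
  show "\<forall>(u, v) \<in> parcs N. u \<in> orb ` parity_class n 0 \<and> v \<in> orb ` parity_class n 1 \<or>
      u \<in> orb ` parity_class n 1 \<and> v \<in> orb ` parity_class n 0"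
  proof (clarify)
    fix A B assume "(A, B) \<in> parcs N" and other: "\<not> (A \<in> orb ` parity_class n 1 \<and> B \<in> orb ` parity_class n 0)"
    then obtain x y where xy: "x \<in> F2_vectors n" "y \<in> F2_vectors n" "A = orb x" "B = orb y"
      "parity n x \<noteq> parity n y" using edge by blast
    have "parity n x = 0 \<and> parity n y = 1 \<or> parity n x = 1 \<and> parity n y = 0"
      using xy(5) by (cases "parity n x"; cases "parity n y") simp_all
    then show "A \<in> orb ` parity_class n 0 \<and> B \<in> orb ` parity_class n 1"
      using xy other by (auto simp: parity_class_def)
  qed
qed

lemma connected_N: "connected (with_proj N)"
  unfolding connected_conv_rtrancl[OF wf_N sym_N]
proof (intro conjI ballI)
  show "pverts N \<noteq> {}" using F2_vectors_zero by (auto simp: pverts_N)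
  fix A B assume "A \<in> pverts N" "B \<in> pverts N"
  then obtain x y where x: "x \<in> F2_vectors n" "A = orb x" and y: "y \<in> F2_vectors n" "B = orb y"
    by (auto simp: pverts_N)
  have "(orb x, orb (x + chi S)) \<in> (parcs N)\<^sup>*" if "finite S" "S \<subseteq> {1..n}" for S
    using that
  proof (induction S rule: finite_induct)
    case empty
    show ?case unfolding chi_empty add_0_right by (rule rtrancl.rtrancl_refl)
  next
    case (insert i S)
    have S: "S \<subseteq> {1..n}" "i \<in> {1..n}" using insert.prems by blast+
    have "chi (insert i S) = chi S + chi {i}" using insert.hyps chi_disjoint_Un[of S "{i}"] by simp
    then have "x + chi (insert i S) = x + chi S + chi {i}" by (simp only: add.assoc)
    then have "(orb (x + chi S), orb (x + chi (insert i S))) \<in> parcs N"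
      using in_parcs_N_iff[OF F2_vectors_add[OF x(1) F2_vectors_chi[OF S(1)]]] S(2) by metis
    then show ?case using insert.IH[OF S(1)] by (meson rtrancl.rtrancl_into_rtrancl)
  qed
  from this[OF finite_supp supp_subset, of "x + y"] show "(A, B) \<in> (parcs N)\<^sup>*"
    using chi_supp[OF F2_vectors_add[OF x(1) y(1)]] x y by (metis vec_add_self_left)
qed

text \<open>Two steps in the same direction return to \<open>x\<close>, so distance 2 means two
  different directions. Conversely, displacement keeps \<open>x + chi P\<close> out of the orbit of
  \<open>x\<close>, and parity keeps its orbit from being adjacent to that of
  \<open>x\<close>.\<close>

lemma in_parcs_D_iff:
  assumes x: "x \<in> F2_vectors n"
  shows "(orb x, B) \<in> parcs D \<longleftrightarrow> (\<exists>P \<in> pairs n. B = orb (x + chi P))"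
proof -
  have xN: "orb x \<in> pverts N" using x by (simp add: pverts_N)
  have two: "(\<exists>C. (orb x, C) \<in> parcs N \<and> (C, B) \<in> parcs N) \<longleftrightarrow>
      (\<exists>i \<in> {1..n}. \<exists>j \<in> {1..n}. B = orb (x + chi {i} + chi {j}))"
  proof -
    have "(orb (x + chi {i}), B) \<in> parcs N \<longleftrightarrow> (\<exists>j \<in> {1..n}. B = orb (x + chi {i} + chi {j}))"
      if "i \<in> {1..n}" for i
      using that by (intro in_parcs_N_iff F2_vectors_add x F2_vectors_chi) auto
    then show ?thesis using in_parcs_N_iff[OF x] by metis
  qed
  have "(orb x, B) \<in> parcs D \<longleftrightarrow> B \<in> pverts N \<and> graph_dist N (orb x) B = 2"
    using xN by (simp add: distance2_graph_def)
  also have "\<dots> \<longleftrightarrow> B \<in> pverts N \<and> orb x \<noteq> B \<and> (orb x, B) \<notin> parcs N \<and>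
      (\<exists>i \<in> {1..n}. \<exists>j \<in> {1..n}. B = orb (x + chi {i} + chi {j}))"
    unfolding graph_dist_eq_2_iff[OF wf_N xN] two ..
  also have "\<dots> \<longleftrightarrow> (\<exists>P \<in> pairs n. B = orb (x + chi P))"
  proof
    assume "B \<in> pverts N \<and> orb x \<noteq> B \<and> (orb x, B) \<notin> parcs N \<and>
      (\<exists>i \<in> {1..n}. \<exists>j \<in> {1..n}. B = orb (x + chi {i} + chi {j}))"
    then obtain i j where ij: "i \<in> {1..n}" "j \<in> {1..n}" "B = orb (x + chi {i} + chi {j})" "orb x \<noteq> B"
      by blast
    have "i \<noteq> j"
    proof
      assume "i = j"
      then have "x + chi {i} + chi {j} = x" by (simp only: add.assoc vec_add_self add_0_right)
      then show False using ij by metis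
    qed
    then have "{i, j} \<in> pairs n" "chi {i, j} = chi {i} + chi {j}"
      using ij chi_disjoint_Un[of "{i}" "{j}"] by (simp_all add: doubleton_in_pairs insert_commute)
    then show "\<exists>P \<in> pairs n. B = orb (x + chi P)" using ij(3) by (metis add.assoc)
  next
    assume "\<exists>P \<in> pairs n. B = orb (x + chi P)"
    then obtain P where P: "P \<in> pairs n" "B = orb (x + chi P)" by blast
    obtain i j where ij: "P = {i, j}" "i \<noteq> j" "i \<in> {1..n}" "j \<in> {1..n}" using P(1) by (rule pairsE)
    have PF: "x + chi P \<in> F2_vectors n" using F2_vectors_add[OF x F2_vectors_chi[OF pairs_subset[OF P(1)]]] .
    have "card (sym_diff {} P) \<le> 6" using P(1) by (simp add: pairs_def)
    then have "orb (x + chi {}) \<noteq> orb (x + chi P)"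
      using orb_add_chi_eq_iff[OF x _ pairs_subset[OF P(1)], of "{}"] P(1) empty_not_in_pairs by auto
    then have "orb x \<noteq> B" using P(2) by simp
    moreover have "(orb x, B) \<notin> parcs N"
    proof
      assume "(orb x, B) \<in> parcs N"
      then obtain l where l: "l \<in> {1..n}" "orb (x + chi P) = orb (x + chi {l})"
        using in_parcs_N_iff[OF x] P(2) by metis
      have lS: "{l} \<subseteq> {1..n}" using l by blast
      have "parity n (x + chi P) = parity n (x + chi {l})"
        using l F2_vectors_add[OF x F2_vectors_chi[OF lS]] by (intro orb_eq_parity[OF PF])
      then have "parity n (chi P) = parity n (chi {l})" by (simp only: parity_add add_left_cancel)
      then show False
        using parity_chi[OF pairs_subset[OF P(1)]] parity_chi[OF lS] P(1) by (simp add: pairs_def)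
    qed
    moreover have "chi P = chi {i} + chi {j}"
      using ij chi_disjoint_Un[of "{i}" "{j}"] by (simp add: insert_commute)
    then have "B = orb (x + chi {i} + chi {j})" using P(2) by (simp only: add.assoc)
    moreover have "B \<in> pverts N" using P(2) PF by (simp add: pverts_N)
    ultimately show "B \<in> pverts N \<and> orb x \<noteq> B \<and> (orb x, B) \<notin> parcs N \<and>
      (\<exists>i \<in> {1..n}. \<exists>j \<in> {1..n}. B = orb (x + chi {i} + chi {j}))" using ij by blast
  qed
  finally show ?thesis .
qed

text \<open>Every comparison of orbits that the frame condition demands concerns vectors at distance
  at most 6, where equality of orbits is equality of vectors. The neighbourhoods are thus those of
  the halved cube.\<close>

lemma is_cover_orb: "is_cover n (parcs D) c orb"
  unfolding is_cover_def
proof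
  fix x assume "x \<in> parity_class n c"
  then have x: "x \<in> F2_vectors n" using parity_class_subset by blast
  have small: "card (sym_diff S T) \<le> 6" if "card S \<le> 3" "card T \<le> 3" "finite S" "finite T" for S T :: "nat set"
  proof -
    have "card (sym_diff S T) \<le> card (S \<union> T)" using that by (intro card_mono) auto
    also have "\<dots> \<le> card S + card T" by (rule card_Un_le)
    finally show ?thesis using that by simp
  qed
  have pair: "finite P" "P \<subseteq> {1..n}" "card P = 2" if "P \<in> pairs n" for P
    using that finite_subset[of P "{1..n}"] by (auto simp: pairs_def)
  have inj: "orb (x + chi P) = orb (x + chi Q) \<longleftrightarrow> P = Q" if "P \<in> pairs n" "Q \<in> pairs n" for P Q
    using that by (intro orb_add_chi_eq_iff x small pair) (simp_all add: pair)
  show "frame n (parcs D) (\<lambda>P. orb (x + chi P))"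
    unfolding frame_def
  proof (intro conjI ballI)
    show "inj_on (\<lambda>P. orb (x + chi P)) (pairs n)" using inj by (intro inj_onI) blast
    show "(\<lambda>P. orb (x + chi P)) ` pairs n = parcs D `` {orb (x + chi {})}"
      unfolding chi_empty add_0_right using in_parcs_D_iff[OF x] by blast
    fix P Q assume PQ: "P \<in> pairs n" "Q \<in> pairs n"
    have P: "x + chi P \<in> F2_vectors n" using F2_vectors_add[OF x F2_vectors_chi[OF pair(2)[OF PQ(1)]]] .
    have "(orb (x + chi P), orb (x + chi Q)) \<in> parcs D \<longleftrightarrow> (\<exists>R \<in> pairs n. orb (x + chi Q) = orb (x + chi P + chi R))"
      by (rule in_parcs_D_iff[OF P])
    \<comment> \<open>The step from \<open>x + chi P\<close> to \<open>x + chi Q\<close> is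
      \<open>chi (sym_diff P Q)\<close>, so adjacency asks whether this set is a pair.\<close>
    also have "\<dots> \<longleftrightarrow> (\<exists>R \<in> pairs n. R = sym_diff P Q)"
    proof (rule bex_cong[OF refl])
      fix R assume R: "R \<in> pairs n"
      let ?T = "sym_diff P Q"
      have T: "?T \<subseteq> {1..n}" using pair PQ by blast
      have "chi Q = chi P + chi ?T" by (simp only: chi_add[symmetric] vec_add_self_left)
      then have "x + chi Q = x + chi P + chi ?T" by (simp only: add.assoc)
      moreover have "orb (x + chi P + chi ?T) = orb (x + chi P + chi R) \<longleftrightarrow> ?T = R"
      proof (rule orb_add_chi_eq_iff[OF P T pair(2)[OF R]])
        \<comment> \<open>Three pairs span at most six coordinates: the full strength of
          displacement 7 is used here.\<close>
        have "card (sym_diff ?T R) \<le> card (P \<union> Q \<union> R)" using pair PQ R by (intro card_mono) auto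
        also have "\<dots> \<le> card P + card Q + card R"
          using card_Un_le[of "P \<union> Q" R] card_Un_le[of P Q] by linarith
        finally show "card (sym_diff ?T R) \<le> 6" using pair PQ R by simp
      qed
      ultimately show "orb (x + chi Q) = orb (x + chi P + chi R) \<longleftrightarrow> R = ?T" by metis
    qed
    also have "\<dots> \<longleftrightarrow> card (P \<inter> Q) = 1"
    proof -
      have "card (sym_diff P Q) = card (P - Q) + card (Q - P)"
        using pair PQ by (intro card_Un_disjoint) auto
      moreover have "card (P - Q) = 2 - card (P \<inter> Q)" "card (Q - P) = 2 - card (P \<inter> Q)"
        using card_Diff_subset_Int[of P Q] card_Diff_subset_Int[of Q P] pair PQ
        by (simp_all add: Int_commute)
      moreover have "card (P \<inter> Q) \<le> 2" using card_mono[of P "P \<inter> Q"] pair PQ by simp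
      ultimately have "card (sym_diff P Q) = 2 \<longleftrightarrow> card (P \<inter> Q) = 1" by auto
      moreover have "sym_diff P Q \<subseteq> {1..n}" using pair PQ by blast
      ultimately show ?thesis by (auto simp: pairs_def)
    qed
    finally show "(orb (x + chi P), orb (x + chi Q)) \<in> parcs D \<longleftrightarrow> card (P \<inter> Q) = 1" .
  qed
qed

lemma pverts_D: "pverts D = orb ` F2_vectors n"
  by (simp add: distance2_graph_def pverts_N)

text \<open>For each parity class the orbit map is a cover of the distance 2 graph, so lifting of
  paths and connectedness of the halved cube identify its image as one component.\<close>

lemma sccs_D: "pre_digraph.sccs (with_proj D) = {with_proj D \<restriction> orb ` parity_class n c | c. True}"
proof -
  interpret D: pair_wf_digraph D by unfold_locales (auto simp: distance2_graph_def)
  have scc: "D.scc_of (orb x) = orb ` parity_class n c" if x: "x \<in> parity_class n c" for x c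
  proof -
    have v: "orb y \<in> pverts D" if "y \<in> parity_class n c" for y
      using that parity_class_subset by (auto simp: pverts_D)
    have "B \<in> D.scc_of (orb x) \<longleftrightarrow> B \<in> orb ` parity_class n c" for B
    proof
      assume "B \<in> D.scc_of (orb x)"
      then have "(orb x, B) \<in> (parcs D)\<^sup>*" by (simp add: D.scc_of_def D.reachable_conv)
      then show "B \<in> orb ` parity_class n c" by (rule is_cover_onto[OF is_cover_orb x])
    next
      assume "B \<in> orb ` parity_class n c"
      then obtain y where y: "y \<in> parity_class n c" "B = orb y" by blast
      then show "B \<in> D.scc_of (orb x)"
        using is_cover_reachable[OF is_cover_orb x y(1)] is_cover_reachable[OF is_cover_orb y(1) x] v x
        by (simp add: D.scc_of_def D.reachable_conv)
    qed
    then show ?thesis by blast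
  qed
  have "D.sccs_verts = {orb ` parity_class n c | c. True}"
    unfolding D.sccs_verts_conv_scc_of
  proof (intro equalityI subsetI)
    fix S assume "S \<in> D.scc_of ` pverts D"
    then obtain x where x: "x \<in> F2_vectors n" "S = D.scc_of (orb x)" by (auto simp: pverts_D)
    then have "x \<in> parity_class n (parity n x)" by (simp add: parity_class_def)
    then show "S \<in> {orb ` parity_class n c | c. True}" using scc x(2) by blast
  next
    fix S assume "S \<in> {orb ` parity_class n c | c. True}"
    then obtain c where S: "S = orb ` parity_class n c" by blast
    obtain x where x: "x \<in> parity_class n c" using parity_class_nonempty[OF n_pos] .
    then have "orb x \<in> pverts D" using parity_class_subset by (auto simp: pverts_D)
    then show "S \<in> D.scc_of ` pverts D" using scc[OF x] S by blast
  qed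
  then show ?thesis unfolding D.sccs_conv_sccs_verts by auto
qed

end


section \<open>Halved graphs and covers\<close>

text \<open>Both images are the quotient of the class by the same equivalence, and a cover lets
  adjacency be read off from the steps \<open>chi P\<close> upstairs.\<close>

lemma covers_with_same_kernel:
  assumes p: "is_cover n E c p" and q: "is_cover n E' c q"
    and ker: "\<And>x y. \<lbrakk>x \<in> parity_class n c; y \<in> parity_class n c\<rbrakk> \<Longrightarrow> p x = p y \<longleftrightarrow> q x = q y"
  obtains f where "bij_betw f (p ` parity_class n c) (q ` parity_class n c)"
    "\<And>u v. \<lbrakk>u \<in> p ` parity_class n c; v \<in> p ` parity_class n c\<rbrakk> \<Longrightarrow> (u, v) \<in> E \<longleftrightarrow> (f u, f v) \<in> E'"
proof -
  let ?C = "parity_class n c"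
  define f where "f u = q (inv_into ?C p u)" for u
  have f: "f (p x) = q x" if x: "x \<in> ?C" for x
  proof -
    have "inv_into ?C p (p x) \<in> ?C" "p (inv_into ?C p (p x)) = p x"
      using x inv_into_into[of "p x" p ?C] f_inv_into_f[of "p x" p ?C] by blast+
    then show ?thesis unfolding f_def using ker x by blast
  qed
  have "bij_betw f (p ` ?C) (q ` ?C)"
    unfolding bij_betw_def
  proof
    show "inj_on f (p ` ?C)"
    proof (rule inj_onI)
      fix u v assume "u \<in> p ` ?C" "v \<in> p ` ?C" "f u = f v"
      then obtain x y where "x \<in> ?C" "y \<in> ?C" "u = p x" "v = p y" "q x = q y" using f by auto
      then show "u = v" using ker by blast
    qed
    show "f ` p ` ?C = q ` ?C" using f by (auto simp: image_image)
  qed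
  moreover have "(u, v) \<in> E \<longleftrightarrow> (f u, f v) \<in> E'" if uv: "u \<in> p ` ?C" "v \<in> p ` ?C" for u v
  proof -
    obtain x y where xy: "x \<in> ?C" "y \<in> ?C" "u = p x" "v = p y" using uv by blast
    have "(u, v) \<in> E \<longleftrightarrow> (\<exists>P \<in> pairs n. p y = p (x + chi P))"
      using is_cover_adj[OF p xy(1)] xy by blast
    also have "\<dots> \<longleftrightarrow> (\<exists>P \<in> pairs n. q y = q (x + chi P))"
      using ker[OF xy(2)] parity_class_add_pair[OF xy(1)] by blast
    also have "\<dots> \<longleftrightarrow> (f u, f v) \<in> E'" using is_cover_adj[OF q xy(1)] f xy by simp
    finally show ?thesis .
  qed
  ultimately show ?thesis by (rule that)
qed

lemma is_cover_transfer:
  assumes q: "is_cover n E c q" and f: "bij_betw f V (q ` parity_class n c)"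
    and adj: "\<And>u v. \<lbrakk>u \<in> V; v \<in> V\<rbrakk> \<Longrightarrow> (u, v) \<in> E' \<longleftrightarrow> (f u, f v) \<in> E"
    and sub: "E' \<subseteq> V \<times> V"
  obtains p where "is_cover n E' c p" "p ` parity_class n c = V"
    "\<And>x y. \<lbrakk>x \<in> parity_class n c; y \<in> parity_class n c\<rbrakk> \<Longrightarrow> p x = p y \<longleftrightarrow> q x = q y"
proof -
  let ?C = "parity_class n c"
  define p where "p x = inv_into V f (q x)" for x
  have fp: "f (p x) = q x" and pV: "p x \<in> V" if "x \<in> ?C" for x
    using that bij_betw_inv_into_right[OF f] bij_betwE[OF bij_betw_inv_into[OF f]]
    by (auto simp: p_def)
  have ker: "p x = p y \<longleftrightarrow> q x = q y" if "x \<in> ?C" "y \<in> ?C" for x y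
    using fp that unfolding p_def by metis
  have img: "p ` ?C = V"
    using bij_betw_inv_into[OF f] unfolding p_def bij_betw_def by (simp add: image_image)
  have pq: "(p x, p y) \<in> E' \<longleftrightarrow> (q x, q y) \<in> E" if "x \<in> ?C" "y \<in> ?C" for x y
    using adj[OF pV pV] fp that by simp
  have "is_cover n E' c p"
    unfolding is_cover_def
  proof
    fix x assume x: "x \<in> ?C"
    note cl = parity_class_add_pair[OF x]
    show "frame n E' (\<lambda>P. p (x + chi P))"
      unfolding frame_def chi_empty add_0_right
    proof (intro conjI ballI)
      show "inj_on (\<lambda>P. p (x + chi P)) (pairs n)"
        using ker[OF cl cl] is_cover_inj[OF q x] by (intro inj_onI) blast
      show "(\<lambda>P. p (x + chi P)) ` pairs n = E' `` {p x}"
      proof (intro equalityI subsetI)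
        fix w assume "w \<in> (\<lambda>P. p (x + chi P)) ` pairs n"
        then show "w \<in> E' `` {p x}" using pq[OF x cl] is_cover_adj[OF q x] by blast
      next
        fix w assume "w \<in> E' `` {p x}"
        then have w: "(p x, w) \<in> E'" by blast
        then obtain y where y: "y \<in> ?C" "w = p y" using sub img by blast
        then obtain P where P: "P \<in> pairs n" "q y = q (x + chi P)"
          using pq[OF x y(1)] w is_cover_adj[OF q x] by blast
        then show "w \<in> (\<lambda>P. p (x + chi P)) ` pairs n" using ker[OF y(1) cl] y by blast
      qed
      show "(p (x + chi P), p (x + chi Q)) \<in> E' \<longleftrightarrow> card (P \<inter> Q) = 1"
        if "P \<in> pairs n" "Q \<in> pairs n" for P Q
        using pq[OF cl cl] frame_adj[OF is_coverD[OF q x]] that by blast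
    qed
  qed
  then show ?thesis using img ker by (rule that)
qed

context cube_quotient
begin

text \<open>The bridge between the two descriptions: a halved graph of the quotient is a graph
  covered by one half of the cube with the orbits of \<open>K\<close> as fibres. Existence and
  conjugacy can then be treated on covers.\<close>

lemma is_halved_graph_iff:
  assumes G: "pair_wf_digraph \<Gamma>"
  shows "is_halved_graph \<Gamma> N \<longleftrightarrow> (\<exists>c p. is_cover n (parcs \<Gamma>) c p \<and> p ` parity_class n c = pverts \<Gamma> \<and>
    (\<forall>x \<in> parity_class n c. \<forall>y \<in> parity_class n c. p x = p y \<longleftrightarrow> orb x = orb y))"
proof -
  interpret pair_wf_digraph \<Gamma> by fact
  interpret D: pair_wf_digraph D by unfold_locales (auto simp: distance2_graph_def)
  have conv: "digraph_iso (with_proj \<Gamma>) (with_proj D \<restriction> orb ` parity_class n c) \<longleftrightarrow>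
      (\<exists>f. bij_betw f (pverts \<Gamma>) (orb ` parity_class n c) \<and>
        (\<forall>u \<in> pverts \<Gamma>. \<forall>v \<in> pverts \<Gamma>. (u, v) \<in> parcs \<Gamma> \<longleftrightarrow> (f u, f v) \<in> parcs D))" for c
  proof -
    have "wf_digraph (with_proj D \<restriction> orb ` parity_class n c)" by (rule D.wellformed_induce_subgraph)
    note digraph_iso_conv[OF wf_with_proj[OF G] this]
    then have "digraph_iso (with_proj \<Gamma>) (with_proj D \<restriction> orb ` parity_class n c) \<longleftrightarrow>
      (\<exists>f. bij_betw f (pverts \<Gamma>) (orb ` parity_class n c) \<and>
        (\<forall>u \<in> pverts \<Gamma>. \<forall>v \<in> pverts \<Gamma>. (u, v) \<in> parcs \<Gamma> \<longleftrightarrow>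
          (f u, f v) \<in> parcs D \<and> f u \<in> orb ` parity_class n c \<and> f v \<in> orb ` parity_class n c))"
      by simp
    also have "\<dots> \<longleftrightarrow> (\<exists>f. bij_betw f (pverts \<Gamma>) (orb ` parity_class n c) \<and>
        (\<forall>u \<in> pverts \<Gamma>. \<forall>v \<in> pverts \<Gamma>. (u, v) \<in> parcs \<Gamma> \<longleftrightarrow> (f u, f v) \<in> parcs D))"
      by (intro ex_cong1 conj_cong refl ball_cong) (auto dest: bij_betwE)
    finally show ?thesis .
  qed
  have "is_halved_graph \<Gamma> N \<longleftrightarrow>
      (\<exists>c. digraph_iso (with_proj \<Gamma>) (with_proj D \<restriction> orb ` parity_class n c))"
    unfolding is_halved_graph_def sccs_D using connected_N bipartite_N by blast
  also have "\<dots> \<longleftrightarrow> (\<exists>c p. is_cover n (parcs \<Gamma>) c p \<and> p ` parity_class n c = pverts \<Gamma> \<and>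
      (\<forall>x \<in> parity_class n c. \<forall>y \<in> parity_class n c. p x = p y \<longleftrightarrow> orb x = orb y))"
    unfolding conv
  proof (intro iffI; elim exE conjE)
    fix c f assume f: "bij_betw f (pverts \<Gamma>) (orb ` parity_class n c)"
      and adj: "\<forall>u \<in> pverts \<Gamma>. \<forall>v \<in> pverts \<Gamma>. (u, v) \<in> parcs \<Gamma> \<longleftrightarrow> (f u, f v) \<in> parcs D"
    have "parcs \<Gamma> \<subseteq> pverts \<Gamma> \<times> pverts \<Gamma>" using wellformed' by auto
    then obtain p where "is_cover n (parcs \<Gamma>) c p" "p ` parity_class n c = pverts \<Gamma>"
      "\<And>x y. \<lbrakk>x \<in> parity_class n c; y \<in> parity_class n c\<rbrakk> \<Longrightarrow> p x = p y \<longleftrightarrow> orb x = orb y"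
      using is_cover_transfer[OF is_cover_orb f, of "parcs \<Gamma>"] adj by blast
    then show "\<exists>c p. is_cover n (parcs \<Gamma>) c p \<and> p ` parity_class n c = pverts \<Gamma> \<and>
      (\<forall>x \<in> parity_class n c. \<forall>y \<in> parity_class n c. p x = p y \<longleftrightarrow> orb x = orb y)" by blast
  next
    fix c p assume p: "is_cover n (parcs \<Gamma>) c p" "p ` parity_class n c = pverts \<Gamma>"
      "\<forall>x \<in> parity_class n c. \<forall>y \<in> parity_class n c. p x = p y \<longleftrightarrow> orb x = orb y"
    obtain f where "bij_betw f (p ` parity_class n c) (orb ` parity_class n c)"
      "\<And>u v. \<lbrakk>u \<in> p ` parity_class n c; v \<in> p ` parity_class n c\<rbrakk> \<Longrightarrow>
        (u, v) \<in> parcs \<Gamma> \<longleftrightarrow> (f u, f v) \<in> parcs D"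
      using covers_with_same_kernel[OF p(1) is_cover_orb[of c]] p(3) by blast
    then show "\<exists>c f. bij_betw f (pverts \<Gamma>) (orb ` parity_class n c) \<and>
        (\<forall>u \<in> pverts \<Gamma>. \<forall>v \<in> pverts \<Gamma>. (u, v) \<in> parcs \<Gamma> \<longleftrightarrow> (f u, f v) \<in> parcs D)"
      unfolding p(2) by blast
  qed
  finally show ?thesis .
qed

end

section \<open>The two implications and uniqueness up to conjugacy\<close>

lemma connected_locally_triangular_if_cover:
  assumes G: "pair_wf_digraph \<Gamma>" "sym (parcs \<Gamma>)" and n: "1 \<le> n"
    and p: "is_cover n (parcs \<Gamma>) c p" "p ` parity_class n c = pverts \<Gamma>"
  shows "connected (with_proj \<Gamma>) \<and> is_locally \<Gamma> (triangular_graph n)"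
proof
  show "connected (with_proj \<Gamma>)"
    unfolding connected_conv_rtrancl[OF G] p(2)[symmetric]
    using parity_class_nonempty[OF n, of c] is_cover_reachable[OF p(1)] by blast
  show "is_locally \<Gamma> (triangular_graph n)"
    unfolding is_locally_triangular_iff[OF G(1)] p(2)[symmetric]
  proof
    fix u assume "u \<in> p ` parity_class n c"
    then obtain x where x: "x \<in> parity_class n c" "u = p x" by blast
    then show "\<exists>f. frame n (parcs \<Gamma>) f \<and> f {} = u"
      using is_coverD[OF p(1) x(1)] by (intro exI[of _ "\<lambda>P. p (x + chi P)"]) simp
  qed
qed

lemma cover_if_connected_locally_triangular:
  assumes G: "pair_wf_digraph \<Gamma>" "sym (parcs \<Gamma>)" "irrefl (parcs \<Gamma>)"
    and con: "connected (with_proj \<Gamma>)" and loc: "is_locally \<Gamma> (triangular_graph n)"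
  obtains p where "is_cover n (parcs \<Gamma>) 0 p" "p ` parity_class n 0 = pverts \<Gamma>"
proof -
  interpret pair_wf_digraph \<Gamma> by fact
  have frames: "\<exists>f. frame n (parcs \<Gamma>) f \<and> f {} = u" if "u \<in> pverts \<Gamma>" for u
    using loc that is_locally_triangular_iff[OF G(1)] by blast
  interpret locally_triangular_rel n "parcs \<Gamma>"
    using G frames in_arcsD2 by unfold_locales blast+
  obtain v where v: "v \<in> pverts \<Gamma>" and reach: "\<And>w. w \<in> pverts \<Gamma> \<Longrightarrow> (v, w) \<in> (parcs \<Gamma>)\<^sup>*"
    using con unfolding connected_conv_rtrancl[OF G(1,2)] by blast
  obtain f where "frame n (parcs \<Gamma>) f" "f {} = v" using frames[OF v] by blast
  then obtain p where p: "\<And>x. frame n (parcs \<Gamma>) (\<lambda>P. p (x + chi P))" "p 0 = v"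
    using ex_cover by metis
  have cov: "is_cover n (parcs \<Gamma>) 0 p" using p(1) by (simp add: is_cover_def)
  have zero: "0 \<in> parity_class n 0"
    using F2_vectors_zero by (simp add: parity_class_def parity_def)
  have "p ` parity_class n 0 = pverts \<Gamma>"
  proof
    show "pverts \<Gamma> \<subseteq> p ` parity_class n 0"
      using is_cover_onto[OF cov zero] reach p(2) by blast
    show "p ` parity_class n 0 \<subseteq> pverts \<Gamma>"
    proof
      fix w assume "w \<in> p ` parity_class n 0"
      then have "(v, w) \<in> (parcs \<Gamma>)\<^sup>*" using is_cover_reachable[OF cov zero] p(2) by blast
      then show "w \<in> pverts \<Gamma>" using v by (induction rule: rtrancl_induct) (auto dest: in_arcsD2)
    qed
  qed
  then show ?thesis using cov that by blast
qed

lemma cube_quotient_iff: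
  assumes "1 \<le> n"
  shows "cube_quotient n K \<longleftrightarrow> subgroup K (cube_group n) \<and> K \<subseteq> even_cube_group n \<and>
    7 \<le> min_displacement (cube n) K"
proof (cases "subgroup K (cube_group n)")
  case True
  then show ?thesis
    using assms min_displacement_ge_iff[OF subgroup.subset[OF True]]
    by (auto simp: cube_quotient_def)
next
  case False
  then show ?thesis by (auto simp: cube_quotient_def)
qed

text \<open>The covers may live on different halves, so the lift between them may exchange the
  parity classes. For \<open>n \<le> 6\<close> both groups are trivial; otherwise both are deck
  groups, and any lift between the covers conjugates one into the other.\<close>

lemma conjugate_if_covers:
  assumes K: "cube_quotient n K" and L: "cube_quotient n L"
    and p: "is_cover n E c p" "p ` parity_class n c = V"
      "\<forall>x \<in> parity_class n c. \<forall>y \<in> parity_class n c. p x = p y \<longleftrightarrow> orbit K x = orbit K y"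
    and q: "is_cover n E c' q" "q ` parity_class n c' = V"
      "\<forall>x \<in> parity_class n c'. \<forall>y \<in> parity_class n c'. q x = q y \<longleftrightarrow> orbit L x = orbit L y"
  shows "conjugate_in (cube_group n) K L"
proof -
  interpret K: cube_quotient n K by fact
  interpret L: cube_quotient n L by fact
  interpret group "cube_group n" by (rule group_aut_group)
  show ?thesis
  proof (cases "n \<le> 6")
    case True
    have "K = {\<one>\<^bsub>cube_group n\<^esub>}"
      using True K.subgroup_K K.displacement_K by (rule group_trivial_if_small)
    moreover have "L = {\<one>\<^bsub>cube_group n\<^esub>}"
      using True L.subgroup_K L.displacement_K by (rule group_trivial_if_small)
    ultimately show ?thesis
      unfolding conjugate_in_def by (intro bexI[of _ "\<one>\<^bsub>cube_group n\<^esub>"]) simp_all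
  next
    case False
    then have n: "3 \<le> n" "5 \<le> n" by simp_all
    have F: "x \<in> F2_vectors n" if "x \<in> parity_class n d" for x d using that parity_class_subset by blast
    have "K = deck_group n c p"
    proof (rule group_eq_deck_group[OF n(1) K.subgroup_K K.even_K p(1)])
      fix x y assume xy: "x \<in> parity_class n c" "y \<in> parity_class n c"
      show "p x = p y \<longleftrightarrow> (\<exists>k \<in> K. y = k x)"
        unfolding K.orb_eq_iff[OF F[OF xy(1)] F[OF xy(2)], symmetric] using p(3) xy by blast
    qed
    moreover have "L = deck_group n c' q"
    proof (rule group_eq_deck_group[OF n(1) L.subgroup_K L.even_K q(1)])
      fix x y assume xy: "x \<in> parity_class n c'" "y \<in> parity_class n c'"
      show "q x = q y \<longleftrightarrow> (\<exists>l \<in> L. y = l x)"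
        unfolding L.orb_eq_iff[OF F[OF xy(1)] F[OF xy(2)], symmetric] using q(3) xy by blast
    qed
    moreover obtain x where x: "x \<in> parity_class n c" using parity_class_nonempty[OF K.n_pos] .
    moreover obtain y where y: "y \<in> parity_class n c'" "p x = q y" using x p(2) q(2) by (metis imageE imageI)
    moreover obtain g where "g \<in> affine_auts n"
      "\<And>z. z \<in> F2_vectors n \<Longrightarrow> g z \<in> parity_class n c' \<longleftrightarrow> z \<in> parity_class n c"
      "\<And>z. z \<in> parity_class n c \<Longrightarrow> q (g z) = p z"
      using lift_covers[OF n(2) p(1) q(1) x y] by blast
    ultimately show ?thesis using conjugate_deck_groups by blast
  qed
qed

theorem theorem1p1:
  fixes \<Gamma> :: "'a pair_pre_digraph" and n :: nat
  assumes "pair_graph \<Gamma>" and "n \<ge> 2"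
  shows "(connected (with_proj \<Gamma>) \<and> is_locally \<Gamma> (triangular_graph n) \<longleftrightarrow>
           (\<exists>K. subgroup K (aut_group (cube n)) \<and> K \<subseteq> even_cube_group n \<and>
             min_displacement (cube n) K \<ge> 7 \<and> is_halved_graph \<Gamma> (normal_quotient (cube n) K))) \<and>
         (\<forall>K L.
             subgroup K (aut_group (cube n)) \<and> K \<subseteq> even_cube_group n \<and>
             min_displacement (cube n) K \<ge> 7 \<and> is_halved_graph \<Gamma> (normal_quotient (cube n) K) \<and>
             subgroup L (aut_group (cube n)) \<and> L \<subseteq> even_cube_group n \<and>
             min_displacement (cube n) L \<ge> 7 \<and> is_halved_graph \<Gamma> (normal_quotient (cube n) L) \<longrightarrow>
             conjugate_in (aut_group (cube n)) K L)"
proof -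
  interpret \<Gamma>: pair_graph \<Gamma> by fact
  have wf: "pair_wf_digraph \<Gamma>" by unfold_locales
  have sym: "sym (parcs \<Gamma>)" using \<Gamma>.pair_sym_arcs by (simp add: symmetric_def)
  have irr: "irrefl (parcs \<Gamma>)" using \<Gamma>.pair_no_loops[of "(u, u)" for u] by (auto simp: irrefl_def)
  have n: "1 \<le> n" using assms(2) by simp
  note cover_iff = cube_quotient.is_halved_graph_iff[OF _ wf]
  have "connected (with_proj \<Gamma>) \<and> is_locally \<Gamma> (triangular_graph n) \<longleftrightarrow>
      (\<exists>K. cube_quotient n K \<and> is_halved_graph \<Gamma> (normal_quotient (cube n) K))" (is "?i \<longleftrightarrow> ?ii")
  proof
    assume ?i
    then obtain p where p: "is_cover n (parcs \<Gamma>) 0 p" "p ` parity_class n 0 = pverts \<Gamma>"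
      using cover_if_connected_locally_triangular[OF wf sym irr] by blast
    show ?ii
    proof (rule ex_group_of_cover[OF irr p(1)])
      fix K assume K: "subgroup K (cube_group n)" "K \<subseteq> even_cube_group n"
        "\<And>k x. \<lbrakk>k \<in> K; k \<noteq> \<one>\<^bsub>cube_group n\<^esub>; x \<in> F2_vectors n\<rbrakk> \<Longrightarrow> 7 \<le> hamming_dist n x (k x)"
        "\<And>x y. \<lbrakk>x \<in> parity_class n 0; y \<in> parity_class n 0\<rbrakk> \<Longrightarrow> p x = p y \<longleftrightarrow> (\<exists>k \<in> K. y = k x)"
      have quo: "cube_quotient n K" using n K(1-3) by (rule cube_quotient.intro)
      have "p x = p y \<longleftrightarrow> orbit K x = orbit K y"
        if "x \<in> parity_class n 0" "y \<in> parity_class n 0" for x y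
        using K(4)[OF that] orbit_eq_iff[OF K(1)] that parity_class_subset by blast
      then show ?ii using cover_iff[OF quo] quo p by blast
    qed
  next
    assume ?ii
    then show ?i
      using cover_iff connected_locally_triangular_if_cover[OF wf sym n] by blast
  qed
  moreover have "conjugate_in (cube_group n) K L"
    if halved: "cube_quotient n K" "is_halved_graph \<Gamma> (normal_quotient (cube n) K)"
      "cube_quotient n L" "is_halved_graph \<Gamma> (normal_quotient (cube n) L)" for K L
  proof -
    obtain c p where p: "is_cover n (parcs \<Gamma>) c p" "p ` parity_class n c = pverts \<Gamma>"
      "\<forall>x \<in> parity_class n c. \<forall>y \<in> parity_class n c. p x = p y \<longleftrightarrow> orbit K x = orbit K y"
      using halved(2) unfolding cover_iff[OF halved(1)] by blast
    obtain c' q where q: "is_cover n (parcs \<Gamma>) c' q" "q ` parity_class n c' = pverts \<Gamma>"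
      "\<forall>x \<in> parity_class n c'. \<forall>y \<in> parity_class n c'. q x = q y \<longleftrightarrow> orbit L x = orbit L y"
      using halved(4) unfolding cover_iff[OF halved(3)] by blast
    show ?thesis by (rule conjugate_if_covers[OF halved(1,3) p q])
  qed
  ultimately show ?thesis unfolding cube_quotient_iff[OF n] by blast
qed

end
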